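(* Let $\mathcal{M}_1$ be a model of $\phi$ of cardinality $\aleph_1$. Then for every linear ordering $(L,<)$ with $|L|=\kappa\ge\aleph_1$ there is a model $\mathcal{G}^*$ of $\phi_{\mathcal{F}}$ of cardinality $\kappa$ with $M(\mathcal{G}^* )=\mathcal{M}_1$, and a one-to-one function $F:L\to V(\mathcal{G}^* )$ such that $x<y$ iff $F(x)\triangleleft F(y)$ for all $x,y\in L$, and $F(x)$ is $0$-colored for every $x\in L$.
   Context: Fix a countable structure $\mathcal{M}$ in a countable language $\mathcal{L}_0$ containing a binary relation symbol $<$ interpreted as a linear order on $\mathcal{M}$, whose Scott sentence $\phi$ has a model of cardinality $\aleph_1$ but none of cardinality $\aleph_2$. Let $\mathcal{L}$ extend $\mathcal{L}_0$ by unary predicates $V,M,N$, a binary relation $\triangleleft$ and a binary function symbol $f$. $K(\mathcal{M})$ is the class of countable $\mathcal{L}$-structures $\mathcal{A}$ such that: (1) $V(\mathcal{A}),M(\mathcal{A})$ partition the universe, $V(\mathcal{A})$ is finite and $M(\mathcal{A})$ (with its $\mathcal{L}_0$-structure) is $\mathcal{M}$; (2) $\triangleleft$ is a linear order on $V(\mathcal{A})$; (3) for $x\ne y$ in $V(\mathcal{A})$, $f(x,y)=f(y,x)\in M(\mathcal{A})$; (4) if $x\triangleleft y\triangleleft z$ are distinct elements of $V(\mathcal{A})$, then either $f(x,y)=f(x,z)=f(y,z)$, or $f(x,y)=f(x,z)<f(y,z)$, or $f(x,z)=f(y,z)<f(x,y)$; (5) $N(x)$ implies $x\in V(\mathcal{A})$.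 An element $x\in V$ is $1$-colored if $N(x)$ holds and $0$-colored otherwise. A finitely generated$/\mathcal{M}$ substructure of a structure containing $\mathcal{M}$ is one of the form $\langle A_0\rangle\cup\mathcal{M}$, $A_0$ finite. $\mathcal{F}$ is the Fraïssé limit of $K(\mathcal{M})$: the (unique up to isomorphism) countable $\mathcal{L}$-structure containing $\mathcal{M}$ whose finitely generated$/\mathcal{M}$ substructures are, up to isomorphism, exactly the members of $K(\mathcal{M})$ and in which every isomorphism between finitely generated$/\mathcal{M}$ substructures extends to an automorphism; $\phi_{\mathcal{F}}$ is its Scott sentence. *)

theory Defs
  imports Main "HOL-Library.Countable_Set"
begin

unbundle cardinal_syntax

section \<open>Languages, structures, isomorphisms\<close>

record ('f, 'r) lang =
  Funs :: "'f set"
  Rels :: "'r set"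
  farity :: "'f \<Rightarrow> nat"
  rarity :: "'r \<Rightarrow> nat"

definition countable_lang :: "('f, 'r) lang \<Rightarrow> bool" where
  "countable_lang L \<longleftrightarrow> countable (Funs L) \<and> countable (Rels L)"

record ('a, 'f, 'r) struct =
  univ :: "'a set"
  funI :: "'f \<Rightarrow> 'a list \<Rightarrow> 'a"
  relI :: "'r \<Rightarrow> 'a list \<Rightarrow> bool"

definition closed_under :: "('f, 'r) lang \<Rightarrow> ('a, 'f, 'r) struct \<Rightarrow> 'a set \<Rightarrow> bool" where
  "closed_under L A X \<longleftrightarrow>
     (\<forall>g\<in>Funs L. \<forall>xs. length xs = farity L g \<and> set xs \<subseteq> X \<longrightarrow> funI A g xs \<in> X)"

definition is_struct :: "('f, 'r) lang \<Rightarrow> ('a, 'f, 'r) struct \<Rightarrow> bool" where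
  "is_struct L A \<longleftrightarrow> univ A \<noteq> {} \<and> closed_under L A (univ A)"

definition is_iso ::
  "('f, 'r) lang \<Rightarrow> ('a \<Rightarrow> 'b) \<Rightarrow> ('a, 'f, 'r) struct \<Rightarrow> ('b, 'f, 'r) struct \<Rightarrow> bool" where
  "is_iso L h A B \<longleftrightarrow>
     is_struct L A \<and> is_struct L B \<and> bij_betw h (univ A) (univ B) \<and>
     (\<forall>g\<in>Funs L. \<forall>xs. length xs = farity L g \<and> set xs \<subseteq> univ A \<longrightarrow>
        h (funI A g xs) = funI B g (map h xs)) \<and>
     (\<forall>r\<in>Rels L. \<forall>xs. length xs = rarity L r \<and> set xs \<subseteq> univ A \<longrightarrow>
        (relI A r xs \<longleftrightarrow> relI B r (map h xs)))"

definition isomorphic ::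
  "('f, 'r) lang \<Rightarrow> ('a, 'f, 'r) struct \<Rightarrow> ('b, 'f, 'r) struct \<Rightarrow> bool" where
  "isomorphic L A B \<longleftrightarrow> (\<exists>h. is_iso L h A B)"

definition restrict_to :: "('a, 'f, 'r) struct \<Rightarrow> 'a set \<Rightarrow> ('a, 'f, 'r) struct" where
  "restrict_to A X = A\<lparr>univ := X\<rparr>"

definition generated :: "('f, 'r) lang \<Rightarrow> ('a, 'f, 'r) struct \<Rightarrow> 'a set \<Rightarrow> 'a set" where
  "generated L A X = \<Inter>{Y. X \<subseteq> Y \<and> Y \<subseteq> univ A \<and> closed_under L A Y}"

section \<open>The logic with countable conjunctions, and Scott sentences\<close>

datatype 'f tm = Var nat | Fn 'f "'f tm list"

datatype ('f, 'r) fm =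
    Eq "'f tm" "'f tm"
  | Rel 'r "'f tm list"
  | Neg "('f, 'r) fm"
  | Conj "nat \<Rightarrow> ('f, 'r) fm"
  | Exists nat "('f, 'r) fm"

fun wf_tm :: "('f, 'r) lang \<Rightarrow> 'f tm \<Rightarrow> bool" where
  "wf_tm L (Var n) \<longleftrightarrow> True"
| "wf_tm L (Fn g ts) \<longleftrightarrow> g \<in> Funs L \<and> length ts = farity L g \<and> (\<forall>t\<in>set ts. wf_tm L t)"

fun fv_tm :: "'f tm \<Rightarrow> nat set" where
  "fv_tm (Var n) = {n}"
| "fv_tm (Fn g ts) = (\<Union>t\<in>set ts. fv_tm t)"

fun eval_tm :: "('a, 'f, 'r) struct \<Rightarrow> (nat \<Rightarrow> 'a) \<Rightarrow> 'f tm \<Rightarrow> 'a" where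
  "eval_tm A e (Var n) = e n"
| "eval_tm A e (Fn g ts) = funI A g (map (eval_tm A e) ts)"

primrec wf_fm :: "('f, 'r) lang \<Rightarrow> ('f, 'r) fm \<Rightarrow> bool" where
  "wf_fm L (Eq s t) \<longleftrightarrow> wf_tm L s \<and> wf_tm L t"
| "wf_fm L (Rel r ts) \<longleftrightarrow> r \<in> Rels L \<and> length ts = rarity L r \<and> (\<forall>t\<in>set ts. wf_tm L t)"
| "wf_fm L (Neg p) \<longleftrightarrow> wf_fm L p"
| "wf_fm L (Conj P) \<longleftrightarrow> (\<forall>n. wf_fm L (P n))"
| "wf_fm L (Exists n p) \<longleftrightarrow> wf_fm L p"

primrec fv_fm :: "('f, 'r) fm \<Rightarrow> nat set" where
  "fv_fm (Eq s t) = fv_tm s \<union> fv_tm t"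
| "fv_fm (Rel r ts) = (\<Union>t\<in>set ts. fv_tm t)"
| "fv_fm (Neg p) = fv_fm p"
| "fv_fm (Conj P) = (\<Union>n. fv_fm (P n))"
| "fv_fm (Exists n p) = fv_fm p - {n}"

primrec sat :: "('a, 'f, 'r) struct \<Rightarrow> (nat \<Rightarrow> 'a) \<Rightarrow> ('f, 'r) fm \<Rightarrow> bool" where
  "sat A e (Eq s t) \<longleftrightarrow> eval_tm A e s = eval_tm A e t"
| "sat A e (Rel r ts) \<longleftrightarrow> relI A r (map (eval_tm A e) ts)"
| "sat A e (Neg p) \<longleftrightarrow> \<not> sat A e p"
| "sat A e (Conj P) \<longleftrightarrow> (\<forall>n. sat A e (P n))"
| "sat A e (Exists n p) \<longleftrightarrow> (\<exists>a\<in>univ A. sat A (e(n := a)) p)"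

text \<open>A subformula of a sentence lies in the scope of finitely many quantifiers, so it
  automatically has only finitely many free variables, as usual for this logic.\<close>

definition sentence :: "('f, 'r) lang \<Rightarrow> ('f, 'r) fm \<Rightarrow> bool" where
  "sentence L p \<longleftrightarrow> wf_fm L p \<and> fv_fm p = {}"

definition is_model :: "('f, 'r) lang \<Rightarrow> ('a, 'f, 'r) struct \<Rightarrow> ('f, 'r) fm \<Rightarrow> bool" where
  "is_model L A p \<longleftrightarrow> is_struct L A \<and> (\<forall>e. range e \<subseteq> univ A \<longrightarrow> sat A e p)"

text \<open>The countable models of a Scott sentence are exactly the isomorphic copies of \<open>A\<close>.
  Every countable structure has a copy with universe a subset of \<open>nat\<close>.\<close>

definition scott_sentence ::
  "('f, 'r) lang \<Rightarrow> ('a, 'f, 'r) struct \<Rightarrow> ('f, 'r) fm \<Rightarrow> bool" where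
  "scott_sentence L A p \<longleftrightarrow>
     sentence L p \<and>
     (\<forall>B :: (nat, 'f, 'r) struct. is_struct L B \<longrightarrow> (is_model L B p \<longleftrightarrow> isomorphic L B A))"

section \<open>Cardinals and linear orders\<close>

text \<open>The fields of these well-orders have cardinality \<open>\<aleph>\<^sub>1\<close> and \<open>\<aleph>\<^sub>2\<close>, so every structure of that
  cardinality has a copy over the type \<open>nat set\<close> or \<open>nat set set\<close>, respectively.\<close>

abbreviation aleph1 :: "nat set rel" where
  "aleph1 \<equiv> cardSuc natLeq"

abbreviation aleph2 :: "nat set set rel" where
  "aleph2 \<equiv> cardSuc aleph1"

definition strict_linorder_on :: "'a set \<Rightarrow> ('a \<Rightarrow> 'a \<Rightarrow> bool) \<Rightarrow> bool" where
  "strict_linorder_on X R \<longleftrightarrow> irreflp_on X R \<and> transp_on X R \<and> totalp_on X R"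

section \<open>The expanded language and the class of finite extensions\<close>

datatype 'f ext_fun = OldF 'f | F_sym
datatype 'r ext_rel = OldR 'r | V_sym | M_sym | N_sym | Tri_sym

definition ext_lang :: "('f, 'r) lang \<Rightarrow> ('f ext_fun, 'r ext_rel) lang" where
  "ext_lang L0 =
    \<lparr>Funs = insert F_sym (OldF ` Funs L0),
     Rels = {V_sym, M_sym, N_sym, Tri_sym} \<union> OldR ` Rels L0,
     farity = (\<lambda>g. case g of OldF g' \<Rightarrow> farity L0 g' | F_sym \<Rightarrow> 2),
     rarity = (\<lambda>r. case r of OldR r' \<Rightarrow> rarity L0 r' | V_sym \<Rightarrow> 1 | M_sym \<Rightarrow> 1 | N_sym \<Rightarrow> 1
                             | Tri_sym \<Rightarrow> 2)\<rparr>"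

type_synonym ('a, 'f, 'r) ext_struct = "('a, 'f ext_fun, 'r ext_rel) struct"

definition V_part :: "('a, 'f, 'r) ext_struct \<Rightarrow> 'a set" where
  "V_part A = {x \<in> univ A. relI A V_sym [x]}"

definition M_part :: "('a, 'f, 'r) ext_struct \<Rightarrow> 'a set" where
  "M_part A = {x \<in> univ A. relI A M_sym [x]}"

definition M_struct :: "('a, 'f, 'r) ext_struct \<Rightarrow> ('a, 'f, 'r) struct" where
  "M_struct A =
     \<lparr>univ = M_part A, funI = (\<lambda>g. funI A (OldF g)), relI = (\<lambda>r. relI A (OldR r))\<rparr>"

abbreviation tri :: "('a, 'f, 'r) ext_struct \<Rightarrow> 'a \<Rightarrow> 'a \<Rightarrow> bool" where
  "tri A x y \<equiv> relI A Tri_sym [x, y]"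

abbreviation fI :: "('a, 'f, 'r) ext_struct \<Rightarrow> 'a \<Rightarrow> 'a \<Rightarrow> 'a" where
  "fI A x y \<equiv> funI A F_sym [x, y]"

definition zero_colored :: "('a, 'f, 'r) ext_struct \<Rightarrow> 'a \<Rightarrow> bool" where
  "zero_colored A x \<longleftrightarrow> x \<in> V_part A \<and> \<not> relI A N_sym [x]"

text \<open>Structures containing \<open>M\<close> live on a sum type whose left summand is the type of \<open>M\<close>, so
  that there is always room for the elements of the \<open>V\<close>-part.  Thus ``the \<open>M\<close>-part of \<open>A\<close>
  is \<open>M\<close>'' says that it is the copy of \<open>M\<close> under \<open>Inl\<close>.\<close>

definition M_part_is ::
  "('f, 'r) lang \<Rightarrow> ('m + 'v, 'f, 'r) ext_struct \<Rightarrow> ('m, 'f, 'r) struct \<Rightarrow> bool" where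
  "M_part_is L0 A M \<longleftrightarrow> is_iso L0 Inl M (M_struct A)"

text \<open>The symbols of the base language are meaningful only on the \<open>M\<close>-part, \<open>\<triangleleft>\<close> only on the
  \<open>V\<close>-part, and \<open>f\<close> only at pairs of distinct elements of the \<open>V\<close>-part.  Elsewhere relations are
  false and functions return their first argument, so that they carry no information and
  generate no elements.\<close>

definition trivial_elsewhere :: "('f, 'r) lang \<Rightarrow> ('a, 'f, 'r) ext_struct \<Rightarrow> bool" where
  "trivial_elsewhere L0 A \<longleftrightarrow>
     (\<forall>r\<in>Rels L0. \<forall>xs. length xs = rarity L0 r \<and> set xs \<subseteq> univ A \<and> relI A (OldR r) xs \<longrightarrow>
        set xs \<subseteq> M_part A) \<and>
     (\<forall>g\<in>Funs L0. \<forall>xs. length xs = farity L0 g \<and> set xs \<subseteq> univ A \<and> \<not> set xs \<subseteq> M_part A \<longrightarrow>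
        funI A (OldF g) xs = hd xs) \<and>
     (\<forall>x\<in>univ A. \<forall>y\<in>univ A. tri A x y \<longrightarrow> x \<in> V_part A \<and> y \<in> V_part A) \<and>
     (\<forall>x\<in>univ A. \<forall>y\<in>univ A. \<not> (x \<in> V_part A \<and> y \<in> V_part A \<and> x \<noteq> y) \<longrightarrow> fI A x y = x)"

definition K_class ::
  "('f, 'r) lang \<Rightarrow> 'r \<Rightarrow> ('m, 'f, 'r) struct \<Rightarrow> ('m + 'v, 'f, 'r) ext_struct \<Rightarrow> bool" where
  "K_class L0 lt M A \<longleftrightarrow>
     is_struct (ext_lang L0) A \<and> countable (univ A) \<and>
     V_part A \<union> M_part A = univ A \<and> V_part A \<inter> M_part A = {} \<and>
     finite (V_part A) \<and> M_part_is L0 A M \<and>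
     strict_linorder_on (V_part A) (tri A) \<and>
     (\<forall>x\<in>V_part A. \<forall>y\<in>V_part A. x \<noteq> y \<longrightarrow> fI A x y = fI A y x \<and> fI A x y \<in> M_part A) \<and>
     (\<forall>x\<in>V_part A. \<forall>y\<in>V_part A. \<forall>z\<in>V_part A. tri A x y \<and> tri A y z \<longrightarrow>
        fI A x y = fI A x z \<and> fI A x z = fI A y z \<or>
        fI A x y = fI A x z \<and> relI A (OldR lt) [fI A x z, fI A y z] \<or>
        fI A x z = fI A y z \<and> relI A (OldR lt) [fI A y z, fI A x y]) \<and>
     (\<forall>x\<in>univ A. relI A N_sym [x] \<longrightarrow> x \<in> V_part A) \<and>
     trivial_elsewhere L0 A"

section \<open>The Fraisse limit\<close>

definition fg_over :: "('f, 'r) lang \<Rightarrow> ('m, 'f, 'r) struct \<Rightarrow>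
    ('m + 'v, 'f, 'r) ext_struct \<Rightarrow> ('m + 'v, 'f, 'r) ext_struct set" where
  "fg_over L0 M A =
     {restrict_to A (generated (ext_lang L0) A A0 \<union> Inl ` univ M) | A0.
        finite A0 \<and> A0 \<subseteq> univ A}"

definition fraisse_limit ::
  "('f, 'r) lang \<Rightarrow> 'r \<Rightarrow> ('m, 'f, 'r) struct \<Rightarrow> ('m + nat, 'f, 'r) ext_struct \<Rightarrow> bool" where
  "fraisse_limit L0 lt M F \<longleftrightarrow>
     is_struct (ext_lang L0) F \<and> countable (univ F) \<and> M_part_is L0 F M \<and>
     (\<forall>B\<in>fg_over L0 M F. \<exists>A :: ('m + nat, 'f, 'r) ext_struct.
        K_class L0 lt M A \<and> isomorphic (ext_lang L0) B A) \<and>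
     (\<forall>A :: ('m + nat, 'f, 'r) ext_struct. K_class L0 lt M A \<longrightarrow>
        (\<exists>B\<in>fg_over L0 M F. isomorphic (ext_lang L0) B A)) \<and>
     (\<forall>B\<in>fg_over L0 M F. \<forall>C\<in>fg_over L0 M F. \<forall>h. is_iso (ext_lang L0) h B C \<longrightarrow>
        (\<exists>g. is_iso (ext_lang L0) g F F \<and> (\<forall>x\<in>univ B. g x = h x)))"

end

theory Submission
  imports Defs Complex_Main
begin

text \<open>The model is explicit. Its \<open>V\<close>-part consists of the finitely supported functions from \<open>M1\<close> to the
  lexicographic product of \<open>L\<close> with the rationals, ordered lexicographically; \<open>f x y\<close> is the first
  place where \<open>x\<close> and \<open>y\<close> differ, and the colour of \<open>x\<close> is read off its last nonzero value. Density
  of the rationals makes the structure rich: every admissible one-point extension over a finite set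
  is realized. Every \<open>l\<close> in \<open>L\<close> is sent to a function supported at one fixed point of \<open>M1\<close>.

  To see that a rich structure satisfies the Scott sentence of the Fraisse limit, take a countable
  substructure that is elementary for this sentence, is still rich, and whose \<open>M\<close>-part satisfies
  \<open>\<phi>\<close> and so is isomorphic to \<open>M\<close>. A back-and-forth argument extends this isomorphism to one with the
  Fraisse limit, which is rich by homogeneity.\<close>

subsection \<open>Isomorphisms and Scott sentences\<close>

text \<open>The sentence \<open>\<phi>F\<close> is known only through its countable models, so an
  uncountable \<open>G\<close> must be judged by its countable substructures. This is why richness
  is split into clauses with at most two parameters: a countable set can be closed under them. The
  isomorphism of the M-parts is fixed before any point of the V-part is matched, since the two parts
  interact only through the values of \<open>f\<close>.

  The order on \<open>M1\<close> need not be well-founded, so two arbitrary functions on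
  \<open>M1\<close> may have no first difference; finite support repairs this and also keeps the
  cardinality down to that of \<open>L\<close>. A new point must have a prescribed closeness, side
  and colour all at once. Reading the colour off the last nonzero value lets the choice of one value
  at a prescribed place settle all three. In the values the \<open>L\<close>-coordinate leads, so
  that functions supported at one common place are ordered like \<open>L\<close>, while the rational
  coordinate supplies density and both colours whatever gaps or endpoints \<open>L\<close>
  has.\<close>

lemma is_isoI:
  assumes "is_struct L A" "is_struct L B" "bij_betw h (univ A) (univ B)"
    and "\<And>g xs. g \<in> Funs L \<Longrightarrow> length xs = farity L g \<Longrightarrow> set xs \<subseteq> univ A \<Longrightarrow>
           h (funI A g xs) = funI B g (map h xs)"
    and "\<And>r xs. r \<in> Rels L \<Longrightarrow> length xs = rarity L r \<Longrightarrow> set xs \<subseteq> univ A \<Longrightarrow>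
           relI A r xs \<longleftrightarrow> relI B r (map h xs)"
  shows "is_iso L h A B"
  using assms unfolding is_iso_def by blast

lemma is_iso_fun:
  "is_iso L h A B \<Longrightarrow> g \<in> Funs L \<Longrightarrow> length xs = farity L g \<Longrightarrow> set xs \<subseteq> univ A \<Longrightarrow>
     h (funI A g xs) = funI B g (map h xs)"
  unfolding is_iso_def by blast

lemma is_iso_rel:
  "is_iso L h A B \<Longrightarrow> r \<in> Rels L \<Longrightarrow> length xs = rarity L r \<Longrightarrow> set xs \<subseteq> univ A \<Longrightarrow>
     relI A r xs \<longleftrightarrow> relI B r (map h xs)"
  unfolding is_iso_def by blast

lemma is_iso_bij: "is_iso L h A B \<Longrightarrow> bij_betw h (univ A) (univ B)"
  unfolding is_iso_def by blast

lemma is_iso_struct: "is_iso L h A B \<Longrightarrow> is_struct L A" "is_iso L h A B \<Longrightarrow> is_struct L B"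
  unfolding is_iso_def by blast+

lemma is_struct_closed:
  "is_struct L A \<Longrightarrow> g \<in> Funs L \<Longrightarrow> length xs = farity L g \<Longrightarrow> set xs \<subseteq> univ A \<Longrightarrow>
     funI A g xs \<in> univ A"
  unfolding is_struct_def closed_under_def by blast

lemma is_iso_trans:
  assumes "is_iso L h A B" "is_iso L k B C"
  shows "is_iso L (k \<circ> h) A C"
proof (rule is_isoI)
  have im: "h ` univ A = univ B" using is_iso_bij[OF assms(1)] by (simp add: bij_betw_def)
  show "is_struct L A" "is_struct L C" using assms is_iso_struct by blast+
  show "bij_betw (k \<circ> h) (univ A) (univ C)"
    by (rule bij_betw_trans[OF is_iso_bij[OF assms(1)] is_iso_bij[OF assms(2)]])
  fix g xs assume *: "g \<in> Funs L" "length xs = farity L g" "set xs \<subseteq> univ A"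
  then have "set (map h xs) \<subseteq> univ B" using im by auto
  then show "(k \<circ> h) (funI A g xs) = funI C g (map (k \<circ> h) xs)"
    using is_iso_fun[OF assms(1) *] is_iso_fun[OF assms(2) *(1), of "map h xs"] *(2) by simp
next
  have im: "h ` univ A = univ B" using is_iso_bij[OF assms(1)] by (simp add: bij_betw_def)
  fix r xs assume *: "r \<in> Rels L" "length xs = rarity L r" "set xs \<subseteq> univ A"
  then have "set (map h xs) \<subseteq> univ B" using im by auto
  then show "relI A r xs = relI C r (map (k \<circ> h) xs)"
    using is_iso_rel[OF assms(1) *] is_iso_rel[OF assms(2) *(1), of "map h xs"] *(2) by simp
qed

lemma is_iso_sym:
  assumes "is_iso L h A B"
  shows "is_iso L (inv_into (univ A) h) B A"
proof (rule is_isoI)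
  let ?k = "inv_into (univ A) h"
  have b: "bij_betw h (univ A) (univ B)" by (rule is_iso_bij[OF assms])
  show "is_struct L A" "is_struct L B" using assms is_iso_struct by blast+
  show bk: "bij_betw ?k (univ B) (univ A)" by (rule bij_betw_inv_into[OF b])
  have hk: "map h (map ?k xs) = xs" if "set xs \<subseteq> univ B" for xs
    using that bij_betw_inv_into_right[OF b] by (induction xs) auto
  have sub: "set (map ?k xs) \<subseteq> univ A" if "set xs \<subseteq> univ B" for xs
    using that bk by (auto simp: bij_betw_def)
  {
    fix g xs assume *: "g \<in> Funs L" "length xs = farity L g" "set xs \<subseteq> univ B"
    have "h (funI A g (map ?k xs)) = funI B g xs"
      using is_iso_fun[OF assms *(1) _ sub[OF *(3)]] *(2) hk[OF *(3)] by simp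
    moreover have "funI A g (map ?k xs) \<in> univ A"
      using is_struct_closed[OF is_iso_struct(1)[OF assms] *(1) _ sub[OF *(3)]] *(2) by simp
    ultimately show "?k (funI B g xs) = funI A g (map ?k xs)"
      using bij_betw_inv_into_left[OF b] by metis
  next
    fix r xs assume *: "r \<in> Rels L" "length xs = rarity L r" "set xs \<subseteq> univ B"
    show "relI B r xs = relI A r (map ?k xs)"
      using is_iso_rel[OF assms *(1) _ sub[OF *(3)]] *(2) hk[OF *(3)] by simp
  }
qed

lemma isomorphic_sym: "isomorphic L A B \<Longrightarrow> isomorphic L B A"
  unfolding isomorphic_def using is_iso_sym by blast

lemma isomorphic_trans: "isomorphic L A B \<Longrightarrow> isomorphic L B C \<Longrightarrow> isomorphic L A C"
  unfolding isomorphic_def using is_iso_trans by blast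

lemma is_iso_cong:
  assumes "is_iso L h A B" "\<And>x. x \<in> univ A \<Longrightarrow> h x = k x"
  shows "is_iso L k A B"
proof (rule is_isoI)
  have m: "map k xs = map h xs" if "set xs \<subseteq> univ A" for xs
    using that assms(2) by auto
  show "is_struct L A" "is_struct L B" using assms(1) is_iso_struct by blast+
  show "bij_betw k (univ A) (univ B)"
    using is_iso_bij[OF assms(1)] bij_betw_cong[of "univ A" h k] assms(2) by blast
  fix g xs assume *: "g \<in> Funs L" "length xs = farity L g" "set xs \<subseteq> univ A"
  then show "k (funI A g xs) = funI B g (map k xs)"
    using is_iso_fun[OF assms(1) *] m assms(2) is_struct_closed[OF is_iso_struct(1)[OF assms(1)] *]
    by metis
next
  fix r xs assume *: "r \<in> Rels L" "length xs = rarity L r" "set xs \<subseteq> univ A"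
  moreover have "map k xs = map h xs" using * assms(2) by auto
  ultimately show "relI A r xs = relI B r (map k xs)"
    using is_iso_rel[OF assms(1) *] by metis
qed

lemma eval_tm_in_univ:
  assumes "is_struct L A" "range e \<subseteq> univ A"
  shows "wf_tm L t \<Longrightarrow> eval_tm A e t \<in> univ A"
  by (induction t) (use assms in \<open>auto intro!: is_struct_closed[of L]\<close>)

lemma eval_tm_iso:
  assumes "is_iso L h A B" "range e \<subseteq> univ A"
  shows "wf_tm L t \<Longrightarrow> h (eval_tm A e t) = eval_tm B (h \<circ> e) t"
proof (induction t)
  case (Fn g ts)
  have "set (map (eval_tm A e) ts) \<subseteq> univ A"
    using Fn.prems eval_tm_in_univ[OF is_iso_struct(1)[OF assms(1)] assms(2)] by auto
  moreover have "map h (map (eval_tm A e) ts) = map (eval_tm B (h \<circ> e)) ts"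
  proof -
    have "h (eval_tm A e t) = eval_tm B (h \<circ> e) t" if "t \<in> set ts" for t
      by (rule Fn.IH[OF that]) (use Fn.prems that in simp)
    then show ?thesis by (simp only: map_map map_eq_conv comp_apply) blast
  qed
  ultimately show ?case
    using is_iso_fun[OF assms(1), of g "map (eval_tm A e) ts"] Fn.prems
    by (metis eval_tm.simps(2) length_map wf_tm.simps(2))
qed simp

lemma sat_iso:
  assumes "is_iso L h A B"
  shows "wf_fm L p \<Longrightarrow> range e \<subseteq> univ A \<Longrightarrow> sat A e p \<longleftrightarrow> sat B (h \<circ> e) p"
proof (induction p arbitrary: e)
  case (Eq s t)
  note in_univ = eval_tm_in_univ[OF is_iso_struct(1)[OF assms] Eq.prems(2)]
  have "inj_on h (univ A)" using is_iso_bij[OF assms] by (simp add: bij_betw_def)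
  then show ?case
    using Eq.prems eval_tm_iso[OF assms Eq.prems(2), of s]
      eval_tm_iso[OF assms Eq.prems(2), of t] in_univ[of s] in_univ[of t]
    by (metis inj_onD sat.simps(1) wf_fm.simps(1))
next
  case (Rel r ts)
  have "set (map (eval_tm A e) ts) \<subseteq> univ A"
    using Rel.prems eval_tm_in_univ[OF is_iso_struct(1)[OF assms] Rel.prems(2)] by auto
  moreover have "map h (map (eval_tm A e) ts) = map (eval_tm B (h \<circ> e)) ts"
    using Rel.prems eval_tm_iso[OF assms Rel.prems(2)] by simp
  ultimately show ?case
    using is_iso_rel[OF assms, of r "map (eval_tm A e) ts"] Rel.prems
    by (metis length_map sat.simps(2) wf_fm.simps(2))
next
  case (Exists n p)
  have im: "univ B = h ` univ A" using is_iso_bij[OF assms] by (simp add: bij_betw_def)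
  have "sat A (e(n := a)) p \<longleftrightarrow> sat B ((h \<circ> e)(n := h a)) p" if "a \<in> univ A" for a
  proof -
    have "range (e(n := a)) \<subseteq> univ A" using that Exists.prems by auto
    then have "sat A (e(n := a)) p \<longleftrightarrow> sat B (h \<circ> e(n := a)) p"
      using Exists.IH[of "e(n := a)"] Exists.prems(1) by (simp only: wf_fm.simps)
    moreover have "h \<circ> e(n := a) = (h \<circ> e)(n := h a)" by (auto simp: fun_eq_iff)
    ultimately show ?thesis by simp
  qed
  then show ?case by (auto simp: im comp_def)
qed simp_all

lemma is_model_iso:
  assumes "is_iso L h A B" "wf_fm L p" "is_model L A p"
  shows "is_model L B p"
  unfolding is_model_def
proof (intro conjI allI impI)
  show "is_struct L B" using assms(1) is_iso_struct by blast
  fix e :: "nat \<Rightarrow> _" assume e: "range e \<subseteq> univ B"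
  let ?k = "inv_into (univ A) h"
  have b: "bij_betw h (univ A) (univ B)" by (rule is_iso_bij[OF assms(1)])
  have "range (?k \<circ> e) \<subseteq> univ A"
    using e bij_betw_inv_into[OF b] by (auto simp: bij_betw_def)
  moreover have "h \<circ> (?k \<circ> e) = e"
    using e bij_betw_inv_into_right[OF b] by (auto simp: fun_eq_iff)
  ultimately show "sat B e p"
    using sat_iso[OF assms(1,2)] assms(3) unfolding is_model_def by metis
qed

lemma is_model_isomorphic:
  "isomorphic L A B \<Longrightarrow> wf_fm L p \<Longrightarrow> is_model L A p \<longleftrightarrow> is_model L B p"
  unfolding isomorphic_def by (metis is_model_iso is_iso_sym)

lemma countable_struct_nat_copy:
  fixes A :: "('a, 'f, 'r) struct"
  assumes "is_struct L A" "countable (univ A)"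
  shows "\<exists>B :: (nat, 'f, 'r) struct. isomorphic L B A"
proof -
  let ?t = "to_nat_on (univ A)" let ?k = "from_nat_into (univ A)"
  define B :: "(nat, 'f, 'r) struct" where
    "B = \<lparr>univ = ?t ` univ A, funI = (\<lambda>g xs. ?t (funI A g (map ?k xs))),
          relI = (\<lambda>r xs. relI A r (map ?k xs))\<rparr>"
  have kt: "?k (?t x) = x" if "x \<in> univ A" for x using that assms(2) by simp
  have mkt: "map ?k (map ?t xs) = xs" if "set xs \<subseteq> univ A" for xs
    using that kt by (induction xs) auto
  have "is_iso L ?t A B"
  proof (rule is_isoI)
    show "is_struct L A" by fact
    show "bij_betw ?t (univ A) (univ B)"
      using inj_on_to_nat_on[OF assms(2)] by (simp add: B_def inj_on_imp_bij_betw)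
    show "is_struct L B"
      unfolding is_struct_def closed_under_def
    proof (intro conjI ballI allI impI)
      show "univ B \<noteq> {}" using assms(1) by (simp add: B_def is_struct_def)
      fix g xs assume "g \<in> Funs L" "length xs = farity L g \<and> set xs \<subseteq> univ B"
      moreover from this have "set (map ?k xs) \<subseteq> univ A" using kt by (auto simp: B_def)
      ultimately show "funI B g xs \<in> univ B"
        using is_struct_closed[OF assms(1), of g "map ?k xs"] by (simp add: B_def)
    qed
  qed (simp_all add: B_def mkt del: map_map)
  then show ?thesis using isomorphic_sym unfolding isomorphic_def by blast
qed

text \<open>\<open>scott_sentence\<close> quantifies over structures on \<open>nat\<close> only. A
  \<open>nat\<close> copy of \<open>B\<close> carries the equivalence over to countable structures
  on any type.\<close>

lemma scott_sentence_iff: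
  assumes "scott_sentence L A p" "is_struct L B" "countable (univ B)"
  shows "is_model L B p \<longleftrightarrow> isomorphic L B A"
proof -
  obtain C :: "(nat, _, _) struct" where C: "isomorphic L C B"
    using countable_struct_nat_copy assms(2,3) by blast
  then have "is_struct L C" using is_iso_struct unfolding isomorphic_def by blast
  then have "is_model L C p \<longleftrightarrow> isomorphic L C A" and "wf_fm L p"
    using assms(1) unfolding scott_sentence_def sentence_def by blast+
  then show ?thesis
    using is_model_isomorphic[OF C] isomorphic_trans[OF C, of A]
      isomorphic_trans[OF isomorphic_sym[OF C], of A] by blast
qed

subsection \<open>Countable reflection\<close>

text \<open>The Tarski-Vaught condition, with formulas replaced by arbitrary predicates on a
  parameter list and a witness. Satisfaction, closure under functions and richness thus become
  members of one family and can be reflected together.\<close>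

definition reflects :: "'a set \<Rightarrow> ('a list \<Rightarrow> 'a \<Rightarrow> bool) set \<Rightarrow> 'a set \<Rightarrow> bool" where
  "reflects U PP X \<longleftrightarrow>
     (\<forall>P\<in>PP. \<forall>xs. set xs \<subseteq> X \<longrightarrow> (\<exists>z\<in>U. P xs z) \<longrightarrow> (\<exists>z\<in>X. P xs z))"

lemma reflects_Un: "reflects U (PP \<union> QQ) X \<longleftrightarrow> reflects U PP X \<and> reflects U QQ X"
  by (simp only: reflects_def ball_Un)

lemma reflects_subset: "reflects U PP X \<Longrightarrow> QQ \<subseteq> PP \<Longrightarrow> reflects U QQ X"
  unfolding reflects_def by (meson subsetD)

lemma reflectsD:
  "reflects U PP X \<Longrightarrow> P \<in> PP \<Longrightarrow> set xs \<subseteq> X \<Longrightarrow> z \<in> U \<Longrightarrow> P xs z \<Longrightarrow> \<exists>z\<in>X. P xs z"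
  unfolding reflects_def by blast

text \<open>A Skolem hull: every round adds one chosen witness for each predicate and each list of
  parameters found so far. A parameter list is finite, so it lies in a single round, and its witness
  in the next.\<close>

lemma countable_reflecting_set:
  assumes "countable PP" "countable X0" "X0 \<subseteq> U"
  shows "\<exists>X. countable X \<and> X0 \<subseteq> X \<and> X \<subseteq> U \<and> reflects U PP X"
proof -
  define w where "w P xs = (SOME z. z \<in> U \<and> P xs z)" for P :: "'a list \<Rightarrow> 'a \<Rightarrow> bool" and xs
  have w: "w P xs \<in> U \<and> P xs (w P xs)" if "\<exists>z\<in>U. P xs z" for P xs
    unfolding w_def by (rule someI_ex[of "\<lambda>z. z \<in> U \<and> P xs z"]) (use that in blast)
  define step where
    "step X = X \<union> {z \<in> U. \<exists>P\<in>PP. \<exists>xs\<in>lists X. z = w P xs}" for X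
  define Y where "Y n = (step ^^ n) X0" for n
  have Y_Suc: "Y (Suc n) = step (Y n)" for n by (simp add: Y_def)
  have cY: "countable (Y n)" for n
  proof (induction n)
    case 0 then show ?case using assms(2) by (simp add: Y_def)
  next
    case (Suc n)
    have "{z \<in> U. \<exists>P\<in>PP. \<exists>xs\<in>lists (Y n). z = w P xs} \<subseteq> (\<lambda>(P, xs). w P xs) ` (PP \<times> lists (Y n))"
      by force
    then have "countable {z \<in> U. \<exists>P\<in>PP. \<exists>xs\<in>lists (Y n). z = w P xs}"
      using assms(1) Suc countable_subset by (metis (no_types, lifting) countable_SIGMA countable_image countable_lists)
    then show ?case using Suc unfolding Y_Suc step_def by simp
  qed
  have YU: "Y n \<subseteq> U" for n
    by (induction n) (use assms(3) in \<open>auto simp: Y_def step_def\<close>)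
  have mono: "Y m \<subseteq> Y n" if "m \<le> n" for m n
    using that by (rule lift_Suc_mono_le[of Y, rotated]) (auto simp: Y_Suc step_def)
  have fin: "\<exists>n. S \<subseteq> Y n" if "finite S" "S \<subseteq> (\<Union>n. Y n)" for S
    using that
  proof (induction S)
    case (insert s S)
    then obtain m n where "S \<subseteq> Y m" "s \<in> Y n" by auto
    then have "insert s S \<subseteq> Y (max m n)"
      using mono[of m "max m n"] mono[of n "max m n"] by auto
    then show ?case by blast
  qed simp
  have "reflects U PP (\<Union>n. Y n)"
    unfolding reflects_def
  proof (intro ballI allI impI)
    fix P xs assume P: "P \<in> PP" and xs: "set xs \<subseteq> (\<Union>n. Y n)" and ex: "\<exists>z\<in>U. P xs z"
    obtain n where "set xs \<subseteq> Y n" using fin[OF _ xs] by auto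
    then have "w P xs \<in> Y (Suc n)" using w[of P xs] ex P unfolding Y_Suc step_def by blast
    then show "\<exists>z\<in>\<Union>n. Y n. P xs z" using w[of P xs] ex by blast
  qed
  moreover have "X0 \<subseteq> (\<Union>n. Y n)" using Y_def[of 0] by auto
  ultimately show ?thesis using cY YU by (intro exI[of _ "\<Union>n. Y n"]) auto
qed

section \<open>Elementary substructures for formulas with countable conjunctions\<close>

lemma eval_tm_cong_fv: "(\<And>n. n \<in> fv_tm t \<Longrightarrow> e n = e' n) \<Longrightarrow> eval_tm A e t = eval_tm A e' t"
proof (induction t)
  case (Fn g ts)
  then have "map (eval_tm A e) ts = map (eval_tm A e') ts" by fastforce
  then show ?case by (metis eval_tm.simps(2))
qed simp

lemma sat_cong_fv: "(\<And>n. n \<in> fv_fm p \<Longrightarrow> e n = e' n) \<Longrightarrow> sat A e p \<longleftrightarrow> sat A e' p"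
proof (induction p arbitrary: e e')
  case (Eq s t)
  then show ?case using eval_tm_cong_fv[of s e e' A] eval_tm_cong_fv[of t e e' A] by simp
next
  case (Rel r ts)
  have "map (eval_tm A e) ts = map (eval_tm A e') ts"
    using Rel eval_tm_cong_fv[of _ e e' A] by fastforce
  then show ?case by (simp del: map_eq_conv)
next
  case (Neg p)
  from Neg.IH[of e e'] Neg.prems show ?case by simp
next
  case (Conj P)
  have "sat A e (P n) = sat A e' (P n)" for n
    by (rule Conj.IH) (use Conj.prems in auto)
  then show ?case by simp
next
  case (Exists n p)
  have "sat A (e(n := a)) p = sat A (e'(n := a)) p" for a
    by (rule Exists.IH) (use Exists.prems in auto)
  then show ?case by simp
qed

lemma eval_tm_restrict: "eval_tm (restrict_to A X) e t = eval_tm A e t"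
  by (induction t) (auto simp: restrict_to_def cong: map_cong)

text \<open>A conjunction only unites the countably many families of its conjuncts, and each
  quantifier adds a single predicate. One predicate can serve all assignments because, with finitely
  many free variables, an assignment can be coded by a list.\<close>

lemma sat_reflecting:
  "finite (fv_fm p) \<Longrightarrow> \<exists>PP. countable PP \<and>
     (\<forall>X\<subseteq>univ A. reflects (univ A) PP X \<longrightarrow>
        (\<forall>e. range e \<subseteq> X \<longrightarrow> (sat (restrict_to A X) e p \<longleftrightarrow> sat A e p)))"
proof (induction p)
  case (Eq s t)
  then show ?case by (intro exI[of _ "{}"]) (simp add: eval_tm_restrict)
next
  case (Rel r ts)
  have "map (eval_tm (restrict_to A X) e) ts = map (eval_tm A e) ts" for X e
    by (simp add: eval_tm_restrict)
  then show ?case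
    by (intro exI[of _ "{}"]) (simp add: restrict_to_def del: map_eq_conv)
next
  case (Neg p)
  then show ?case by simp
next
  case (Conj P)
  have "\<forall>n. \<exists>PP. countable PP \<and>
     (\<forall>X\<subseteq>univ A. reflects (univ A) PP X \<longrightarrow>
        (\<forall>e. range e \<subseteq> X \<longrightarrow> (sat (restrict_to A X) e (P n) \<longleftrightarrow> sat A e (P n))))"
  proof
    fix n
    have "finite (fv_fm (P n))" using Conj.prems by (auto intro: rev_finite_subset)
    then show "\<exists>PP. countable PP \<and>
     (\<forall>X\<subseteq>univ A. reflects (univ A) PP X \<longrightarrow>
        (\<forall>e. range e \<subseteq> X \<longrightarrow> (sat (restrict_to A X) e (P n) \<longleftrightarrow> sat A e (P n))))"
      using Conj.IH[OF rangeI] by blast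
  qed
  then obtain PP where PP: "\<forall>n. countable (PP n) \<and>
     (\<forall>X\<subseteq>univ A. reflects (univ A) (PP n) X \<longrightarrow>
        (\<forall>e. range e \<subseteq> X \<longrightarrow> (sat (restrict_to A X) e (P n) \<longleftrightarrow> sat A e (P n))))"
    by metis
  show ?case
  proof (intro exI[of _ "\<Union>n. PP n"] conjI allI impI)
    show "countable (\<Union>n. PP n)" using PP by blast
    fix X and e :: "nat \<Rightarrow> _"
    assume "X \<subseteq> univ A" "reflects (univ A) (\<Union>n. PP n) X" "range e \<subseteq> X"
    moreover from this have "reflects (univ A) (PP n) X" for n
      by (blast intro: reflects_subset)
    ultimately show "sat (restrict_to A X) e (Conj P) \<longleftrightarrow> sat A e (Conj P)" using PP by simp
  qed
next
  case (Exists n p)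
  then have fin: "finite (fv_fm p)" by simp
  then obtain PP where "countable PP" and
    PP: "\<And>X e. X \<subseteq> univ A \<Longrightarrow> reflects (univ A) PP X \<Longrightarrow> range e \<subseteq> X \<Longrightarrow>
           sat (restrict_to A X) e p \<longleftrightarrow> sat A e p"
    using Exists.IH by metis
  obtain k where k: "fv_fm p \<subseteq> {..<k}" using fin finite_nat_iff_bounded by blast
  define Q where "Q xs z \<longleftrightarrow> sat A ((\<lambda>i. xs ! i)(n := z)) p" for xs z
  show ?case
  proof (intro exI[of _ "insert Q PP"] conjI allI impI)
    show "countable (insert Q PP)" using \<open>countable PP\<close> by simp
    fix X and e :: "nat \<Rightarrow> _"
    assume X: "X \<subseteq> univ A" and rX: "reflects (univ A) (insert Q PP) X" and e: "range e \<subseteq> X"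
    have rP: "reflects (univ A) PP X" by (rule reflects_subset[OF rX]) blast
    \<comment> \<open>Indices from \<open>k\<close> on give unspecified entries, which is harmless:
      \<open>p\<close> has no free variables there.\<close>
    let ?xs = "map e [0..<k]"
    have Q: "Q ?xs z \<longleftrightarrow> sat A (e(n := z)) p" for z
      unfolding Q_def by (rule sat_cong_fv) (use k in auto)
    have "sat (restrict_to A X) (e(n := z)) p \<longleftrightarrow> Q ?xs z" if "z \<in> X" for z
      unfolding Q by (rule PP[OF X rP]) (use e that in auto)
    moreover have "(\<exists>z\<in>univ A. Q ?xs z) \<longleftrightarrow> (\<exists>z\<in>X. Q ?xs z)"
      using X reflectsD[OF rX, of Q ?xs] e by fastforce
    ultimately show "sat (restrict_to A X) e (Exists n p) \<longleftrightarrow> sat A e (Exists n p)"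
      using Q by (auto simp: restrict_to_def)
  qed
qed

lemma is_model_reflecting:
  assumes "countable_lang L" "is_struct L A" "sentence L p"
  shows "\<exists>PP. countable PP \<and>
     (\<forall>X\<subseteq>univ A. reflects (univ A) PP X \<longrightarrow> is_struct L (restrict_to A X) \<and>
        (is_model L (restrict_to A X) p \<longleftrightarrow> is_model L A p))"
proof -
  obtain PP where "countable PP" and
    PP: "\<And>X e. X \<subseteq> univ A \<Longrightarrow> reflects (univ A) PP X \<Longrightarrow> range e \<subseteq> X \<Longrightarrow>
           sat (restrict_to A X) e p \<longleftrightarrow> sat A e p"
    using sat_reflecting[of p A] assms(3) unfolding sentence_def by auto
  define FF where
    "FF = (\<lambda>g xs z. length xs = farity L g \<and> z = funI A g xs) ` Funs L"
  \<comment> \<open>The constantly true predicate makes reflecting sets nonempty, and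
    \<open>FF\<close> makes them closed under the functions, so that they carry structures.\<close>
  define QQ where "QQ = insert (\<lambda>_ _. True) (FF \<union> PP)"
  have "countable QQ"
    using \<open>countable PP\<close> assms(1) by (simp add: QQ_def FF_def countable_lang_def)
  moreover have "is_struct L (restrict_to A X) \<and>
        (is_model L (restrict_to A X) p \<longleftrightarrow> is_model L A p)"
    if X: "X \<subseteq> univ A" and rX: "reflects (univ A) QQ X" for X
  proof -
    have ne: "X \<noteq> {}"
      using rX assms(2) reflectsD[OF rX, of "\<lambda>_ _. True" "[]"]
      unfolding is_struct_def QQ_def by auto
    have rP: "reflects (univ A) PP X" by (rule reflects_subset[OF rX]) (auto simp: QQ_def)
    have st: "is_struct L (restrict_to A X)"
      unfolding is_struct_def closed_under_def
    proof (intro conjI ballI allI impI)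
      show "univ (restrict_to A X) \<noteq> {}" using ne by (simp add: restrict_to_def)
      fix g xs assume g: "g \<in> Funs L" and "length xs = farity L g \<and> set xs \<subseteq> univ (restrict_to A X)"
      then have xs: "length xs = farity L g" "set xs \<subseteq> X" by (auto simp: restrict_to_def)
      have "(\<lambda>xs z. length xs = farity L g \<and> z = funI A g xs) \<in> QQ"
        using g by (auto simp: QQ_def FF_def)
      from reflectsD[OF rX this xs(2), of "funI A g xs"] xs(1)
        is_struct_closed[OF assms(2) g xs(1)] xs(2) X
      show "funI (restrict_to A X) g xs \<in> univ (restrict_to A X)"
        by (auto simp: restrict_to_def)
    qed
    obtain x where x: "x \<in> X" using ne by blast
    let ?e = "\<lambda>_::nat. x"
    have const: "sat B e p \<longleftrightarrow> sat B ?e p" for B e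
      by (rule sat_cong_fv) (use assms(3) in \<open>auto simp: sentence_def\<close>)
    have 1: "sat (restrict_to A X) ?e p \<longleftrightarrow> sat A ?e p"
      by (rule PP[OF X rP]) (use x in auto)
    have "is_model L (restrict_to A X) p \<longleftrightarrow> sat (restrict_to A X) ?e p"
      unfolding is_model_def using st x const[of "restrict_to A X"] by (auto simp: restrict_to_def)
    moreover have "is_model L A p \<longleftrightarrow> sat A ?e p"
      unfolding is_model_def using assms(2) x X const[of A] by auto
    ultimately show ?thesis using st 1 by simp
  qed
  ultimately show ?thesis by (intro exI[of _ QQ]) blast
qed

subsection \<open>Convexly ordered ultrametric spaces\<close>

lemma strict_linorder_onD:
  assumes "strict_linorder_on X R"
  shows "x \<in> X \<Longrightarrow> \<not> R x x"
    and "x \<in> X \<Longrightarrow> y \<in> X \<Longrightarrow> z \<in> X \<Longrightarrow> R x y \<Longrightarrow> R y z \<Longrightarrow> R x z"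
    and "x \<in> X \<Longrightarrow> y \<in> X \<Longrightarrow> x \<noteq> y \<Longrightarrow> R x y \<or> R y x"
    and "x \<in> X \<Longrightarrow> y \<in> X \<Longrightarrow> R x y \<Longrightarrow> \<not> R y x"
proof -
  show *: "x \<in> X \<Longrightarrow> \<not> R x x" for x
    using assms unfolding strict_linorder_on_def by (auto dest: irreflp_onD)
  show **: "x \<in> X \<Longrightarrow> y \<in> X \<Longrightarrow> z \<in> X \<Longrightarrow> R x y \<Longrightarrow> R y z \<Longrightarrow> R x z" for x y z
    using assms unfolding strict_linorder_on_def by (auto dest: transp_onD)
  show "x \<in> X \<Longrightarrow> y \<in> X \<Longrightarrow> x \<noteq> y \<Longrightarrow> R x y \<or> R y x"
    using assms unfolding strict_linorder_on_def by (auto dest: totalp_onD)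
  show "x \<in> X \<Longrightarrow> y \<in> X \<Longrightarrow> R x y \<Longrightarrow> \<not> R y x" using * ** by blast
qed

lemma strict_linorder_onI:
  assumes "\<And>x. x \<in> X \<Longrightarrow> \<not> R x x"
    and "\<And>x y z. x \<in> X \<Longrightarrow> y \<in> X \<Longrightarrow> z \<in> X \<Longrightarrow> R x y \<Longrightarrow> R y z \<Longrightarrow> R x z"
    and "\<And>x y. x \<in> X \<Longrightarrow> y \<in> X \<Longrightarrow> x \<noteq> y \<Longrightarrow> R x y \<or> R y x"
  shows "strict_linorder_on X R"
  using assms unfolding strict_linorder_on_def irreflp_on_def transp_on_def totalp_on_def by blast

lemma strict_linorder_on_conv:
  "strict_linorder_on X R \<Longrightarrow> strict_linorder_on X (\<lambda>x y. R y x)"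
  unfolding strict_linorder_on_def irreflp_on_def transp_on_def totalp_on_def by blast

lemma strict_linorder_on_image:
  assumes "strict_linorder_on X R" "\<And>y. y \<in> Y \<Longrightarrow> h y \<in> X" "inj_on h Y"
    and "\<And>x y. x \<in> Y \<Longrightarrow> y \<in> Y \<Longrightarrow> S x y \<longleftrightarrow> R (h x) (h y)"
  shows "strict_linorder_on Y S"
proof (rule strict_linorder_onI)
  show "\<not> S x x" if "x \<in> Y" for x using that assms strict_linorder_onD(1)[OF assms(1)] by simp
  show "S x z" if "x \<in> Y" "y \<in> Y" "z \<in> Y" "S x y" "S y z" for x y z
    using that assms(2,4) strict_linorder_onD(2)[OF assms(1), of "h x" "h y" "h z"] by simp
  show "S x y \<or> S y x" if "x \<in> Y" "y \<in> Y" "x \<noteq> y" for x y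
    using that assms(2,4) strict_linorder_onD(3)[OF assms(1), of "h x" "h y"]
      inj_onD[OF assms(3), of x y] by blast
qed

lemma finite_strict_linorder_has_min:
  assumes "finite S" "S \<noteq> {}" "S \<subseteq> X" "strict_linorder_on X R"
  shows "\<exists>m\<in>S. \<forall>s\<in>S. s \<noteq> m \<longrightarrow> R m s"
  using assms(1-3)
proof (induction S rule: finite_ne_induct)
  case (insert x S)
  then obtain m where m: "m \<in> S" "\<And>s. s \<in> S \<Longrightarrow> s \<noteq> m \<Longrightarrow> R m s" by auto
  show ?case
  proof (cases "R m x")
    case True
    then show ?thesis using m by auto
  next
    case False
    moreover have "x \<noteq> m" using m insert by blast
    ultimately have "R x m" using strict_linorder_onD(3)[OF assms(4), of x m] m insert.prems by blast
    then have "R x s" if "s \<in> S" for s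
      using that m insert.prems strict_linorder_onD(2)[OF assms(4), of x m s] by blast
    then show ?thesis by auto
  qed
qed simp

text \<open>\<open>f x y\<close> measures closeness: larger values are closer.\<close>

locale convex_ultrametric =
  fixes V :: "'a set" and t :: "'a \<Rightarrow> 'a \<Rightarrow> bool"
    and U :: "'u set" and r :: "'u \<Rightarrow> 'u \<Rightarrow> bool" and f :: "'a \<Rightarrow> 'a \<Rightarrow> 'u"
  assumes V_lin: "strict_linorder_on V t" and U_lin: "strict_linorder_on U r"
    and f_sym: "x \<in> V \<Longrightarrow> y \<in> V \<Longrightarrow> x \<noteq> y \<Longrightarrow> f x y = f y x"
    and f_in: "x \<in> V \<Longrightarrow> y \<in> V \<Longrightarrow> x \<noteq> y \<Longrightarrow> f x y \<in> U"
    and f_triple: "x \<in> V \<Longrightarrow> y \<in> V \<Longrightarrow> z \<in> V \<Longrightarrow> t x y \<Longrightarrow> t y z \<Longrightarrow>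
       f x y = f x z \<and> f x z = f y z \<or> f x y = f x z \<and> r (f x z) (f y z) \<or>
       f x z = f y z \<and> r (f y z) (f x y)"
begin

lemmas V_irrefl = strict_linorder_onD(1)[OF V_lin]
lemmas V_trans = strict_linorder_onD(2)[OF V_lin]
lemmas V_total = strict_linorder_onD(3)[OF V_lin]
lemmas V_asym = strict_linorder_onD(4)[OF V_lin]
lemmas U_irrefl = strict_linorder_onD(1)[OF U_lin]
lemmas U_trans = strict_linorder_onD(2)[OF U_lin]
lemmas U_total = strict_linorder_onD(3)[OF U_lin]
lemmas U_asym = strict_linorder_onD(4)[OF U_lin]

text \<open>Reversing the order exchanges the last two alternatives of the triple condition.
  Neighbours above a point can thus be treated like those below it.\<close>

lemma convex_ultrametric_conv: "convex_ultrametric V (\<lambda>x y. t y x) U r f"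
proof
  show "strict_linorder_on V (\<lambda>x y. t y x)" "strict_linorder_on U r"
    by (rule strict_linorder_on_conv[OF V_lin] U_lin)+
  show "f x y = f y x" "f x y \<in> U" if "x \<in> V" "y \<in> V" "x \<noteq> y" for x y
    using that f_sym f_in by blast+
  fix x y z assume *: "x \<in> V" "y \<in> V" "z \<in> V" "t y x" "t z y"
  then have "x \<noteq> y" "y \<noteq> z" "x \<noteq> z" using V_irrefl V_asym by blast+
  then have "f x y = f y x" "f y z = f z y" "f x z = f z x" using f_sym * by blast+
  then show "f x y = f x z \<and> f x z = f y z \<or> f x y = f x z \<and> r (f x z) (f y z) \<or>
       f x z = f y z \<and> r (f y z) (f x y)"
    using f_triple[of z y x] * by auto
qed

text \<open>Balls are convex: if \<open>y\<close> and \<open>w\<close> are closer to each other than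
  \<open>x\<close> is to \<open>y\<close>, then some ball contains \<open>y\<close> and
  \<open>w\<close> but not \<open>x\<close>, so \<open>x\<close> lies on the same side of both and
  is equally close to both.\<close>

lemma far_point:
  assumes V: "x \<in> V" "y \<in> V" "w \<in> V" and ne: "x \<noteq> y" "x \<noteq> w" "y \<noteq> w"
    and lt: "r (f x y) (f y w)"
  shows "f x w = f x y" "t x w \<longleftrightarrow> t x y"
proof -
  note in_U = f_in[OF V(1,2) ne(1)] f_in[OF V(1,3) ne(2)] f_in[OF V(2,3) ne(3)]
  note sym = f_sym[OF V(1,2) ne(1)] f_sym[OF V(1,3) ne(2)] f_sym[OF V(2,3) ne(3)]
  note U = U_irrefl[OF in_U(1)] U_irrefl[OF in_U(2)] U_irrefl[OF in_U(3)]
    U_asym[OF in_U(1,3)] U_asym[OF in_U(1,2)] U_asym[OF in_U(2,3)]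
  \<comment> \<open>The triple condition for all six orders of the three points; totality selects
    the one that holds.\<close>
  note tri = f_triple[OF V] f_triple[OF V(1,3,2)] f_triple[OF V(2,1,3)]
    f_triple[OF V(2,3,1)] f_triple[OF V(3,1,2)] f_triple[OF V(3,2,1)]
  have tot: "t x y \<or> t y x" "t x w \<or> t w x" "t y w \<or> t w y"
    using V_total V ne by blast+
  have "f x w = f x y \<and> (t x w \<longleftrightarrow> t x y)"
    using tri tot U lt V_asym[OF V(1,2)] V_asym[OF V(1,3)] V_asym[OF V(2,3)]
    unfolding sym(1)[symmetric] sym(2)[symmetric] sym(3)[symmetric]
    by metis
  then show "f x w = f x y" "t x w \<longleftrightarrow> t x y" by blast+
qed

end

text \<open>These extension properties over one or two points already give extensions over all
  finite sets. A point between \<open>b\<close> and \<open>b'\<close> that is closer to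
  \<open>b\<close> than \<open>b'\<close> is comes from the first clause, by convexity; the third
  clause supplies the points that are exactly as close to both as these are to each other.\<close>

definition rich :: "'a set \<Rightarrow> ('a \<Rightarrow> 'a \<Rightarrow> bool) \<Rightarrow> 'u set \<Rightarrow> ('a \<Rightarrow> 'a \<Rightarrow> 'u) \<Rightarrow> ('a \<Rightarrow> bool) \<Rightarrow> bool"
  where "rich V t U f N \<longleftrightarrow> V \<noteq> {} \<and> U \<noteq> {} \<and>
    (\<forall>b\<in>V. \<forall>m\<in>U. \<forall>c. \<exists>z\<in>V. t b z \<and> f b z = m \<and> N z = c) \<and>
    (\<forall>b\<in>V. \<forall>m\<in>U. \<forall>c. \<exists>z\<in>V. t z b \<and> f b z = m \<and> N z = c) \<and>
    (\<forall>b\<in>V. \<forall>b'\<in>V. \<forall>c. t b b' \<longrightarrow>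
       (\<exists>z\<in>V. t b z \<and> t z b' \<and> f b z = f b b' \<and> f b' z = f b b' \<and> N z = c))"

lemma richD:
  assumes "rich V t U f N"
  shows "V \<noteq> {}" "U \<noteq> {}"
    "b \<in> V \<Longrightarrow> m \<in> U \<Longrightarrow> \<exists>z\<in>V. t b z \<and> f b z = m \<and> N z = c"
    "b \<in> V \<Longrightarrow> m \<in> U \<Longrightarrow> \<exists>z\<in>V. t z b \<and> f b z = m \<and> N z = c"
    "b \<in> V \<Longrightarrow> b' \<in> V \<Longrightarrow> t b b' \<Longrightarrow>
       \<exists>z\<in>V. t b z \<and> t z b' \<and> f b z = f b b' \<and> f b' z = f b b' \<and> N z = c"
  using assms unfolding rich_def by simp_all

text \<open>The map \<open>h\<close> on values is given in advance; only points are matched. With a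
  relation in place of a partial function, the back step is the forth step for the converse.\<close>

definition partial_iso where
  "partial_iso V t f N V' t' f' N' h R \<longleftrightarrow> finite R \<and> R \<subseteq> V \<times> V' \<and>
     (\<forall>a b. (a, b) \<in> R \<longrightarrow> N a = N' b) \<and>
     (\<forall>a b a' b'. (a, b) \<in> R \<longrightarrow> (a', b') \<in> R \<longrightarrow>
        (a = a' \<longleftrightarrow> b = b') \<and> (t a a' \<longleftrightarrow> t' b b') \<and> (a \<noteq> a' \<longrightarrow> h (f a a') = f' b b'))"

lemma partial_isoD:
  assumes "partial_iso V t f N V' t' f' N' h R"
  shows "finite R" "R \<subseteq> V \<times> V'" "\<And>a b. (a, b) \<in> R \<Longrightarrow> N a = N' b"
    "\<And>a b a' b'. (a, b) \<in> R \<Longrightarrow> (a', b') \<in> R \<Longrightarrow>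
       (a = a' \<longleftrightarrow> b = b') \<and> (t a a' \<longleftrightarrow> t' b b') \<and> (a \<noteq> a' \<longrightarrow> h (f a a') = f' b b')"
  using assms unfolding partial_iso_def by simp_all

text \<open>The new point is placed relative to its closest neighbours in the domain, which determine
  its position relative to all the others.\<close>

lemma partial_iso_forth:
  assumes "convex_ultrametric V t U r f" "convex_ultrametric V' t' U' r' f'"
    and rich: "rich V' t' U' f' N'"
    and h: "\<And>u. u \<in> U \<Longrightarrow> h u \<in> U'" "\<And>u v. u \<in> U \<Longrightarrow> v \<in> U \<Longrightarrow> r u v \<longleftrightarrow> r' (h u) (h v)"
    and P: "partial_iso V t f N V' t' f' N' h R" and z: "z \<in> V"
  shows "\<exists>w\<in>V'. partial_iso V t f N V' t' f' N' h (insert (z, w) R)"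
proof -
  interpret A: convex_ultrametric V t U r f by fact
  interpret B: convex_ultrametric V' t' U' r' f' by fact
  note up = richD(3)[OF rich] and down = richD(4)[OF rich] and between = richD(5)[OF rich]
  note R = partial_isoD[OF P]
  show ?thesis
  proof (cases "z \<in> Domain R")
    case True
    then obtain w where "(z, w) \<in> R" by blast
    then have "insert (z, w) R = R" "w \<in> V'" using R(2) by blast+
    then show ?thesis using P by (intro bexI[of _ w]) simp_all
  next
    case False
    \<comment> \<open>Only the conditions from an old point to the new one need checking; those in
      the other direction follow from the symmetry of \<open>f\<close> and the totality of the
      orders.\<close>
    have suff: ?thesis if w: "w \<in> V'" "N z = N' w" and
      *: "\<And>a b. (a, b) \<in> R \<Longrightarrow> b \<noteq> w \<and> (t a z \<longleftrightarrow> t' b w) \<and> h (f a z) = f' b w" for w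
    proof
      show "w \<in> V'" by fact
      have 1: "a \<noteq> z \<and> (t z a \<longleftrightarrow> t' w b) \<and> h (f z a) = f' w b" if ab: "(a, b) \<in> R" for a b
      proof -
        have "a \<in> V" "b \<in> V'" "a \<noteq> z" "b \<noteq> w" using ab R(2) False *[OF ab] by blast+
        then show ?thesis
          using *[OF ab] A.V_total[of a z] A.V_asym[of a z] B.V_total[of b w] B.V_asym[of b w]
            A.f_sym[of a z] B.f_sym[of b w] z w by metis
      qed
      have "\<not> t z z" "\<not> t' w w" using A.V_irrefl z B.V_irrefl w by blast+
      moreover have "(z, b) \<notin> R" "(a, w) \<notin> R" for a b using * 1 by blast+
      ultimately show "partial_iso V t f N V' t' f' N' h (insert (z, w) R)"
        using R w z * 1 unfolding partial_iso_def by (auto 0 3)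
    qed
    show ?thesis
    proof (cases "R = {}")
      case True
      obtain b m where "b \<in> V'" "m \<in> U'" using richD(1,2)[OF rich] by blast
      then obtain w where "w \<in> V'" "N' w = N z" using up[of b m "N z"] by blast
      then show ?thesis using suff[of w] True by auto
    next
      case False
      note zR = \<open>z \<notin> Domain R\<close>
      have DV: "Domain R \<subseteq> V" using R(2) by blast
      have inU: "f a z \<in> U" if "a \<in> Domain R" for a
        using that DV zR z A.f_in by blast
      let ?D = "(\<lambda>a. f a z) ` Domain R"
      have "finite ?D" "?D \<noteq> {}" "?D \<subseteq> U" using R(1) False inU by (auto simp: finite_Domain)
      \<comment> \<open>Larger values are closer, so the greatest value \<open>m\<close> is the
        closeness of \<open>z\<close> to its nearest points in the domain.\<close>
      then obtain m where m: "m \<in> ?D" "\<And>s. s \<in> ?D \<Longrightarrow> s \<noteq> m \<Longrightarrow> r s m"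
        using finite_strict_linorder_has_min[of ?D U "\<lambda>x y. r y x"]
          strict_linorder_on_conv[OF A.U_lin] by blast
      have mU: "m \<in> U" using m \<open>?D \<subseteq> U\<close> by blast
      let ?lo = "{a \<in> Domain R. f a z = m \<and> t a z}"
      let ?hi = "{a \<in> Domain R. f a z = m \<and> t z a}"
      have ne: "?lo \<noteq> {} \<or> ?hi \<noteq> {}"
        using m(1) DV zR z A.V_total by fast
      have fin: "finite ?lo" "finite ?hi" using R(1) by (auto simp: finite_Domain)
      \<comment> \<open>Among the nearest points on one side of \<open>z\<close>, the one next to
        \<open>z\<close> in the order will serve as the reference point.\<close>
      have lo: "\<exists>a b. (a, b) \<in> R \<and> f a z = m \<and> t a z \<and>
                   (\<forall>x. x \<in> Domain R \<and> f x z = m \<and> t x z \<and> x \<noteq> a \<longrightarrow> t x a)" if "?lo \<noteq> {}"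
        using finite_strict_linorder_has_min[OF fin(1) that _ strict_linorder_on_conv[OF A.V_lin]] DV
        by fast
      have hi: "\<exists>a b. (a, b) \<in> R \<and> f a z = m \<and> t z a \<and>
                   (\<forall>x. x \<in> Domain R \<and> f x z = m \<and> t z x \<and> x \<noteq> a \<longrightarrow> t a x)" if "?hi \<noteq> {}"
        using finite_strict_linorder_has_min[OF fin(2) that _ A.V_lin] DV by fast
      \<comment> \<open>A point that is not among the nearest sees \<open>z\<close> and the
        reference point \<open>p\<close> alike, by \<open>far_point\<close>. Its partner sees
        \<open>q\<close> and \<open>w\<close> alike for the same reason, so the known relation to
        \<open>q\<close> carries over to \<open>w\<close>.\<close>
      have far: "b \<noteq> w \<and> (t a z \<longleftrightarrow> t' b w) \<and> h (f a z) = f' b w"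
        if w: "w \<in> V'" and p: "(p, q) \<in> R" "f p z = m" "f' q w = h m" "q \<noteq> w"
          and ab: "(a, b) \<in> R" "f a z \<noteq> m" for a b p q w
      proof -
        have mem: "a \<in> V" "p \<in> V" "b \<in> V'" "q \<in> V'" "a \<noteq> z" "p \<noteq> z" "a \<noteq> p" "b \<noteq> q"
          using ab p R(2) zR R(4)[OF ab(1) p(1)] by blast+
        have "r (f a z) m" using m(2) ab by blast
        then have "r (f a z) (f z p)" using p(2) A.f_sym mem z by metis
        from A.far_point[OF mem(1) z mem(2) mem(5,7) _ this] mem
        have A: "f a p = f a z" "t a p \<longleftrightarrow> t a z" by auto
        have hab: "f' b q = h (f a z)" "t' b q \<longleftrightarrow> t a z"
          using R(4)[OF ab(1) p(1)] mem A by auto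
        then have B: "r' (f' b q) (f' q w)"
          using \<open>r (f a z) m\<close> p(3) h(2)[of "f a z" m] mU inU ab by auto
        have "b \<noteq> w"
        proof
          assume "b = w"
          then have "f' b q = f' q w" using B.f_sym mem w by metis
          then show False using B B.U_irrefl B.f_in mem w p by metis
        qed
        then show ?thesis
          using B.far_point[OF mem(3,4) w mem(8) _ _ B] p(4) hab by auto
      qed
      \<comment> \<open>Another nearest point below \<open>z\<close> lies below \<open>p\<close> and
        is at least as close to \<open>p\<close> as to \<open>z\<close>. Carried over by
        \<open>h\<close>, this excludes the only alternative of the triple \<open>b\<close>,
        \<open>q\<close>, \<open>w\<close> in which \<open>f' b w\<close> differs from
        \<open>h m\<close>.\<close>
      have low: "b \<noteq> w \<and> t' b w \<and> f' b w = h m"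
        if w: "w \<in> V'" and p: "(p, q) \<in> R" "f p z = m" "t p z" "f' q w = h m" "t' q w"
          "\<And>x. x \<in> Domain R \<Longrightarrow> f x z = m \<Longrightarrow> t x z \<Longrightarrow> x \<noteq> p \<Longrightarrow> t x p"
          and ab: "(a, b) \<in> R" "f a z = m" "t a z" for a b p q w
      proof (cases "a = p")
        case True
        then have "b = q" using R(4)[OF ab(1) p(1)] by blast
        then show ?thesis using p B.V_irrefl w by blast
      next
        case False
        have mem: "a \<in> V" "p \<in> V" "b \<in> V'" "q \<in> V'" "b \<noteq> q"
          using ab p R(2) R(4)[OF ab(1) p(1)] False by blast+
        have ap: "t a p" using p(6)[of a] ab False by blast
        have 1: "f a p = m \<or> r m (f a p)"
          using A.f_triple[OF mem(1,2) z ap p(3)] ab(2) p(2) A.U_irrefl mU by metis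
        have 2: "t' b q" "f' b q = h (f a p)" using R(4)[OF ab(1) p(1)] ap False by simp_all
        then have bw: "t' b w" using B.V_trans mem w p by blast
        have "f a p \<in> U" using A.f_in mem False by blast
        then have 3: "f' b q = h m \<or> r' (h m) (f' b q)" using 1 2 h(2) mU by metis
        have hm: "h m \<in> U'" using h mU by blast
        have "f' b w = h m"
          using B.f_triple[OF mem(3,4) w 2(1) p(5)] 3 p(4) B.U_irrefl[OF hm] B.U_asym[OF hm]
            B.f_in[OF mem(3,4,5)] by metis
        then show ?thesis using bw B.V_irrefl w by blast
      qed
      have high: "b \<noteq> w \<and> t' w b \<and> f' b w = h m"
        if w: "w \<in> V'" and p: "(p, q) \<in> R" "f p z = m" "t z p" "f' q w = h m" "t' w q"
          "\<And>x. x \<in> Domain R \<Longrightarrow> f x z = m \<Longrightarrow> t z x \<Longrightarrow> x \<noteq> p \<Longrightarrow> t p x"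
          and ab: "(a, b) \<in> R" "f a z = m" "t z a" for a b p q w
      proof (cases "a = p")
        case True
        then have "b = q" using R(4)[OF ab(1) p(1)] by blast
        then show ?thesis using p B.V_irrefl w by blast
      next
        case False
        interpret A': convex_ultrametric V "\<lambda>x y. t y x" U r f by (rule A.convex_ultrametric_conv)
        interpret B': convex_ultrametric V' "\<lambda>x y. t' y x" U' r' f' by (rule B.convex_ultrametric_conv)
        have mem: "a \<in> V" "p \<in> V" "b \<in> V'" "q \<in> V'" "b \<noteq> q"
          using ab p R(2) R(4)[OF ab(1) p(1)] False by blast+
        have ap: "t p a" using p(6)[of a] ab False by blast
        have 1: "f a p = m \<or> r m (f a p)"
          using A'.f_triple[OF mem(1,2) z ap p(3)] ab(2) p(2) A.U_irrefl mU by metis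
        have 2: "t' q b" "f' b q = h (f a p)"
          using R(4)[OF p(1) ab(1)] R(4)[OF ab(1) p(1)] ap False by simp_all
        then have bw: "t' w b" using B.V_trans mem w p by blast
        have "f a p \<in> U" using A.f_in mem False by blast
        then have 3: "f' b q = h m \<or> r' (h m) (f' b q)" using 1 2 h(2) mU by metis
        have hm: "h m \<in> U'" using h mU by blast
        have "f' b w = h m"
          using B'.f_triple[OF mem(3,4) w 2(1) p(5)] 3 p(4) B.U_irrefl[OF hm] B.U_asym[OF hm]
            B.f_in[OF mem(3,4,5)] by metis
        then show ?thesis using bw B.V_irrefl w by blast
      qed
      show ?thesis
      proof (cases "?lo = {}")
        case nolo: True
        then obtain p q where p: "(p, q) \<in> R" "f p z = m" "t z p"
          "\<And>x. x \<in> Domain R \<Longrightarrow> f x z = m \<Longrightarrow> t z x \<Longrightarrow> x \<noteq> p \<Longrightarrow> t p x"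
          using hi ne by metis
        have q: "q \<in> V'" using p R(2) by blast
        obtain w where w: "w \<in> V'" "t' w q" "f' q w = h m" "N' w = N z"
          using down[OF q, of "h m" "N z"] h mU by blast
        have qw: "q \<noteq> w" using w B.V_irrefl by blast
        show ?thesis
        proof (rule suff[OF w(1)])
          fix a b assume ab: "(a, b) \<in> R"
          show "b \<noteq> w \<and> (t a z \<longleftrightarrow> t' b w) \<and> h (f a z) = f' b w"
          proof (cases "f a z = m")
            case True
            then have nt: "\<not> t a z" using nolo ab by blast
            then have "t z a" using A.V_total z DV ab zR by blast
            note hg = high[OF w(1) p(1-3) w(3,2) p(4) ab True this]
            have "b \<in> V'" using ab R(2) by blast
            then have "\<not> t' b w" using B.V_asym[OF w(1)] hg by blast
            then show ?thesis using hg nt True by simp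
          next
            case False
            show ?thesis by (rule far[OF w(1) p(1,2) w(3) qw ab False])
          qed
        qed (use w in simp)
      next
        case False
        then obtain p q where p: "(p, q) \<in> R" "f p z = m" "t p z"
          "\<And>x. x \<in> Domain R \<Longrightarrow> f x z = m \<Longrightarrow> t x z \<Longrightarrow> x \<noteq> p \<Longrightarrow> t x p"
          using lo by metis
        have q: "q \<in> V'" "p \<in> V" using p R(2) by blast+
        show ?thesis
        proof (cases "?hi = {}")
          case nohi: True
          obtain w where w: "w \<in> V'" "t' q w" "f' q w = h m" "N' w = N z"
            using up[OF q(1), of "h m" "N z"] h mU by blast
          have qw: "q \<noteq> w" using w B.V_irrefl by blast
          show ?thesis
          proof (rule suff[OF w(1)])
            fix a b assume ab: "(a, b) \<in> R"
            show "b \<noteq> w \<and> (t a z \<longleftrightarrow> t' b w) \<and> h (f a z) = f' b w"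
            proof (cases "f a z = m")
              case True
              then have "\<not> t z a" using nohi ab by blast
              then have "t a z" using A.V_total z DV ab zR by blast
              from this low[OF w(1) p(1-3) w(3,2) p(4) ab True this]
              show ?thesis using True by simp
            next
              case False
              show ?thesis by (rule far[OF w(1) p(1,2) w(3) qw ab False])
            qed
          qed (use w in simp)
        next
          case False
          then obtain p' q' where p': "(p', q') \<in> R" "f p' z = m" "t z p'"
            "\<And>x. x \<in> Domain R \<Longrightarrow> f x z = m \<Longrightarrow> t z x \<Longrightarrow> x \<noteq> p' \<Longrightarrow> t p' x"
            using hi by metis
          have q': "q' \<in> V'" "p' \<in> V" using p' R(2) by blast+
          have pp': "t p p'" using A.V_trans[OF q(2) z q'(2)] p p' by blast
          then have ne': "p \<noteq> p'" using A.V_irrefl q by blast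
          have "f z p' = m" using p'(2) A.f_sym[OF z q'(2)] zR p'(1) by (metis Domain.DomainI)
          \<comment> \<open>Since \<open>z\<close> has closeness \<open>m\<close> to both
            neighbours, the triple condition forces the same closeness between them. A point between
            their partners is then available at closeness exactly \<open>h m\<close> to
            both.\<close>
          then have "f p p' = m"
            using A.f_triple[OF q(2) z q'(2) p(3) p'(3)] p(2) A.U_irrefl mU by metis
          then have qq': "t' q q'" "f' q q' = h m" using R(4)[OF p(1) p'(1)] pp' ne' by auto
          obtain w where w: "w \<in> V'" "t' q w" "t' w q'" "f' q w = h m" "f' q' w = h m" "N' w = N z"
            using between[OF q(1) q'(1) qq'(1), of "N z"] qq'(2) by auto
          have qw: "q \<noteq> w" using w B.V_irrefl by blast
          show ?thesis
          proof (rule suff[OF w(1)])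
            fix a b assume ab: "(a, b) \<in> R"
            show "b \<noteq> w \<and> (t a z \<longleftrightarrow> t' b w) \<and> h (f a z) = f' b w"
            proof (cases "f a z = m")
              case True
              have "b \<in> V'" using ab R(2) by blast
              show ?thesis
              proof (cases "t a z")
                case t: True
                then show ?thesis using low[OF w(1) p(1-3) w(4,2) p(4) ab True t] True by simp
              next
                case t: False
                then have "t z a" using A.V_total z DV ab zR by blast
                note hg = high[OF w(1) p'(1-3) w(5,3) p'(4) ab True this]
                then have "\<not> t' b w" using B.V_asym[OF w(1) \<open>b \<in> V'\<close>] by blast
                then show ?thesis using hg t True by simp
              qed
            next
              case False
              show ?thesis by (rule far[OF w(1) p(1,2) w(4) qw ab False])
            qed
          qed (use w in simp)
        qed
      qed
    qed
  qed
qed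

section \<open>Back-and-forth and the uniqueness of countable rich spaces\<close>

lemma partial_iso_converse:
  assumes "partial_iso V t f N V' t' f' N' h R"
    and "\<And>x y. x \<in> V \<Longrightarrow> y \<in> V \<Longrightarrow> x \<noteq> y \<Longrightarrow> k (h (f x y)) = f x y"
  shows "partial_iso V' t' f' N' V t f N k (R\<inverse>)"
proof -
  note R = partial_isoD[OF assms(1)]
  have "k (f' b b') = f a a'" if "(a, b) \<in> R" "(a', b') \<in> R" "b \<noteq> b'" for a b a' b'
    using R(4)[OF that(1,2)] that assms(2)[of a a'] R(2) by force
  then show ?thesis
    using R(1-3) R(4) unfolding partial_iso_def by (auto 0 4)
qed

text \<open>Stage \<open>n\<close> settles the \<open>n\<close>-th elements of both sides.
  \<open>P\<close> is meant for finite relations and is therefore not claimed for the union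
  \<open>T\<close> of the stages; what survives is that each finite part of \<open>T\<close> lies
  inside some relation satisfying \<open>P\<close>, which is enough for properties of pairs.\<close>

lemma back_and_forth:
  assumes "countable V" "countable V'" "V \<noteq> {}" "V' \<noteq> {}" "P {}"
    and forward: "\<And>R a. P R \<Longrightarrow> a \<in> V \<Longrightarrow> \<exists>b\<in>V'. P (insert (a, b) R)"
    and backward: "\<And>R b. P R \<Longrightarrow> b \<in> V' \<Longrightarrow> \<exists>a\<in>V. P (insert (a, b) R)"
  shows "\<exists>T. V \<subseteq> Domain T \<and> V' \<subseteq> Range T \<and> (\<forall>S. finite S \<longrightarrow> S \<subseteq> T \<longrightarrow> (\<exists>R. S \<subseteq> R \<and> P R))"
proof -
  let ?a = "from_nat_into V" let ?b = "from_nat_into V'"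
  have "\<exists>R'. R \<subseteq> R' \<and> P R' \<and> ?a n \<in> Domain R' \<and> ?b n \<in> Range R'" if PR: "P R" for R n
  proof -
    obtain b where b: "P (insert (?a n, b) R)"
      using forward[OF PR from_nat_into[OF assms(3)]] by blast
    then obtain a where "P (insert (a, ?b n) (insert (?a n, b) R))"
      using backward[OF b from_nat_into[OF assms(4)]] by blast
    then show ?thesis by (intro exI[of _ "insert (a, ?b n) (insert (?a n, b) R)"]) blast
  qed
  then obtain s where s: "\<And>R n. P R \<Longrightarrow> R \<subseteq> s R n \<and> P (s R n) \<and> ?a n \<in> Domain (s R n) \<and> ?b n \<in> Range (s R n)"
    by metis
  define Y where "Y = rec_nat {} (\<lambda>n R. s R n)"
  have Y: "Y 0 = {}" "\<And>n. Y (Suc n) = s (Y n) n" by (simp_all add: Y_def)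
  have PY: "P (Y n)" for n by (induction n) (use Y s assms(5) in auto)
  have mono: "Y m \<subseteq> Y n" if "m \<le> n" for m n
    using that by (rule lift_Suc_mono_le[of Y, rotated]) (use s[OF PY] Y in auto)
  have fin: "\<exists>n. S \<subseteq> Y n" if "finite S" "S \<subseteq> (\<Union>n. Y n)" for S
    using that
  proof (induction S)
    case (insert x S)
    then obtain m n where "S \<subseteq> Y m" "x \<in> Y n" by auto
    then have "insert x S \<subseteq> Y (max m n)"
      using mono[of m "max m n"] mono[of n "max m n"] by auto
    then show ?case by blast
  qed simp
  show ?thesis
  proof (rule exI[of _ "\<Union>n. Y n"], intro conjI subsetI allI impI)
    fix x assume "x \<in> V"
    then obtain n where "x = ?a n" using assms(1) from_nat_into_surj by metis
    then have "x \<in> Domain (Y (Suc n))" using s[OF PY, of n n] Y by auto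
    then show "x \<in> Domain (\<Union>n. Y n)" by blast
  next
    fix x assume "x \<in> V'"
    then obtain n where "x = ?b n" using assms(2) from_nat_into_surj by metis
    then have "x \<in> Range (Y (Suc n))" using s[OF PY, of n n] Y by auto
    then show "x \<in> Range (\<Union>n. Y n)" by blast
  next
    fix S assume "finite S" "S \<subseteq> (\<Union>n. Y n)"
    then obtain n where "S \<subseteq> Y n" using fin by blast
    then show "\<exists>R. S \<subseteq> R \<and> P R" using PY[of n] by (intro exI[of _ "Y n"]) simp
  qed
qed

lemma rich_unique:
  assumes A: "convex_ultrametric V t U r f" and B: "convex_ultrametric V' t' U' r' f'"
    and "rich V t U f N" "rich V' t' U' f' N'" "countable V" "countable V'"
    and h: "bij_betw h U U'" "\<And>u v. u \<in> U \<Longrightarrow> v \<in> U \<Longrightarrow> r u v \<longleftrightarrow> r' (h u) (h v)"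
  shows "\<exists>g. bij_betw g V V' \<and> (\<forall>x\<in>V. N x = N' (g x)) \<and>
     (\<forall>x\<in>V. \<forall>y\<in>V. (t x y \<longleftrightarrow> t' (g x) (g y)) \<and> (x \<noteq> y \<longrightarrow> h (f x y) = f' (g x) (g y)))"
proof -
  let ?k = "inv_into U h"
  let ?P = "partial_iso V t f N V' t' f' N' h"
  have hU: "h u \<in> U'" "?k (h u) = u" if "u \<in> U" for u
    using that h(1) by (auto simp: bij_betw_def)
  have kU: "?k u \<in> U" "h (?k u) = u" if "u \<in> U'" for u
    using that h(1) bij_betw_inv_into_right[OF h(1) that] by (auto simp: bij_betw_def inv_into_into)
  have kr: "r' u v \<longleftrightarrow> r (?k u) (?k v)" if "u \<in> U'" "v \<in> U'" for u v
    using h(2) kU that by simp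
  have fU: "f x y \<in> U" if "x \<in> V" "y \<in> V" "x \<noteq> y" for x y
    using convex_ultrametric.f_in[OF A that] .
  have f'U: "f' x y \<in> U'" if "x \<in> V'" "y \<in> V'" "x \<noteq> y" for x y
    using convex_ultrametric.f_in[OF B that] .
  have "\<exists>T. V \<subseteq> Domain T \<and> V' \<subseteq> Range T \<and> (\<forall>S. finite S \<longrightarrow> S \<subseteq> T \<longrightarrow> (\<exists>R. S \<subseteq> R \<and> ?P R))"
  proof (rule back_and_forth)
    show "V \<noteq> {}" "V' \<noteq> {}" using assms(3,4) unfolding rich_def by blast+
    show "?P {}" unfolding partial_iso_def by simp
    show "\<exists>b\<in>V'. ?P (insert (a, b) R)" if "?P R" "a \<in> V" for R a
      by (rule partial_iso_forth[OF A B assms(4) hU(1) h(2) that])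
    show "\<exists>a\<in>V. ?P (insert (a, b) R)" if R: "?P R" and b: "b \<in> V'" for R b
    proof -
      have "partial_iso V' t' f' N' V t f N ?k (R\<inverse>)"
        by (rule partial_iso_converse[OF R]) (use fU hU in auto)
      from partial_iso_forth[OF B A assms(3) kU(1) kr this b]
      obtain a where "a \<in> V" "partial_iso V' t' f' N' V t f N ?k (insert (b, a) (R\<inverse>))" by blast
      moreover have "(insert (b, a) (R\<inverse>))\<inverse> = insert (a, b) R" by auto
      ultimately show ?thesis
        using partial_iso_converse[of V' t' f' N' V t f N ?k "insert (b, a) (R\<inverse>)" h] f'U kU
        by metis
    qed
  qed fact+
  then obtain T where T: "V \<subseteq> Domain T" "V' \<subseteq> Range T"
    "\<And>S. finite S \<Longrightarrow> S \<subseteq> T \<Longrightarrow> \<exists>R. S \<subseteq> R \<and> ?P R" by blast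
  \<comment> \<open>Each of these properties involves at most two pairs, so it can be read off one
    finite relation.\<close>
  have T2: "(a = a' \<longleftrightarrow> b = b') \<and> (t a a' \<longleftrightarrow> t' b b') \<and> (a \<noteq> a' \<longrightarrow> h (f a a') = f' b b') \<and>
            N a = N' b \<and> a \<in> V \<and> b \<in> V'"
    if "(a, b) \<in> T" "(a', b') \<in> T" for a b a' b'
  proof -
    obtain R where R: "(a, b) \<in> R" "(a', b') \<in> R" "?P R"
      using T(3)[of "{(a, b), (a', b')}"] \<open>(a, b) \<in> T\<close> \<open>(a', b') \<in> T\<close> by auto
    show ?thesis
      using partial_isoD(2)[OF R(3)] partial_isoD(3)[OF R(3,1)] partial_isoD(4)[OF R(3,1,2)] R(1)
      by blast
  qed
  have "\<forall>x\<in>V. \<exists>y. (x, y) \<in> T" using T(1) by blast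
  then obtain g where g: "\<And>x. x \<in> V \<Longrightarrow> (x, g x) \<in> T" by metis
  have "bij_betw g V V'"
    unfolding bij_betw_def
  proof
    show "inj_on g V" using g T2 by (metis inj_onI)
    show "g ` V = V'"
    proof (intro equalityI subsetI)
      fix y assume "y \<in> V'"
      then obtain x where "(x, y) \<in> T" using T(2) by blast
      then have "x \<in> V" "y = g x" using T2 g by metis+
      then show "y \<in> g ` V" by blast
    qed (use g T2 in blast)
  qed
  then show ?thesis using g T2 by (intro exI[of _ g]) blast
qed

section \<open>Transport along injections and bijections\<close>

lemma convex_ultrametric_transfer:
  assumes "convex_ultrametric V t U r f" "inj_on g V'" "inj_on k U'"
    and g: "\<And>x. x \<in> V' \<Longrightarrow> g x \<in> V" and k: "\<And>u. u \<in> U' \<Longrightarrow> k u \<in> U"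
    and t: "\<And>x y. x \<in> V' \<Longrightarrow> y \<in> V' \<Longrightarrow> t' x y \<longleftrightarrow> t (g x) (g y)"
    and r: "\<And>u v. u \<in> U' \<Longrightarrow> v \<in> U' \<Longrightarrow> r' u v \<longleftrightarrow> r (k u) (k v)"
    and f'_in: "\<And>x y. x \<in> V' \<Longrightarrow> y \<in> V' \<Longrightarrow> x \<noteq> y \<Longrightarrow> f' x y \<in> U'"
    and f: "\<And>x y. x \<in> V' \<Longrightarrow> y \<in> V' \<Longrightarrow> x \<noteq> y \<Longrightarrow> k (f' x y) = f (g x) (g y)"
  shows "convex_ultrametric V' t' U' r' f'"
proof -
  interpret convex_ultrametric V t U r f by fact
  have keq: "k u = k v \<longleftrightarrow> u = v" if "u \<in> U'" "v \<in> U'" for u v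
    using that assms(3) by (auto dest: inj_onD)
  have geq: "g u = g v \<longleftrightarrow> u = v" if "u \<in> V'" "v \<in> V'" for u v
    using that assms(2) by (auto dest: inj_onD)
  show ?thesis
  proof
    show "strict_linorder_on V' t'" by (rule strict_linorder_on_image[OF V_lin g assms(2) t])
    show "strict_linorder_on U' r'" by (rule strict_linorder_on_image[OF U_lin k assms(3) r])
    fix x y assume xy: "x \<in> V'" "y \<in> V'"
    show "f' x y \<in> U'" if "x \<noteq> y" by (rule f'_in[OF xy that])
    show "f' x y = f' y x" if "x \<noteq> y"
    proof -
      have "k (f' x y) = k (f' y x)"
        using f[of x y] f[of y x] f_sym[of "g x" "g y"] xy that g geq by metis
      then show ?thesis using keq f'_in xy that by metis
    qed
    fix z assume z: "z \<in> V'" and "t' x y" "t' y z"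
    then have T: "t (g x) (g y)" "t (g y) (g z)" using t xy by blast+
    have "g x \<noteq> g y" "g y \<noteq> g z" "g x \<noteq> g z" using T V_irrefl V_asym g xy z by metis+
    then have ne: "x \<noteq> y" "y \<noteq> z" "x \<noteq> z" by blast+
    note U = f'_in[OF xy ne(1)] f'_in[OF xy(2) z ne(2)] f'_in[OF xy(1) z ne(3)]
    note F = f[OF xy ne(1)] f[OF xy(2) z ne(2)] f[OF xy(1) z ne(3)]
    from f_triple[OF g[OF xy(1)] g[OF xy(2)] g[OF z] T]
    show "f' x y = f' x z \<and> f' x z = f' y z \<or> f' x y = f' x z \<and> r' (f' x z) (f' y z) \<or>
       f' x z = f' y z \<and> r' (f' y z) (f' x y)"
      unfolding F[symmetric] using U by (simp add: keq r)
  qed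
qed

text \<open>The clauses of richness are existential and so use surjectivity on points and values,
  whereas the universal axioms pull back along injections. Irreflexivity is what separates a witness
  from \<open>b\<close>; the values of \<open>f\<close> are controlled at distinct points
  only.\<close>

lemma rich_transfer:
  assumes "rich V t U f N" "bij_betw g V' V" "bij_betw k U' U"
    and irr: "\<And>x. x \<in> V \<Longrightarrow> \<not> t x x"
    and t: "\<And>x y. x \<in> V' \<Longrightarrow> y \<in> V' \<Longrightarrow> t' x y \<longleftrightarrow> t (g x) (g y)"
    and N: "\<And>x. x \<in> V' \<Longrightarrow> N' x \<longleftrightarrow> N (g x)"
    and f_in: "\<And>x y. x \<in> V' \<Longrightarrow> y \<in> V' \<Longrightarrow> x \<noteq> y \<Longrightarrow> f' x y \<in> U'"
    and f: "\<And>x y. x \<in> V' \<Longrightarrow> y \<in> V' \<Longrightarrow> x \<noteq> y \<Longrightarrow> k (f' x y) = f (g x) (g y)"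
  shows "rich V' t' U' f' N'"
proof -
  have im: "V = g ` V'" "U = k ` U'" using assms(2,3) by (auto simp: bij_betw_def)
  have keq: "k u = k v \<longleftrightarrow> u = v" if "u \<in> U'" "v \<in> U'" for u v
    using that assms(3) by (auto simp: bij_betw_def dest: inj_onD)
  have irr': "\<not> t (g x) (g x)" if "x \<in> V'" for x using irr im that by blast
  have feq: "f' x y = m \<longleftrightarrow> f (g x) (g y) = k m" if "x \<in> V'" "y \<in> V'" "x \<noteq> y" "m \<in> U'" for x y m
    using keq[of "f' x y" m] f_in f that by metis
  show ?thesis
    unfolding rich_def
  proof (intro conjI ballI allI impI)
    show "V' \<noteq> {}" "U' \<noteq> {}" using richD(1,2)[OF assms(1)] im by auto
    fix b m c assume bm: "b \<in> V'" "m \<in> U'"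
    have gb: "g b \<in> V" "k m \<in> U" using im bm by blast+
    obtain z where "z \<in> V'" "t (g b) (g z)" "f (g b) (g z) = k m" "N (g z) = c"
      using richD(3)[OF assms(1) gb, of c] im by blast
    moreover from this have "b \<noteq> z" using irr' bm by metis
    ultimately show "\<exists>z\<in>V'. t' b z \<and> f' b z = m \<and> N' z = c" using bm t N feq by metis
    obtain z where "z \<in> V'" "t (g z) (g b)" "f (g b) (g z) = k m" "N (g z) = c"
      using richD(4)[OF assms(1) gb, of c] im by blast
    moreover from this have "b \<noteq> z" using irr' bm by metis
    ultimately show "\<exists>z\<in>V'. t' z b \<and> f' b z = m \<and> N' z = c" using bm t N feq by metis
  next
    fix b b' c assume b: "b \<in> V'" "b' \<in> V'" "t' b b'"
    then have T: "t (g b) (g b')" using t by blast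
    have gb: "g b \<in> V" "g b' \<in> V" using im b by blast+
    obtain z where z: "z \<in> V'" "t (g b) (g z)" "t (g z) (g b')" "f (g b) (g z) = f (g b) (g b')"
      "f (g b') (g z) = f (g b) (g b')" "N (g z) = c"
      using richD(5)[OF assms(1) gb T, of c] im by blast
    have ne: "b \<noteq> z" "b' \<noteq> z" "b \<noteq> b'" using irr' b z T by metis+
    have "f (g b) (g b') = k (f' b b')" "f' b b' \<in> U'" using f f_in b ne by metis+
    then show "\<exists>z\<in>V'. t' b z \<and> t' z b' \<and> f' b z = f' b b' \<and> f' b' z = f' b b' \<and> N' z = c"
      using z b t N feq ne by metis
  qed
qed

subsection \<open>Structures satisfying the universal part of the class \<open>K\<close>\<close>

lemma ext_lang_simps [simp]:
  "F_sym \<in> Funs (ext_lang L0)" "OldF g \<in> Funs (ext_lang L0) \<longleftrightarrow> g \<in> Funs L0"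
  "V_sym \<in> Rels (ext_lang L0)" "M_sym \<in> Rels (ext_lang L0)" "N_sym \<in> Rels (ext_lang L0)"
  "Tri_sym \<in> Rels (ext_lang L0)" "OldR r \<in> Rels (ext_lang L0) \<longleftrightarrow> r \<in> Rels L0"
  "farity (ext_lang L0) (OldF g) = farity L0 g" "farity (ext_lang L0) F_sym = 2"
  "rarity (ext_lang L0) (OldR r) = rarity L0 r" "rarity (ext_lang L0) V_sym = 1"
  "rarity (ext_lang L0) M_sym = 1" "rarity (ext_lang L0) N_sym = 1"
  "rarity (ext_lang L0) Tri_sym = 2"
  by (auto simp: ext_lang_def)

lemma length_2_iff: "length xs = 2 \<longleftrightarrow> (\<exists>x y. xs = [x, y])"
  by (auto simp: length_Suc_conv numeral_2_eq_2)

text \<open>Members of the class, the Fraisse limit, the uncountable model and its suitable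
  countable substructures all satisfy this, so that one isomorphism argument covers them. Linearity
  of \<open>lt\<close> on the M-part is included through \<open>convex_ultrametric\<close>.\<close>

definition K_like :: "('f, 'r) lang \<Rightarrow> 'r \<Rightarrow> ('a, 'f, 'r) ext_struct \<Rightarrow> bool" where
  "K_like L0 lt A \<longleftrightarrow> is_struct (ext_lang L0) A \<and> is_struct L0 (M_struct A) \<and>
     V_part A \<union> M_part A = univ A \<and> V_part A \<inter> M_part A = {} \<and>
     convex_ultrametric (V_part A) (tri A) (M_part A) (\<lambda>x y. relI A (OldR lt) [x, y]) (fI A) \<and>
     (\<forall>x\<in>univ A. relI A N_sym [x] \<longrightarrow> x \<in> V_part A) \<and> trivial_elsewhere L0 A"

abbreviation rich_struct :: "('a, 'f, 'r) ext_struct \<Rightarrow> bool" where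
  "rich_struct A \<equiv> rich (V_part A) (tri A) (M_part A) (fI A) (\<lambda>x. relI A N_sym [x])"

lemma M_struct_simps [simp]:
  "univ (M_struct A) = M_part A" "funI (M_struct A) g = funI A (OldF g)"
  "relI (M_struct A) r = relI A (OldR r)"
  by (simp_all add: M_struct_def)

lemma restrict_to_simps [simp]:
  "univ (restrict_to A X) = X" "funI (restrict_to A X) = funI A" "relI (restrict_to A X) = relI A"
  by (simp_all add: restrict_to_def)

lemma V_part_restrict: "X \<subseteq> univ A \<Longrightarrow> V_part (restrict_to A X) = V_part A \<inter> X"
  and M_part_restrict: "X \<subseteq> univ A \<Longrightarrow> M_part (restrict_to A X) = M_part A \<inter> X"
  by (auto simp: V_part_def M_part_def)

lemma M_struct_restrict: "X \<subseteq> univ A \<Longrightarrow> M_struct (restrict_to A X) = restrict_to (M_struct A) (M_part A \<inter> X)"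
  by (auto simp: M_struct_def M_part_def restrict_to_def)

lemma K_likeD:
  assumes "K_like L0 lt A"
  shows "is_struct (ext_lang L0) A" "is_struct L0 (M_struct A)"
    "univ A = V_part A \<union> M_part A" "V_part A \<inter> M_part A = {}"
    "convex_ultrametric (V_part A) (tri A) (M_part A) (\<lambda>x y. relI A (OldR lt) [x, y]) (fI A)"
    "\<And>x. x \<in> univ A \<Longrightarrow> relI A N_sym [x] \<Longrightarrow> x \<in> V_part A" "trivial_elsewhere L0 A"
  using assms unfolding K_like_def by auto

lemma trivial_elsewhereD:
  assumes "trivial_elsewhere L0 A"
  shows "\<And>r xs. r \<in> Rels L0 \<Longrightarrow> length xs = rarity L0 r \<Longrightarrow> set xs \<subseteq> univ A \<Longrightarrow>
           relI A (OldR r) xs \<Longrightarrow> set xs \<subseteq> M_part A"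
    "\<And>g xs. g \<in> Funs L0 \<Longrightarrow> length xs = farity L0 g \<Longrightarrow> set xs \<subseteq> univ A \<Longrightarrow>
           \<not> set xs \<subseteq> M_part A \<Longrightarrow> funI A (OldF g) xs = hd xs"
    "\<And>x y. x \<in> univ A \<Longrightarrow> y \<in> univ A \<Longrightarrow> tri A x y \<Longrightarrow> x \<in> V_part A \<and> y \<in> V_part A"
    "\<And>x y. x \<in> univ A \<Longrightarrow> y \<in> univ A \<Longrightarrow> \<not> (x \<in> V_part A \<and> y \<in> V_part A \<and> x \<noteq> y) \<Longrightarrow> fI A x y = x"
  using assms unfolding trivial_elsewhere_def by blast+

lemma trivial_elsewhereI:
  assumes "\<And>r xs. r \<in> Rels L0 \<Longrightarrow> length xs = rarity L0 r \<Longrightarrow> set xs \<subseteq> univ A \<Longrightarrow>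
           relI A (OldR r) xs \<Longrightarrow> set xs \<subseteq> M_part A"
    "\<And>g xs. g \<in> Funs L0 \<Longrightarrow> length xs = farity L0 g \<Longrightarrow> set xs \<subseteq> univ A \<Longrightarrow>
           \<not> set xs \<subseteq> M_part A \<Longrightarrow> funI A (OldF g) xs = hd xs"
    "\<And>x y. x \<in> univ A \<Longrightarrow> y \<in> univ A \<Longrightarrow> tri A x y \<Longrightarrow> x \<in> V_part A \<and> y \<in> V_part A"
    "\<And>x y. x \<in> univ A \<Longrightarrow> y \<in> univ A \<Longrightarrow> \<not> (x \<in> V_part A \<and> y \<in> V_part A \<and> x \<noteq> y) \<Longrightarrow> fI A x y = x"
  shows "trivial_elsewhere L0 A"
  using assms unfolding trivial_elsewhere_def by blast

lemma V_part_subset: "V_part A \<subseteq> univ A" and M_part_subset: "M_part A \<subseteq> univ A"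
  by (auto simp: V_part_def M_part_def)

lemma hd_in_set: "\<not> set xs \<subseteq> X \<Longrightarrow> hd xs \<in> set xs"
  by (cases xs) auto

text \<open>Since all symbols are trivial elsewhere, the two parts interact only through
  \<open>f\<close>. Isomorphisms of the parts that respect \<open>f\<close> therefore
  combine.\<close>

lemma is_iso_glue:
  fixes A :: "('a, 'f, 'r) ext_struct" and B :: "('b, 'f, 'r) ext_struct"
  assumes A: "K_like L0 lt A" and B: "K_like L0 lt B"
    and h: "is_iso L0 h (M_struct A) (M_struct B)"
    and g: "bij_betw g (V_part A) (V_part B)"
    and N: "\<And>x. x \<in> V_part A \<Longrightarrow> relI A N_sym [x] \<longleftrightarrow> relI B N_sym [g x]"
    and T: "\<And>x y. x \<in> V_part A \<Longrightarrow> y \<in> V_part A \<Longrightarrow> tri A x y \<longleftrightarrow> tri B (g x) (g y)"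
    and F: "\<And>x y. x \<in> V_part A \<Longrightarrow> y \<in> V_part A \<Longrightarrow> x \<noteq> y \<Longrightarrow> h (fI A x y) = fI B (g x) (g y)"
  shows "is_iso (ext_lang L0) (\<lambda>x. if x \<in> M_part A then h x else g x) A B"
proof -
  define k where "k x = (if x \<in> M_part A then h x else g x)" for x
  note uA = K_likeD(3,4)[OF A] and uB = K_likeD(3,4)[OF B]
  note tA = trivial_elsewhereD[OF K_likeD(7)[OF A]] and tB = trivial_elsewhereD[OF K_likeD(7)[OF B]]
  have hM: "bij_betw h (M_part A) (M_part B)" using is_iso_bij[OF h] by simp
  have kM: "k x \<in> M_part B" if "x \<in> M_part A" for x using that hM by (auto simp: k_def bij_betw_def)
  have notM: "x \<notin> M_part A" if "x \<in> V_part A" for x using uA that by blast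
  have kV: "k x = g x" "g x \<in> V_part B" "g x \<notin> M_part B" if "x \<in> V_part A" for x
    using that g uA uB by (auto simp: k_def bij_betw_def)
  have kMiff: "k x \<in> M_part B \<longleftrightarrow> x \<in> M_part A" "k x \<in> V_part B \<longleftrightarrow> x \<in> V_part A"
    "k x \<in> univ B" if "x \<in> univ A" for x
  proof -
    have "x \<in> V_part A \<and> x \<notin> M_part A \<and> k x \<in> V_part B \<and> k x \<notin> M_part B \<or>
          x \<notin> V_part A \<and> x \<in> M_part A \<and> k x \<notin> V_part B \<and> k x \<in> M_part B"
    proof (cases "x \<in> V_part A")
      case True
      then show ?thesis using kV[OF True] notM[OF True] by simp
    next
      case False
      then have "x \<in> M_part A" using that uA by blast
      then show ?thesis using kM[of x] False uB by blast
    qed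
    then show "k x \<in> M_part B \<longleftrightarrow> x \<in> M_part A" "k x \<in> V_part B \<longleftrightarrow> x \<in> V_part A"
      "k x \<in> univ B" unfolding uB(1) by blast+
  qed
  have "is_iso (ext_lang L0) k A B"
  proof (rule is_isoI)
    show "is_struct (ext_lang L0) A" "is_struct (ext_lang L0) B"
      by (rule K_likeD(1)[OF A] K_likeD(1)[OF B])+
    show bij: "bij_betw k (univ A) (univ B)"
      unfolding uA(1) uB(1)
    proof (rule bij_betw_combine)
      show "bij_betw k (V_part A) (V_part B)"
        using g notM bij_betw_cong[of "V_part A" k g] by (simp add: k_def)
      show "bij_betw k (M_part A) (M_part B)"
        using hM bij_betw_cong[of "M_part A" k h] by (simp add: k_def)
      show "V_part B \<inter> M_part B = {}" by fact
    qed
    have sub: "set (map k xs) \<subseteq> univ B" if "set xs \<subseteq> univ A" for xs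
      using that kMiff(3) by auto
    have subM: "set (map k xs) \<subseteq> M_part B \<longleftrightarrow> set xs \<subseteq> M_part A" if "set xs \<subseteq> univ A" for xs
      using that kMiff(1) by auto
    have mapM: "map k xs = map h xs" if "set xs \<subseteq> M_part A" for xs
      using that by (auto simp: subset_iff k_def)
    {
      fix s xs assume s: "s \<in> Funs (ext_lang L0)" and len: "length xs = farity (ext_lang L0) s"
        and xs: "set xs \<subseteq> univ A"
      show "k (funI A s xs) = funI B s (map k xs)"
      proof (cases s)
        case (OldF q)
        then have q: "q \<in> Funs L0" "length xs = farity L0 q" using s len by auto
        show ?thesis
        proof (cases "set xs \<subseteq> M_part A")
          case True
          have "funI A (OldF q) xs \<in> M_part A"
            using is_struct_closed[OF K_likeD(2)[OF A] q] True by simp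
          then have "k (funI A (OldF q) xs) = h (funI A (OldF q) xs)" by (simp add: k_def)
          then show ?thesis
            using is_iso_fun[OF h q] True OldF by (simp add: mapM[OF True] del: map_eq_conv)
        next
          case False
          have 1: "funI A s xs = hd xs" using tA(2)[OF q xs False] OldF by simp
          have "\<not> set (map k xs) \<subseteq> M_part B" using subM[OF xs] False by blast
          then have "funI B s (map k xs) = hd (map k xs)"
            using tB(2)[OF q(1) _ sub[OF xs]] q(2) OldF by simp
          moreover have "xs \<noteq> []" using False by auto
          ultimately show ?thesis using 1 by (simp add: hd_map)
        qed
      next
        case F_sym
        then obtain x y where xy: "xs = [x, y]" using len by (auto simp: length_2_iff)
        then have u: "x \<in> univ A" "y \<in> univ A" using xs by auto
        show ?thesis
        proof (cases "x \<in> V_part A \<and> y \<in> V_part A \<and> x \<noteq> y")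
          case True
          then have "fI A x y \<in> M_part A" using convex_ultrametric.f_in[OF K_likeD(5)[OF A]] by blast
          then have "k (fI A x y) = h (fI A x y)" by (simp add: k_def)
          then show ?thesis using F True F_sym xy kV(1) by simp
        next
          case False
          have "\<not> (k x \<in> V_part B \<and> k y \<in> V_part B \<and> k x \<noteq> k y)"
            using False kMiff(2)[OF u(1)] kMiff(2)[OF u(2)] by blast
          from tB(4)[OF kMiff(3)[OF u(1)] kMiff(3)[OF u(2)] this]
          show ?thesis using tA(4)[OF u False] F_sym xy by simp
        qed
      qed
    next
      fix s xs assume s: "s \<in> Rels (ext_lang L0)" and len: "length xs = rarity (ext_lang L0) s"
        and xs: "set xs \<subseteq> univ A"
      show "relI A s xs \<longleftrightarrow> relI B s (map k xs)"
      proof (cases s)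
        case (OldR q)
        then have q: "q \<in> Rels L0" "length xs = rarity L0 q" using s len by auto
        show ?thesis
        proof (cases "set xs \<subseteq> M_part A")
          case True
          then show ?thesis
            using is_iso_rel[OF h q] OldR by (simp add: mapM[OF True] del: map_eq_conv)
        next
          case False
          then have "\<not> relI A s xs" using tA(1)[OF q xs] OldR by blast
          moreover have "\<not> relI B s (map k xs)"
            using tB(1)[OF q(1) _ sub[OF xs]] q(2) OldR subM[OF xs] False by (metis length_map)
          ultimately show ?thesis by blast
        qed
      next
        case V_sym
        then obtain x where x: "xs = [x]" using len by (auto simp: length_Suc_conv)
        then show ?thesis using kMiff[of x] xs V_sym unfolding V_part_def by simp
      next
        case M_sym
        then obtain x where x: "xs = [x]" using len by (auto simp: length_Suc_conv)
        then have "x \<in> univ A" using xs by simp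
        from kMiff(1,3)[OF this] this show ?thesis
          using x M_sym unfolding M_part_def by simp
      next
        case N_sym
        then obtain x where x: "xs = [x]" using len by (auto simp: length_Suc_conv)
        then have u: "x \<in> univ A" using xs by simp
        show ?thesis
        proof (cases "x \<in> V_part A")
          case True
          then show ?thesis using N kV x N_sym by simp
        next
          case False
          then have "\<not> relI A N_sym [x]" using K_likeD(6)[OF A u] by blast
          moreover have "\<not> relI B N_sym [k x]"
            using K_likeD(6)[OF B kMiff(3)[OF u]] kMiff(2)[OF u] False by blast
          ultimately show ?thesis using x N_sym by simp
        qed
      next
        case Tri_sym
        then obtain x y where xy: "xs = [x, y]" using len by (auto simp: length_2_iff)
        then have u: "x \<in> univ A" "y \<in> univ A" using xs by auto
        show ?thesis
        proof (cases "x \<in> V_part A \<and> y \<in> V_part A")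
          case True
          then show ?thesis using T kV(1) xy Tri_sym by simp
        next
          case False
          then have "\<not> tri A x y" using tA(3)[OF u] by blast
          moreover have "\<not> tri B (k x) (k y)"
            using tB(3)[OF kMiff(3)[OF u(1)] kMiff(3)[OF u(2)]] kMiff(2)[OF u(1)] kMiff(2)[OF u(2)] False
            by blast
          ultimately show ?thesis using xy Tri_sym by simp
        qed
      qed
    }
  qed
  then show ?thesis unfolding k_def .
qed

lemma convex_ultrametric_subset:
  assumes "convex_ultrametric V t U r f" "V' \<subseteq> V" "U' \<subseteq> U"
    and "\<And>x y. x \<in> V' \<Longrightarrow> y \<in> V' \<Longrightarrow> x \<noteq> y \<Longrightarrow> f x y \<in> U'"
  shows "convex_ultrametric V' t U' r f"
  by (rule convex_ultrametric_transfer[OF assms(1), of id _ id]) (use assms in auto)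

lemma K_like_restrict:
  assumes A: "K_like L0 lt A" and X: "X \<subseteq> univ A"
    and st: "is_struct (ext_lang L0) (restrict_to A X)" "is_struct L0 (M_struct (restrict_to A X))"
  shows "K_like L0 lt (restrict_to A X)"
  unfolding K_like_def
proof (intro conjI)
  note VX = V_part_restrict[OF X] and MX = M_part_restrict[OF X]
  note t = trivial_elsewhereD[OF K_likeD(7)[OF A]]
  show "V_part (restrict_to A X) \<union> M_part (restrict_to A X) = univ (restrict_to A X)"
    "V_part (restrict_to A X) \<inter> M_part (restrict_to A X) = {}"
    using K_likeD(3,4)[OF A] X VX MX by auto
  show "\<forall>x\<in>univ (restrict_to A X). relI (restrict_to A X) N_sym [x] \<longrightarrow> x \<in> V_part (restrict_to A X)"
    using K_likeD(6)[OF A] X VX by auto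
  show "trivial_elsewhere L0 (restrict_to A X)"
  proof (rule trivial_elsewhereI)
    fix r xs assume *: "r \<in> Rels L0" "length xs = rarity L0 r" "set xs \<subseteq> univ (restrict_to A X)"
           "relI (restrict_to A X) (OldR r) xs"
    have "set xs \<subseteq> M_part A" by (rule t(1)[OF *(1,2)]) (use * X in auto)
    then show "set xs \<subseteq> M_part (restrict_to A X)" using * MX by auto
  next
    fix g xs assume *: "g \<in> Funs L0" "length xs = farity L0 g" "set xs \<subseteq> univ (restrict_to A X)"
           "\<not> set xs \<subseteq> M_part (restrict_to A X)"
    have "funI A (OldF g) xs = hd xs" by (rule t(2)[OF *(1,2)]) (use * X MX in auto)
    then show "funI (restrict_to A X) (OldF g) xs = hd xs" by simp
  next
    fix x y assume *: "x \<in> univ (restrict_to A X)" "y \<in> univ (restrict_to A X)"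
    then have u: "x \<in> univ A" "y \<in> univ A" using X by auto
    show "x \<in> V_part (restrict_to A X) \<and> y \<in> V_part (restrict_to A X)" if "tri (restrict_to A X) x y"
      using t(3)[OF u] that VX * by simp
    show "fI (restrict_to A X) x y = x"
      if "\<not> (x \<in> V_part (restrict_to A X) \<and> y \<in> V_part (restrict_to A X) \<and> x \<noteq> y)"
      using t(4)[OF u] that VX * by simp
  qed
  have "fI A x y \<in> M_part A \<inter> X" if "x \<in> V_part A \<inter> X" "y \<in> V_part A \<inter> X" "x \<noteq> y" for x y
    using convex_ultrametric.f_in[OF K_likeD(5)[OF A], of x y] that
      is_struct_closed[OF st(1), of F_sym "[x, y]"] by simp
  from convex_ultrametric_subset[OF K_likeD(5)[OF A] Int_lower1 Int_lower1 this]
  show "convex_ultrametric (V_part (restrict_to A X)) (tri (restrict_to A X)) (M_part (restrict_to A X))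
     (\<lambda>x y. relI (restrict_to A X) (OldR lt) [x, y]) (fI (restrict_to A X))"
    unfolding VX MX by simp
qed (fact st)+

text \<open>Every function returns either an element of the M-part or one of its arguments. Hence
  the finitely generated substructures over the M-part are just the M-part together with finitely
  many points.\<close>

lemma K_like_superset_struct:
  assumes A: "K_like L0 lt A" and X: "M_part A \<subseteq> X" "X \<subseteq> univ A"
  shows "is_struct (ext_lang L0) (restrict_to A X)"
  unfolding is_struct_def closed_under_def
proof (intro conjI ballI allI impI)
  note t = trivial_elsewhereD[OF K_likeD(7)[OF A]]
  show "univ (restrict_to A X) \<noteq> {}"
    using K_likeD(2)[OF A] X by (auto simp: is_struct_def)
  fix s xs assume s: "s \<in> Funs (ext_lang L0)"
    and "length xs = farity (ext_lang L0) s \<and> set xs \<subseteq> univ (restrict_to A X)"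
  then have len: "length xs = farity (ext_lang L0) s" and xs: "set xs \<subseteq> X" "set xs \<subseteq> univ A"
    using X by auto
  have "funI A s xs \<in> X"
  proof (cases s)
    case (OldF q)
    then have q: "q \<in> Funs L0" "length xs = farity L0 q" using s len by auto
    show ?thesis
    proof (cases "set xs \<subseteq> M_part A")
      case True
      then show ?thesis using is_struct_closed[OF K_likeD(2)[OF A] q] X OldF by auto
    next
      case False
      then show ?thesis using t(2)[OF q xs(2) False] OldF hd_in_set[OF False] xs by auto
    qed
  next
    case F_sym
    then obtain x y where xy: "xs = [x, y]" using len by (auto simp: length_2_iff)
    then have u: "x \<in> univ A" "y \<in> univ A" "x \<in> X" using xs by auto
    show ?thesis
    proof (cases "x \<in> V_part A \<and> y \<in> V_part A \<and> x \<noteq> y")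
      case True
      then show ?thesis
        using convex_ultrametric.f_in[OF K_likeD(5)[OF A], of x y] X F_sym xy by auto
    next
      case False
      then show ?thesis using t(4)[OF u(1,2) False] u(3) F_sym xy by simp
    qed
  qed
  then show "funI (restrict_to A X) s xs \<in> univ (restrict_to A X)" by simp
qed

lemma K_like_superset:
  assumes A: "K_like L0 lt A" and X: "M_part A \<subseteq> X" "X \<subseteq> univ A"
  shows "K_like L0 lt (restrict_to A X)" "M_struct (restrict_to A X) = M_struct A"
    "M_part (restrict_to A X) = M_part A"
proof -
  have "M_part A \<inter> X = M_part A" using X by blast
  then show eq: "M_struct (restrict_to A X) = M_struct A" "M_part (restrict_to A X) = M_part A"
    using M_part_restrict[OF X(2)] by (simp_all add: M_struct_def)
  show "K_like L0 lt (restrict_to A X)"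
    by (rule K_like_restrict[OF A X(2) K_like_superset_struct[OF A X]]) (simp add: eq K_likeD(2)[OF A])
qed

lemma rich_struct_iso:
  assumes A: "K_like L0 lt A" and B: "K_like L0 lt B" and lt: "lt \<in> Rels L0" "rarity L0 lt = 2"
    and "rich_struct A" "rich_struct B" "countable (univ A)" "countable (univ B)"
    and h: "is_iso L0 h (M_struct A) (M_struct B)"
  shows "isomorphic (ext_lang L0) A B"
proof -
  have "\<exists>g. bij_betw g (V_part A) (V_part B) \<and> (\<forall>x\<in>V_part A. relI A N_sym [x] = relI B N_sym [g x]) \<and>
     (\<forall>x\<in>V_part A. \<forall>y\<in>V_part A. (tri A x y \<longleftrightarrow> tri B (g x) (g y)) \<and>
        (x \<noteq> y \<longrightarrow> h (fI A x y) = fI B (g x) (g y)))"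
  proof (rule rich_unique[OF K_likeD(5)[OF A] K_likeD(5)[OF B] assms(5,6)])
    show "countable (V_part A)" "countable (V_part B)"
      by (rule countable_subset[OF V_part_subset] assms)+
    show "bij_betw h (M_part A) (M_part B)" using is_iso_bij[OF h] by simp
    show "relI A (OldR lt) [u, v] \<longleftrightarrow> relI B (OldR lt) [h u, h v]"
      if "u \<in> M_part A" "v \<in> M_part A" for u v
      using is_iso_rel[OF h lt(1), of "[u, v]"] that lt(2) by simp
  qed
  then obtain g where g: "bij_betw g (V_part A) (V_part B)"
    "\<And>x. x \<in> V_part A \<Longrightarrow> relI A N_sym [x] = relI B N_sym [g x]"
    "\<And>x y. x \<in> V_part A \<Longrightarrow> y \<in> V_part A \<Longrightarrow> tri A x y \<longleftrightarrow> tri B (g x) (g y)"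
    "\<And>x y. x \<in> V_part A \<Longrightarrow> y \<in> V_part A \<Longrightarrow> x \<noteq> y \<Longrightarrow> h (fI A x y) = fI B (g x) (g y)" by blast
  show ?thesis using is_iso_glue[OF A B h g] unfolding isomorphic_def by blast
qed

subsection \<open>The structure built from a convexly ordered ultrametric space\<close>

text \<open>The default values are those demanded by \<open>trivial_elsewhere\<close>. A constant
  symbol falls under the first branch, since the empty list has no entry outside the left summand,
  and so it is interpreted in \<open>M\<close>.\<close>

definition ext_of :: "('m, 'f, 'r) struct \<Rightarrow> 'v set \<Rightarrow> ('v \<Rightarrow> 'v \<Rightarrow> bool) \<Rightarrow> ('v \<Rightarrow> 'v \<Rightarrow> 'm) \<Rightarrow>
    ('v \<Rightarrow> bool) \<Rightarrow> ('m + 'v, 'f, 'r) ext_struct" where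
  "ext_of M V t f N =
    \<lparr>univ = Inl ` univ M \<union> Inr ` V,
     funI = (\<lambda>g xs. case g of
        OldF q \<Rightarrow> if set xs \<subseteq> range Inl then Inl (funI M q (map projl xs)) else hd xs
      | F_sym \<Rightarrow> if \<exists>a b. xs = [Inr a, Inr b] \<and> a \<noteq> b
                 then Inl (f (projr (xs ! 0)) (projr (xs ! 1))) else hd xs),
     relI = (\<lambda>r xs. case r of
        OldR q \<Rightarrow> set xs \<subseteq> range Inl \<and> relI M q (map projl xs)
      | V_sym \<Rightarrow> \<exists>a. xs = [Inr a]
      | M_sym \<Rightarrow> \<exists>a. xs = [Inl a]
      | N_sym \<Rightarrow> \<exists>a. xs = [Inr a] \<and> N a
      | Tri_sym \<Rightarrow> \<exists>a b. xs = [Inr a, Inr b] \<and> t a b)\<rparr>"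

lemma ext_of_simps [simp]:
  "univ (ext_of M V t f N) = Inl ` univ M \<union> Inr ` V"
  "V_part (ext_of M V t f N) = Inr ` V"
  "M_part (ext_of M V t f N) = Inl ` univ M"
  "tri (ext_of M V t f N) (Inr a) (Inr b) \<longleftrightarrow> t a b"
  "relI (ext_of M V t f N) N_sym [Inr a] \<longleftrightarrow> N a"
  "fI (ext_of M V t f N) (Inr a) (Inr b) = (if a = b then Inr a else Inl (f a b))"
  "relI (ext_of M V t f N) (OldR r) xs \<longleftrightarrow> set xs \<subseteq> range Inl \<and> relI M r (map projl xs)"
  "funI (ext_of M V t f N) (OldF g) xs =
     (if set xs \<subseteq> range Inl then Inl (funI M g (map projl xs)) else hd xs)"
  by (auto simp: ext_of_def V_part_def M_part_def)

lemma map_projl_Inl [simp]: "map projl (map Inl xs) = xs"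
  by (induction xs) auto

lemma ext_of_M_part_is:
  assumes "is_struct L0 M"
  shows "M_part_is L0 (ext_of M V t f N) M"
  unfolding M_part_is_def
proof (rule is_isoI)
  show "is_struct L0 M" by fact
  show "bij_betw Inl (univ M) (univ (M_struct (ext_of M V t f N)))"
    by (simp add: bij_betw_def)
  show "is_struct L0 (M_struct (ext_of M V t f N))"
    unfolding is_struct_def closed_under_def
  proof (intro conjI ballI allI impI)
    show "univ (M_struct (ext_of M V t f N)) \<noteq> {}" using assms by (simp add: is_struct_def)
    fix g xs assume g: "g \<in> Funs L0"
      and "length xs = farity L0 g \<and> set xs \<subseteq> univ (M_struct (ext_of M V t f N))"
    then have xs: "length xs = farity L0 g" "set xs \<subseteq> Inl ` univ M" by auto
    have "set (map projl xs) \<subseteq> univ M" using xs(2) by auto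
    then have "funI M g (map projl xs) \<in> univ M"
      using is_struct_closed[OF assms g] xs(1) by simp
    moreover have "set xs \<subseteq> range Inl" using xs(2) by auto
    ultimately show "funI (M_struct (ext_of M V t f N)) g xs \<in> univ (M_struct (ext_of M V t f N))"
      by simp
  qed
qed (auto simp: image_subset_iff simp del: map_map)

lemma ext_of_K_like:
  assumes M: "is_struct L0 M" and "rarity L0 lt = 2"
    and cu: "convex_ultrametric V t (univ M) (\<lambda>x y. relI M lt [x, y]) f"
  shows "K_like L0 lt (ext_of M V t f N)"
  unfolding K_like_def
proof (intro conjI)
  let ?A = "ext_of M V t f N"
  interpret convex_ultrametric V t "univ M" "\<lambda>x y. relI M lt [x, y]" f by fact
  have range: "set xs \<subseteq> range Inl \<longleftrightarrow> set xs \<subseteq> Inl ` univ M" if "set xs \<subseteq> univ ?A" for xs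
    using that by auto
  show Ms: "is_struct L0 (M_struct ?A)"
    using is_iso_struct(2)[OF ext_of_M_part_is[OF M, unfolded M_part_is_def]] .
  show "V_part ?A \<union> M_part ?A = univ ?A" "V_part ?A \<inter> M_part ?A = {}" by auto
  show "\<forall>x\<in>univ ?A. relI ?A N_sym [x] \<longrightarrow> x \<in> V_part ?A"
    by (auto simp: ext_of_def V_part_def)
  show tr: "trivial_elsewhere L0 ?A"
  proof (rule trivial_elsewhereI)
    fix g xs assume *: "g \<in> Funs L0" "length xs = farity L0 g" "set xs \<subseteq> univ ?A"
           "\<not> set xs \<subseteq> M_part ?A"
    then show "funI ?A (OldF g) xs = hd xs" using range[OF *(3)] by simp
  next
    fix r xs assume *: "r \<in> Rels L0" "length xs = rarity L0 r" "set xs \<subseteq> univ ?A" "relI ?A (OldR r) xs"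
    then show "set xs \<subseteq> M_part ?A" using range[OF *(3)] by simp
  qed (auto simp: ext_of_def V_part_def)
  have f_in': "fI ?A x y \<in> M_part ?A" if "x \<in> V_part ?A" "y \<in> V_part ?A" "x \<noteq> y" for x y
    using that f_in by auto
  show "convex_ultrametric (V_part ?A) (tri ?A) (M_part ?A) (\<lambda>x y. relI ?A (OldR lt) [x, y]) (fI ?A)"
  proof (rule convex_ultrametric_transfer[OF cu, of projr _ projl])
    show "inj_on projr (V_part ?A)" "inj_on projl (M_part ?A)" by (auto simp: inj_on_def)
  qed (use f_in' in \<open>auto split: if_splits\<close>)
  show "is_struct (ext_lang L0) ?A"
    unfolding is_struct_def closed_under_def
  proof (intro conjI ballI allI impI)
    show "univ ?A \<noteq> {}" using M by (simp add: is_struct_def)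
    fix s xs assume s: "s \<in> Funs (ext_lang L0)"
      and "length xs = farity (ext_lang L0) s \<and> set xs \<subseteq> univ ?A"
    then have len: "length xs = farity (ext_lang L0) s" and xs: "set xs \<subseteq> univ ?A" by auto
    show "funI ?A s xs \<in> univ ?A"
    proof (cases s)
      case (OldF q)
      then have q: "q \<in> Funs L0" "length xs = farity L0 q" using s len by auto
      show ?thesis
      proof (cases "set xs \<subseteq> M_part ?A")
        case True
        then show ?thesis using is_struct_closed[OF Ms q] OldF M_part_subset[of ?A] by auto
      next
        case False
        then show ?thesis
          using trivial_elsewhereD(2)[OF tr q xs False] hd_in_set[OF False] xs OldF by auto
      qed
    next
      case F_sym
      then obtain x y where xy: "xs = [x, y]" using len by (auto simp: length_2_iff)
      then have u: "x \<in> univ ?A" "y \<in> univ ?A" using xs by auto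
      show ?thesis
      proof (cases "x \<in> V_part ?A \<and> y \<in> V_part ?A \<and> x \<noteq> y")
        case True
        then show ?thesis using f_in'[of x y] F_sym xy M_part_subset[of ?A] by auto
      next
        case False
        then show ?thesis using trivial_elsewhereD(4)[OF tr u False] u F_sym xy by simp
      qed
    qed
  qed
qed

lemma ext_of_rich:
  assumes "rich V t (univ M) f N" "\<And>x. x \<in> V \<Longrightarrow> \<not> t x x"
    and "\<And>x y. x \<in> V \<Longrightarrow> y \<in> V \<Longrightarrow> x \<noteq> y \<Longrightarrow> f x y \<in> univ M"
  shows "rich_struct (ext_of M V t f N)"
proof (rule rich_transfer[OF assms(1), of projr _ projl])
  show "bij_betw projr (V_part (ext_of M V t f N)) V"
    "bij_betw projl (M_part (ext_of M V t f N)) (univ M)"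
    by (auto simp: bij_betw_def inj_on_def image_image)
qed (use assms in \<open>auto split: if_splits\<close>)

subsection \<open>Fraisse limits are rich\<close>

lemma K_class_imp_K_like:
  assumes "K_class L0 lt M A" "strict_linorder_on (univ M) (\<lambda>x y. relI M lt [x, y])"
    and lt: "lt \<in> Rels L0" "rarity L0 lt = 2"
  shows "K_like L0 lt A"
proof -
  have iso: "is_iso L0 Inl M (M_struct A)" using assms(1) unfolding K_class_def M_part_is_def by blast
  have bij: "bij_betw Inl (univ M) (M_part A)" using is_iso_bij[OF iso] by simp
  let ?p = "inv_into (univ M) Inl"
  have lin: "strict_linorder_on (M_part A) (\<lambda>x y. relI A (OldR lt) [x, y])"
  proof (rule strict_linorder_on_image[OF assms(2), of _ ?p])
    show "?p y \<in> univ M" if "y \<in> M_part A" for y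
      using bij that by (metis bij_betw_def inv_into_into)
    show "inj_on ?p (M_part A)" using bij_betw_inv_into[OF bij] by (simp add: bij_betw_def)
    show "relI A (OldR lt) [x, y] \<longleftrightarrow> relI M lt [?p x, ?p y]" if "x \<in> M_part A" "y \<in> M_part A" for x y
      using is_iso_rel[OF is_iso_sym[OF iso] lt(1), of "[x, y]"] lt(2) that by simp
  qed
  have "convex_ultrametric (V_part A) (tri A) (M_part A) (\<lambda>x y. relI A (OldR lt) [x, y]) (fI A)"
  proof
    show "strict_linorder_on (V_part A) (tri A)" using assms(1) unfolding K_class_def by blast
    show "strict_linorder_on (M_part A) (\<lambda>x y. relI A (OldR lt) [x, y])" by (rule lin)
    have *: "\<forall>x\<in>V_part A. \<forall>y\<in>V_part A. x \<noteq> y \<longrightarrow> fI A x y = fI A y x \<and> fI A x y \<in> M_part A"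
      using assms(1) unfolding K_class_def by blast
    show "fI A x y = fI A y x" "fI A x y \<in> M_part A" if "x \<in> V_part A" "y \<in> V_part A" "x \<noteq> y" for x y
      using * that by blast+
    have **: "\<forall>x\<in>V_part A. \<forall>y\<in>V_part A. \<forall>z\<in>V_part A. tri A x y \<and> tri A y z \<longrightarrow>
       fI A x y = fI A x z \<and> fI A x z = fI A y z \<or>
       fI A x y = fI A x z \<and> relI A (OldR lt) [fI A x z, fI A y z] \<or>
       fI A x z = fI A y z \<and> relI A (OldR lt) [fI A y z, fI A x y]"
      using assms(1) unfolding K_class_def by (elim conjE) assumption
    show "fI A x y = fI A x z \<and> fI A x z = fI A y z \<or>
       fI A x y = fI A x z \<and> relI A (OldR lt) [fI A x z, fI A y z] \<or>
       fI A x z = fI A y z \<and> relI A (OldR lt) [fI A y z, fI A x y]"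
      if "x \<in> V_part A" "y \<in> V_part A" "z \<in> V_part A" "tri A x y" "tri A y z" for x y z
      using **[rule_format, OF that(1-3)] that(4,5) by blast
  qed
  moreover have "is_struct (ext_lang L0) A" "V_part A \<union> M_part A = univ A" "V_part A \<inter> M_part A = {}"
    "\<forall>x\<in>univ A. relI A N_sym [x] \<longrightarrow> x \<in> V_part A" "trivial_elsewhere L0 A"
    using assms(1) unfolding K_class_def by simp_all
  ultimately show ?thesis unfolding K_like_def using is_iso_struct(2)[OF iso] by (intro conjI)
qed

lemma K_like_imp_K_class:
  assumes A: "K_like L0 lt A" and "countable (univ A)" "finite (V_part A)" "M_part_is L0 A M"
  shows "K_class L0 lt M A"
  unfolding K_class_def
proof (intro conjI)
  interpret convex_ultrametric "V_part A" "tri A" "M_part A" "\<lambda>x y. relI A (OldR lt) [x, y]" "fI A"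
    by (rule K_likeD(5)[OF A])
  show "\<forall>x\<in>V_part A. \<forall>y\<in>V_part A. x \<noteq> y \<longrightarrow> fI A x y = fI A y x \<and> fI A x y \<in> M_part A"
    using f_sym f_in by blast
  show "\<forall>x\<in>V_part A. \<forall>y\<in>V_part A. \<forall>z\<in>V_part A. tri A x y \<and> tri A y z \<longrightarrow>
       fI A x y = fI A x z \<and> fI A x z = fI A y z \<or>
       fI A x y = fI A x z \<and> relI A (OldR lt) [fI A x z, fI A y z] \<or>
       fI A x z = fI A y z \<and> relI A (OldR lt) [fI A y z, fI A x y]"
    by (intro ballI impI) (elim conjE, rule f_triple)
  show "strict_linorder_on (V_part A) (tri A)" by (rule V_lin)
  show "\<forall>x\<in>univ A. relI A N_sym [x] \<longrightarrow> x \<in> V_part A" using K_likeD(6)[OF A] by blast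
  show "V_part A \<union> M_part A = univ A" by (rule K_likeD(3)[OF A, symmetric])
qed (fact assms K_likeD(1,4,7)[OF A])+

lemma K_like_iso:
  assumes A: "K_like L0 lt A" and k: "is_iso (ext_lang L0) k B A"
    and lt: "lt \<in> Rels L0" "rarity L0 lt = 2"
  shows "K_like L0 lt B"
  unfolding K_like_def
proof (intro conjI)
  note uA = K_likeD(3,4)[OF A]
  note t = trivial_elsewhereD[OF K_likeD(7)[OF A]]
  have bij: "bij_betw k (univ B) (univ A)" by (rule is_iso_bij[OF k])
  have kU: "k x \<in> univ A" if "x \<in> univ B" for x using that bij by (auto simp: bij_betw_def)
  have inj: "x = y" if "k x = k y" "x \<in> univ B" "y \<in> univ B" for x y
    using bij that by (auto simp: bij_betw_def dest: inj_onD)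
  have V: "x \<in> V_part B \<longleftrightarrow> k x \<in> V_part A" if "x \<in> univ B" for x
    using is_iso_rel[OF k, of V_sym "[x]"] that kU by (simp add: V_part_def)
  have Mi: "x \<in> M_part B \<longleftrightarrow> k x \<in> M_part A" if "x \<in> univ B" for x
    using is_iso_rel[OF k, of M_sym "[x]"] that kU by (simp add: M_part_def)
  have N: "relI B N_sym [x] \<longleftrightarrow> relI A N_sym [k x]" if "x \<in> univ B" for x
    using is_iso_rel[OF k, of N_sym "[x]"] that by simp
  have T: "tri B x y \<longleftrightarrow> tri A (k x) (k y)" if "x \<in> univ B" "y \<in> univ B" for x y
    using is_iso_rel[OF k, of Tri_sym "[x, y]"] that by simp
  have F: "k (fI B x y) = fI A (k x) (k y)" "fI B x y \<in> univ B" if "x \<in> univ B" "y \<in> univ B" for x y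
    using is_iso_fun[OF k, of F_sym "[x, y]"] is_struct_closed[OF is_iso_struct(1)[OF k], of F_sym "[x, y]"]
      that by simp_all
  have sub: "set (map k xs) \<subseteq> univ A" if "set xs \<subseteq> univ B" for xs using that kU by auto
  have subM: "set (map k xs) \<subseteq> M_part A \<longleftrightarrow> set xs \<subseteq> M_part B" if "set xs \<subseteq> univ B" for xs
    using that Mi by auto
  have VB: "V_part B \<subseteq> univ B" and MB: "M_part B \<subseteq> univ B" by (rule V_part_subset M_part_subset)+
  show st: "is_struct (ext_lang L0) B" by (rule is_iso_struct(1)[OF k])
  show "V_part B \<union> M_part B = univ B" "V_part B \<inter> M_part B = {}"
    using V Mi uA kU VB MB by blast+
  show "\<forall>x\<in>univ B. relI B N_sym [x] \<longrightarrow> x \<in> V_part B" using N V K_likeD(6)[OF A] kU by blast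
  show "trivial_elsewhere L0 B"
  proof (rule trivial_elsewhereI)
    fix r xs assume *: "r \<in> Rels L0" "length xs = rarity L0 r" "set xs \<subseteq> univ B" "relI B (OldR r) xs"
    then have "relI A (OldR r) (map k xs)" using is_iso_rel[OF k, of "OldR r" xs] by simp
    then show "set xs \<subseteq> M_part B" using t(1)[OF *(1) _ sub[OF *(3)]] *(2) subM[OF *(3)] by simp
  next
    fix g xs assume *: "g \<in> Funs L0" "length xs = farity L0 g" "set xs \<subseteq> univ B" "\<not> set xs \<subseteq> M_part B"
    have "k (funI B (OldF g) xs) = funI A (OldF g) (map k xs)"
      using is_iso_fun[OF k, of "OldF g" xs] * by simp
    also have "\<dots> = hd (map k xs)"
      using t(2)[OF *(1) _ sub[OF *(3)]] *(2,4) subM[OF *(3)] by simp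
    also have "\<dots> = k (hd xs)" using *(4) by (cases xs) auto
    finally show "funI B (OldF g) xs = hd xs"
    proof (rule inj)
      show "funI B (OldF g) xs \<in> univ B" using is_struct_closed[OF st, of "OldF g" xs] * by simp
      show "hd xs \<in> univ B" using hd_in_set[OF *(4)] *(3) by blast
    qed
  next
    fix x y assume u: "x \<in> univ B" "y \<in> univ B"
    show "x \<in> V_part B \<and> y \<in> V_part B" if "tri B x y"
      using t(3)[of "k x" "k y"] that T V kU u by blast
    show "fI B x y = x" if "\<not> (x \<in> V_part B \<and> y \<in> V_part B \<and> x \<noteq> y)"
    proof (rule inj)
      have "\<not> (k x \<in> V_part A \<and> k y \<in> V_part A \<and> k x \<noteq> k y)" using that V u by blast
      from t(4)[OF kU[OF u(1)] kU[OF u(2)] this] show "k (fI B x y) = k x" using F u by simp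
    qed (use u F in blast)+
  qed
  show "convex_ultrametric (V_part B) (tri B) (M_part B) (\<lambda>x y. relI B (OldR lt) [x, y]) (fI B)"
  proof (rule convex_ultrametric_transfer[OF K_likeD(5)[OF A], of k _ k])
    have "inj_on k (univ B)" using bij by (simp add: bij_betw_def)
    then show "inj_on k (V_part B)" "inj_on k (M_part B)" using inj_on_subset VB MB by blast+
    fix x y
    show "k x \<in> V_part A" if "x \<in> V_part B" using that V VB by blast
    show "k x \<in> M_part A" if "x \<in> M_part B" using that Mi MB by blast
    show "relI B (OldR lt) [x, y] \<longleftrightarrow> relI A (OldR lt) [k x, k y]" if "x \<in> M_part B" "y \<in> M_part B"
      using is_iso_rel[OF k, of "OldR lt" "[x, y]"] lt that MB by auto
    assume xy: "x \<in> V_part B" "y \<in> V_part B"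
    then have u: "x \<in> univ B" "y \<in> univ B" using VB by blast+
    show "tri B x y \<longleftrightarrow> tri A (k x) (k y)" by (rule T[OF u])
    show "k (fI B x y) = fI A (k x) (k y)" by (rule F[OF u])
    assume "x \<noteq> y"
    then have "k x \<noteq> k y" using inj u by blast
    then have "fI A (k x) (k y) \<in> M_part A"
      using convex_ultrametric.f_in[OF K_likeD(5)[OF A]] xy V u by blast
    then show "fI B x y \<in> M_part B" using Mi F u by simp
  qed
  show "is_struct L0 (M_struct B)"
    unfolding is_struct_def closed_under_def
  proof (intro conjI ballI allI impI)
    obtain m where m: "m \<in> M_part A" using K_likeD(2)[OF A] by (auto simp: is_struct_def)
    then obtain x where "x \<in> univ B" "m = k x" using bij M_part_subset by (fastforce simp: bij_betw_def)
    then show "univ (M_struct B) \<noteq> {}" using Mi m by auto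
    fix g xs assume g: "g \<in> Funs L0" and "length xs = farity L0 g \<and> set xs \<subseteq> univ (M_struct B)"
    then have xs: "length xs = farity L0 g" "set xs \<subseteq> M_part B" "set xs \<subseteq> univ B" using MB by auto
    have "funI A (OldF g) (map k xs) \<in> M_part A"
      using is_struct_closed[OF K_likeD(2)[OF A] g, of "map k xs"] xs subM[OF xs(3)] by simp
    moreover have "k (funI B (OldF g) xs) = funI A (OldF g) (map k xs)"
      using is_iso_fun[OF k, of "OldF g" xs] xs g by simp
    moreover have "funI B (OldF g) xs \<in> univ B" using is_struct_closed[OF st, of "OldF g" xs] xs g by simp
    ultimately show "funI (M_struct B) g xs \<in> univ (M_struct B)" using Mi by simp
  qed
qed

text \<open>Each axiom concerns at most three elements or a single argument list, so it may be
  checked in a substructure that contains them. This is how the Fraisse limit inherits the axioms,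
  which its definition imposes only on finitely generated substructures.\<close>

lemma K_like_local:
  assumes st: "is_struct (ext_lang L0) A" "is_struct L0 (M_struct A)"
    and loc: "\<And>S. finite S \<Longrightarrow> S \<subseteq> univ A \<Longrightarrow> \<exists>X. S \<subseteq> X \<and> X \<subseteq> univ A \<and> K_like L0 lt (restrict_to A X)"
  shows "K_like L0 lt A"
proof -
  have ex: "\<exists>X. S \<subseteq> X \<and> X \<subseteq> univ A \<and> V_part A \<inter> X \<union> M_part A \<inter> X = X \<and>
     V_part A \<inter> M_part A \<inter> X = {} \<and>
     convex_ultrametric (V_part A \<inter> X) (tri A) (M_part A \<inter> X) (\<lambda>x y. relI A (OldR lt) [x, y]) (fI A) \<and>
     (\<forall>x\<in>X. relI A N_sym [x] \<longrightarrow> x \<in> V_part A) \<and> trivial_elsewhere L0 (restrict_to A X) \<and>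
     V_part (restrict_to A X) = V_part A \<inter> X \<and> M_part (restrict_to A X) = M_part A \<inter> X"
    if S: "finite S" "S \<subseteq> univ A" for S
  proof -
    obtain X where X: "S \<subseteq> X" "X \<subseteq> univ A" "K_like L0 lt (restrict_to A X)" using loc[OF S] by blast
    then show ?thesis
      using V_part_restrict[OF X(2)] M_part_restrict[OF X(2)] unfolding K_like_def
      by (intro exI[of _ X]) auto
  qed
  have u: "x \<in> V_part A \<union> M_part A" "x \<notin> V_part A \<inter> M_part A" "relI A N_sym [x] \<Longrightarrow> x \<in> V_part A"
    if "x \<in> univ A" for x
  proof -
    obtain X where X: "{x} \<subseteq> X" "V_part A \<inter> X \<union> M_part A \<inter> X = X" "V_part A \<inter> M_part A \<inter> X = {}"
      "\<forall>x\<in>X. relI A N_sym [x] \<longrightarrow> x \<in> V_part A"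
    proof -
      have "finite {x}" "{x} \<subseteq> univ A" using \<open>x \<in> univ A\<close> by auto
      from ex[OF this] show ?thesis by (elim exE conjE) (rule that)
    qed
    then show "x \<in> V_part A \<union> M_part A" "x \<notin> V_part A \<inter> M_part A"
      "relI A N_sym [x] \<Longrightarrow> x \<in> V_part A" by blast+
  qed
  have VA: "V_part A \<subseteq> univ A" and MA: "M_part A \<subseteq> univ A" by (rule V_part_subset M_part_subset)+
  have cu: "\<exists>X. x \<in> X \<and> y \<in> X \<and> z \<in> X \<and>
     convex_ultrametric (V_part A \<inter> X) (tri A) (M_part A \<inter> X) (\<lambda>x y. relI A (OldR lt) [x, y]) (fI A)"
    if "x \<in> univ A" "y \<in> univ A" "z \<in> univ A" for x y z
  proof -
    have "finite {x, y, z}" "{x, y, z} \<subseteq> univ A" using that by auto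
    from ex[OF this] show ?thesis by (elim exE conjE) (rule exI, intro conjI, auto)
  qed
  have te: "\<exists>X. set xs \<subseteq> X \<and> trivial_elsewhere L0 (restrict_to A X) \<and>
     V_part (restrict_to A X) = V_part A \<inter> X \<and> M_part (restrict_to A X) = M_part A \<inter> X"
    if "set xs \<subseteq> univ A" for xs
  proof -
    from ex[OF finite_set that] show ?thesis by (elim exE conjE) (rule exI, intro conjI)
  qed
  have "trivial_elsewhere L0 A"
  proof (rule trivial_elsewhereI)
    fix r xs assume *: "r \<in> Rels L0" "length xs = rarity L0 r" "set xs \<subseteq> univ A" "relI A (OldR r) xs"
    obtain X where X: "set xs \<subseteq> X" "trivial_elsewhere L0 (restrict_to A X)"
     "M_part (restrict_to A X) = M_part A \<inter> X"
      using te[OF *(3)] by (elim exE conjE) (rule that)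
    from trivial_elsewhereD(1)[OF X(2) *(1,2)] show "set xs \<subseteq> M_part A" using X * by simp
  next
    fix g xs assume *: "g \<in> Funs L0" "length xs = farity L0 g" "set xs \<subseteq> univ A" "\<not> set xs \<subseteq> M_part A"
    obtain X where X: "set xs \<subseteq> X" "trivial_elsewhere L0 (restrict_to A X)"
     "M_part (restrict_to A X) = M_part A \<inter> X"
      using te[OF *(3)] by (elim exE conjE) (rule that)
    from trivial_elsewhereD(2)[OF X(2) *(1,2)] show "funI A (OldF g) xs = hd xs" using X * by simp
  next
    fix x y assume *: "x \<in> univ A" "y \<in> univ A"
    then have "set [x, y] \<subseteq> univ A" by simp
    from te[OF this] obtain X where X: "set [x, y] \<subseteq> X" "trivial_elsewhere L0 (restrict_to A X)"
     "V_part (restrict_to A X) = V_part A \<inter> X" by (elim exE conjE) (rule that)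
    from trivial_elsewhereD(3,4)[OF X(2)]
    show "tri A x y \<Longrightarrow> x \<in> V_part A \<and> y \<in> V_part A"
      "\<not> (x \<in> V_part A \<and> y \<in> V_part A \<and> x \<noteq> y) \<Longrightarrow> fI A x y = x" using X by auto
  qed
  moreover have "convex_ultrametric (V_part A) (tri A) (M_part A) (\<lambda>x y. relI A (OldR lt) [x, y]) (fI A)"
  proof
    show "strict_linorder_on (V_part A) (tri A)"
    proof (rule strict_linorder_onI)
      fix x y z assume *: "x \<in> V_part A" "y \<in> V_part A" "z \<in> V_part A"
      obtain X where X: "x \<in> X" "y \<in> X" "z \<in> X" "convex_ultrametric (V_part A \<inter> X) (tri A)
          (M_part A \<inter> X) (\<lambda>x y. relI A (OldR lt) [x, y]) (fI A)" using
        cu[OF subsetD[OF VA *(1)] subsetD[OF VA *(2)] subsetD[OF VA *(3)]]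
        by (elim exE conjE) (rule that)
      show "tri A x z" if "tri A x y" "tri A y z"
        using convex_ultrametric.V_trans[OF X(4), of x y z] X that * by blast
    next
      fix x y assume *: "x \<in> V_part A" "y \<in> V_part A"
      obtain X where X: "x \<in> X" "y \<in> X" "convex_ultrametric (V_part A \<inter> X) (tri A)
          (M_part A \<inter> X) (\<lambda>x y. relI A (OldR lt) [x, y]) (fI A)" using
        cu[OF subsetD[OF VA *(1)] subsetD[OF VA *(2)] subsetD[OF VA *(2)]]
        by (elim exE conjE) (rule that)
      show "tri A x y \<or> tri A y x" if "x \<noteq> y"
        using convex_ultrametric.V_total[OF X(3), of x y] X that * by blast
    next
      fix x assume *: "x \<in> V_part A"
      obtain X where X: "x \<in> X" "convex_ultrametric (V_part A \<inter> X) (tri A)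
          (M_part A \<inter> X) (\<lambda>x y. relI A (OldR lt) [x, y]) (fI A)" using
        cu[OF subsetD[OF VA *] subsetD[OF VA *] subsetD[OF VA *]]
        by (elim exE conjE) (rule that)
      show "\<not> tri A x x" using convex_ultrametric.V_irrefl[OF X(2), of x] X * by blast
    qed
    show "strict_linorder_on (M_part A) (\<lambda>x y. relI A (OldR lt) [x, y])"
    proof (rule strict_linorder_onI)
      fix x y z assume *: "x \<in> M_part A" "y \<in> M_part A" "z \<in> M_part A"
      obtain X where X: "x \<in> X" "y \<in> X" "z \<in> X" "convex_ultrametric (V_part A \<inter> X) (tri A)
          (M_part A \<inter> X) (\<lambda>x y. relI A (OldR lt) [x, y]) (fI A)" using
        cu[OF subsetD[OF MA *(1)] subsetD[OF MA *(2)] subsetD[OF MA *(3)]]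
        by (elim exE conjE) (rule that)
      show "relI A (OldR lt) [x, z]" if "relI A (OldR lt) [x, y]" "relI A (OldR lt) [y, z]"
        using convex_ultrametric.U_trans[OF X(4), of x y z] X that * by blast
    next
      fix x y assume *: "x \<in> M_part A" "y \<in> M_part A"
      obtain X where X: "x \<in> X" "y \<in> X" "convex_ultrametric (V_part A \<inter> X) (tri A)
          (M_part A \<inter> X) (\<lambda>x y. relI A (OldR lt) [x, y]) (fI A)" using
        cu[OF subsetD[OF MA *(1)] subsetD[OF MA *(2)] subsetD[OF MA *(2)]]
        by (elim exE conjE) (rule that)
      show "relI A (OldR lt) [x, y] \<or> relI A (OldR lt) [y, x]" if "x \<noteq> y"
        using convex_ultrametric.U_total[OF X(3), of x y] X that * by blast
    next
      fix x assume *: "x \<in> M_part A"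
      obtain X where X: "x \<in> X" "convex_ultrametric (V_part A \<inter> X) (tri A)
          (M_part A \<inter> X) (\<lambda>x y. relI A (OldR lt) [x, y]) (fI A)" using
        cu[OF subsetD[OF MA *] subsetD[OF MA *] subsetD[OF MA *]]
        by (elim exE conjE) (rule that)
      show "\<not> relI A (OldR lt) [x, x]" using convex_ultrametric.U_irrefl[OF X(2), of x] X * by blast
    qed
  next
    fix x y assume *: "x \<in> V_part A" "y \<in> V_part A" "x \<noteq> y"
    obtain X where X: "x \<in> X" "y \<in> X" "convex_ultrametric (V_part A \<inter> X) (tri A)
        (M_part A \<inter> X) (\<lambda>x y. relI A (OldR lt) [x, y]) (fI A)" using
        cu[OF subsetD[OF VA *(1)] subsetD[OF VA *(2)] subsetD[OF VA *(2)]]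
        by (elim exE conjE) (rule that)
    show "fI A x y = fI A y x" using convex_ultrametric.f_sym[OF X(3), of x y] X * by blast
    show "fI A x y \<in> M_part A" using convex_ultrametric.f_in[OF X(3), of x y] X * by blast
  next
    fix x y z assume *: "x \<in> V_part A" "y \<in> V_part A" "z \<in> V_part A" "tri A x y" "tri A y z"
    obtain X where X: "x \<in> X" "y \<in> X" "z \<in> X" "convex_ultrametric (V_part A \<inter> X) (tri A)
        (M_part A \<inter> X) (\<lambda>x y. relI A (OldR lt) [x, y]) (fI A)" using
        cu[OF subsetD[OF VA *(1)] subsetD[OF VA *(2)] subsetD[OF VA *(3)]]
        by (elim exE conjE) (rule that)
    show "fI A x y = fI A x z \<and> fI A x z = fI A y z \<or>
       fI A x y = fI A x z \<and> relI A (OldR lt) [fI A x z, fI A y z] \<or>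
       fI A x z = fI A y z \<and> relI A (OldR lt) [fI A y z, fI A x y]"
      using convex_ultrametric.f_triple[OF X(4), of x y z] X * by blast
  qed
  ultimately show ?thesis using st u VA MA unfolding K_like_def by blast
qed

lemma fraisse_limit_K_like:
  fixes F :: "('m + nat, 'f, 'r) ext_struct"
  assumes F: "fraisse_limit L0 lt M F" and lin: "strict_linorder_on (univ M) (\<lambda>x y. relI M lt [x, y])"
    and lt: "lt \<in> Rels L0" "rarity L0 lt = 2"
  shows "K_like L0 lt F"
proof (rule K_like_local)
  have F1: "is_struct (ext_lang L0) F" and F2: "is_iso L0 Inl M (M_struct F)"
    using F unfolding fraisse_limit_def M_part_is_def by simp_all
  have F3: "\<forall>B\<in>fg_over L0 M F. \<exists>A :: ('m + nat, 'f, 'r) ext_struct.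
        K_class L0 lt M A \<and> isomorphic (ext_lang L0) B A"
    using F unfolding fraisse_limit_def by (elim conjE) assumption
  show "is_struct (ext_lang L0) F" by fact
  show "is_struct L0 (M_struct F)" by (rule is_iso_struct(2)[OF F2])
  fix S assume S: "finite S" "S \<subseteq> univ F"
  let ?X = "generated (ext_lang L0) F S \<union> Inl ` univ M"
  have "restrict_to F ?X \<in> fg_over L0 M F" using S unfolding fg_over_def by blast
  then obtain A :: "('m + nat, 'f, 'r) ext_struct" and k
    where A: "K_class L0 lt M A" "is_iso (ext_lang L0) k (restrict_to F ?X) A"
    using F3 unfolding isomorphic_def by blast
  have "K_like L0 lt (restrict_to F ?X)"
    by (rule K_like_iso[OF K_class_imp_K_like[OF A(1) lin lt] A(2) lt])
  moreover have "S \<subseteq> ?X" by (auto simp: generated_def)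
  moreover have "?X \<subseteq> univ F"
  proof -
    have "Inl ` univ M = M_part F" using is_iso_bij[OF F2] by (simp add: bij_betw_def)
    moreover have "generated (ext_lang L0) F S \<subseteq> univ F"
      using F1 S unfolding generated_def is_struct_def by blast
    ultimately show ?thesis using M_part_subset[of F] by blast
  qed
  ultimately show "\<exists>X. S \<subseteq> X \<and> X \<subseteq> univ F \<and> K_like L0 lt (restrict_to F X)" by blast
qed

lemma K_like_fg_over:
  assumes F: "K_like L0 lt F" and M: "M_part F = Inl ` univ M" and S: "finite S" "S \<subseteq> univ F"
  shows "restrict_to F (S \<union> M_part F) \<in> fg_over L0 M F"
proof -
  have "closed_under (ext_lang L0) F (S \<union> M_part F)"
    using K_like_superset_struct[OF F, of "S \<union> M_part F"] S(2) M_part_subset[of F]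
    unfolding is_struct_def closed_under_def by simp
  then have "generated (ext_lang L0) F S \<subseteq> S \<union> M_part F"
    unfolding generated_def using S(2) M_part_subset[of F] by blast
  moreover have "S \<subseteq> generated (ext_lang L0) F S" unfolding generated_def by blast
  ultimately have "S \<union> M_part F = generated (ext_lang L0) F S \<union> Inl ` univ M" using M by blast
  then show ?thesis
    unfolding fg_over_def mem_Collect_eq by (intro exI[of _ S] conjI S) simp
qed

text \<open>The extension property, drawn from universality and homogeneity. Both M-parts are
  literally the copy of \<open>M\<close> under \<open>Inl\<close>, so values of \<open>f\<close> in
  \<open>F\<close> and in \<open>C\<close> can be compared by equality.\<close>

lemma fraisse_limit_realizes:
  fixes C :: "('m + nat, 'f, 'r) ext_struct"
  assumes F: "fraisse_limit L0 lt M F" and lin: "strict_linorder_on (univ M) (\<lambda>x y. relI M lt [x, y])"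
    and lt: "lt \<in> Rels L0" "rarity L0 lt = 2"
    and C: "K_class L0 lt M C" and A: "finite A" "A \<subseteq> V_part F"
    and e: "inj_on e A" "\<And>a. a \<in> A \<Longrightarrow> e a \<in> V_part C"
    and eN: "\<And>a. a \<in> A \<Longrightarrow> relI F N_sym [a] \<longleftrightarrow> relI C N_sym [e a]"
    and eT: "\<And>a b. a \<in> A \<Longrightarrow> b \<in> A \<Longrightarrow> tri F a b \<longleftrightarrow> tri C (e a) (e b)"
    and eF: "\<And>a b. a \<in> A \<Longrightarrow> b \<in> A \<Longrightarrow> a \<noteq> b \<Longrightarrow> fI F a b = fI C (e a) (e b)"
    and z: "z \<in> V_part C" "z \<notin> e ` A"
  shows "\<exists>w\<in>V_part F. (relI F N_sym [w] \<longleftrightarrow> relI C N_sym [z]) \<and>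
     (\<forall>a\<in>A. (tri F a w \<longleftrightarrow> tri C (e a) z) \<and> (tri F w a \<longleftrightarrow> tri C z (e a)) \<and> fI F a w = fI C (e a) z)"
proof -
  have FK: "K_like L0 lt F" by (rule fraisse_limit_K_like[OF F lin lt])
  have CK: "K_like L0 lt C" by (rule K_class_imp_K_like[OF C lin lt])
  have FM: "is_iso L0 Inl M (M_struct F)" and CM: "is_iso L0 Inl M (M_struct C)"
    using F C unfolding fraisse_limit_def K_class_def M_part_is_def by simp_all
  have Mp: "M_part F = Inl ` univ M" "M_part C = Inl ` univ M"
    using is_iso_bij[OF FM] is_iso_bij[OF CM] by (simp_all add: bij_betw_def)
  have F3: "\<forall>A :: ('m + nat, 'f, 'r) ext_struct. K_class L0 lt M A \<longrightarrow>
        (\<exists>B\<in>fg_over L0 M F. isomorphic (ext_lang L0) B A)"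
    using F unfolding fraisse_limit_def by (elim conjE) assumption
  have F4: "\<forall>B\<in>fg_over L0 M F. \<forall>C\<in>fg_over L0 M F. \<forall>h. is_iso (ext_lang L0) h B C \<longrightarrow>
        (\<exists>g. is_iso (ext_lang L0) g F F \<and> (\<forall>x\<in>univ B. g x = h x))"
    using F unfolding fraisse_limit_def by (elim conjE) assumption
  obtain B k where B: "B \<in> fg_over L0 M F" and k: "is_iso (ext_lang L0) k B C"
    using F3 C unfolding isomorphic_def by blast
  obtain X where BX: "B = restrict_to F X" and MX: "M_part F \<subseteq> X"
    using B Mp unfolding fg_over_def by blast
  have XF: "X \<subseteq> univ F"
  proof -
    obtain S where S: "S \<subseteq> univ F" "B = restrict_to F (generated (ext_lang L0) F S \<union> Inl ` univ M)"
      using B unfolding fg_over_def by blast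
    then have "X = generated (ext_lang L0) F S \<union> Inl ` univ M" using BX by (metis restrict_to_simps(1))
    moreover have "generated (ext_lang L0) F S \<subseteq> univ F"
      using K_likeD(1)[OF FK] S(1) unfolding generated_def is_struct_def by blast
    ultimately show ?thesis using M_part_subset[of F] Mp by blast
  qed
  have kbij: "bij_betw k X (univ C)" using is_iso_bij[OF k] BX by simp
  have kV: "x \<in> V_part F \<longleftrightarrow> k x \<in> V_part C" if "x \<in> X" for x
    using is_iso_rel[OF k, of V_sym "[x]"] that kbij XF
    by (auto simp: V_part_def BX bij_betw_def)
  have kM: "x \<in> M_part F \<longleftrightarrow> k x \<in> M_part C" if "x \<in> X" for x
    using is_iso_rel[OF k, of M_sym "[x]"] that kbij XF
    by (auto simp: M_part_def BX bij_betw_def)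
  have kN: "relI F N_sym [x] \<longleftrightarrow> relI C N_sym [k x]" if "x \<in> X" for x
    using is_iso_rel[OF k, of N_sym "[x]"] that by (simp add: BX)
  have kT: "tri F x y \<longleftrightarrow> tri C (k x) (k y)" if "x \<in> X" "y \<in> X" for x y
    using is_iso_rel[OF k, of Tri_sym "[x, y]"] that by (simp add: BX)
  have kF: "k (fI F x y) = fI C (k x) (k y)" "fI F x y \<in> X" if "x \<in> X" "y \<in> X" for x y
    using is_iso_fun[OF k, of F_sym "[x, y]"] that
      is_struct_closed[OF is_iso_struct(1)[OF k], of F_sym "[x, y]"] by (simp_all add: BX)
  define j where "j = inv_into X k"
  have j: "j y \<in> X" "k (j y) = y" if "y \<in> univ C" for y
    using that kbij bij_betw_inv_into_right[OF kbij that] unfolding j_def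
    by (auto simp: bij_betw_def inv_into_into)
  have VC: "V_part C \<subseteq> univ C" and VF: "V_part F \<subseteq> univ F" by (rule V_part_subset)+
  have jV: "j y \<in> X" "k (j y) = y" "j y \<in> V_part F" if "y \<in> V_part C" for y
    using that j[of y] VC kV[of "j y"] by auto
  txt \<open>The copy of \<open>A\<close> inside \<open>B\<close> is carried to \<open>A\<close> by an automorphism, which takes the copy of \<open>z\<close>
    to the required point.\<close>
  define A' where "A' = (\<lambda>a. j (e a)) ` A"
  have A'F: "A' \<subseteq> V_part F" "finite A'" using jV e(2) A by (auto simp: A'_def)
  let ?D = "restrict_to F (A' \<union> M_part F)" and ?E = "restrict_to F (A \<union> M_part F)"
  have sub: "A' \<union> M_part F \<subseteq> univ F" "A \<union> M_part F \<subseteq> univ F"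
    using A'F A VF M_part_subset[of F] by blast+
  have DE: "?D \<in> fg_over L0 M F" "?E \<in> fg_over L0 M F"
    using K_like_fg_over[OF FK Mp(1)] A'F A sub by auto
  note DK = K_like_superset[OF FK Un_upper2 sub(1)] and EK = K_like_superset[OF FK Un_upper2 sub(2)]
  have disj: "V_part F \<inter> M_part F = {}" by (rule K_likeD(4)[OF FK])
  have DV: "V_part ?D = A'" "V_part ?E = A"
    using V_part_restrict[OF sub(1)] V_part_restrict[OF sub(2)] A'F A disj by auto
  define g where "g x = inv_into A e (k x)" for x
  have gj: "g (j (e a)) = a" if "a \<in> A" for a
    using that jV(2) e by (simp add: g_def)
  \<comment> \<open>\<open>k\<close> need not fix the M-part pointwise; it induces an automorphism
    there. The partial isomorphism must follow \<open>k\<close> on the M-part, so that the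
    automorphism extending it carries the values of \<open>f\<close> to those prescribed by
    \<open>C\<close>.\<close>
  have kM_iso: "is_iso L0 k (M_struct F) (M_struct F)"
  proof (rule is_isoI)
    show "is_struct L0 (M_struct F)" "is_struct L0 (M_struct F)" by (rule K_likeD(2)[OF FK])+
    have "k ` M_part F = M_part C"
    proof (intro equalityI subsetI)
      fix y assume y: "y \<in> M_part C"
      then have "y \<in> univ C" using M_part_subset[of C] by blast
      then show "y \<in> k ` M_part F" using j[of y] kM[of "j y"] y by (metis image_eqI)
    qed (use kM MX in auto)
    moreover have "inj_on k (M_part F)" using kbij MX by (auto simp: bij_betw_def intro: inj_on_subset)
    ultimately show "bij_betw k (univ (M_struct F)) (univ (M_struct F))"
      using Mp by (simp add: bij_betw_def)
    have CF: "is_iso L0 (Inl \<circ> inv_into (univ M) Inl) (M_struct C) (M_struct F)"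
      by (rule is_iso_trans[OF is_iso_sym[OF CM] FM])
    have CF': "is_iso L0 (\<lambda>x. x) (M_struct C) (M_struct F)"
      by (rule is_iso_cong[OF CF]) (use Mp in \<open>auto simp: f_inv_into_f\<close>)
    {
      fix s xs assume *: "s \<in> Funs L0" "length xs = farity L0 s" "set xs \<subseteq> univ (M_struct F)"
      then have "set (map k xs) \<subseteq> M_part C" using kM MX by auto
      then have "funI C (OldF s) (map k xs) = funI F (OldF s) (map k xs)"
        using is_iso_fun[OF CF' *(1), of "map k xs"] *(2) by simp
      then show "k (funI (M_struct F) s xs) = funI (M_struct F) s (map k xs)"
        using is_iso_fun[OF k, of "OldF s" xs] * MX by (auto simp: BX)
    next
      fix s xs assume *: "s \<in> Rels L0" "length xs = rarity L0 s" "set xs \<subseteq> univ (M_struct F)"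
      then have "set (map k xs) \<subseteq> M_part C" using kM MX by auto
      then have "relI C (OldR s) (map k xs) = relI F (OldR s) (map k xs)"
        using is_iso_rel[OF CF' *(1), of "map k xs"] *(2) by simp
      then show "relI (M_struct F) s xs = relI (M_struct F) s (map k xs)"
        using is_iso_rel[OF k, of "OldR s" xs] * MX by (auto simp: BX)
    }
  qed
  let ?h = "\<lambda>x. if x \<in> M_part ?D then k x else g x"
  have "is_iso (ext_lang L0) ?h ?D ?E"
  proof (rule is_iso_glue[OF DK(1) EK(1)])
    show "is_iso L0 k (M_struct ?D) (M_struct ?E)" using kM_iso DK(2) EK(2) by simp
    have "inj_on g A'" using gj by (auto simp: A'_def inj_on_def)
    moreover have "g ` A' = A" using gj by (auto simp: A'_def image_image)
    ultimately show "bij_betw g (V_part ?D) (V_part ?E)" using DV by (simp add: bij_betw_def)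
    fix x assume "x \<in> V_part ?D"
    then obtain a where a: "a \<in> A" "x = j (e a)" using DV by (auto simp: A'_def)
    show "relI ?D N_sym [x] \<longleftrightarrow> relI ?E N_sym [g x]"
      using kN[of x] jV[of "e a"] e(2) eN a gj by simp
    fix y assume "y \<in> V_part ?D"
    then obtain b where b: "b \<in> A" "y = j (e b)" using DV by (auto simp: A'_def)
    show "tri ?D x y \<longleftrightarrow> tri ?E (g x) (g y)"
      using kT[of x y] jV[of "e a"] jV[of "e b"] e(2) eT a b gj by simp
    assume "x \<noteq> y"
    then have "a \<noteq> b" using a b by blast
    then show "k (fI ?D x y) = fI ?E (g x) (g y)"
      using kF[of x y] jV[of "e a"] jV[of "e b"] e(2) eF a b gj by simp
  qed
  then obtain \<sigma> where \<sigma>: "is_iso (ext_lang L0) \<sigma> F F" "\<And>x. x \<in> A' \<union> M_part F \<Longrightarrow> \<sigma> x = ?h x"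
    using F4 DE by fastforce
  have \<sigma>M: "\<sigma> x = k x" if "x \<in> M_part F" for x using \<sigma>(2)[of x] that DK(3) by simp
  have \<sigma>A: "\<sigma> (j (e a)) = a" if "a \<in> A" for a
  proof -
    have "j (e a) \<in> A'" using that by (auto simp: A'_def)
    moreover from this have "j (e a) \<notin> M_part F" using A'F disj by blast
    ultimately show ?thesis using \<sigma>(2)[of "j (e a)"] DK(3) gj that by simp
  qed
  let ?w = "\<sigma> (j z)"
  have bij: "bij_betw \<sigma> (univ F) (univ F)" by (rule is_iso_bij[OF \<sigma>(1)])
  have u: "x \<in> univ F" if "x \<in> X" for x using that XF by blast
  show ?thesis
  proof (rule bexI[of _ ?w], intro conjI ballI)
    have jz: "j z \<in> univ F" "j z \<in> V_part F" using jV z VF by blast+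
    have "?w \<in> univ F" using jz bij by (auto simp: bij_betw_def)
    then show "?w \<in> V_part F"
      using is_iso_rel[OF \<sigma>(1), of V_sym "[j z]"] jz by (simp add: V_part_def)
    show "relI F N_sym [?w] \<longleftrightarrow> relI C N_sym [z]"
      using is_iso_rel[OF \<sigma>(1), of N_sym "[j z]"] jz kN[of "j z"] jV[OF z(1)] by simp
    fix a assume a: "a \<in> A"
    have ja: "j (e a) \<in> X" "k (j (e a)) = e a" "j (e a) \<in> V_part F" using jV e(2) a by blast+
    have jzX: "j z \<in> X" "k (j z) = z" using jV z by blast+
    show "tri F a ?w \<longleftrightarrow> tri C (e a) z"
      using is_iso_rel[OF \<sigma>(1), of Tri_sym "[j (e a), j z]"] \<sigma>A[OF a] kT[OF ja(1) jzX(1)] ja jzX u by simp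
    show "tri F ?w a \<longleftrightarrow> tri C z (e a)"
      using is_iso_rel[OF \<sigma>(1), of Tri_sym "[j z, j (e a)]"] \<sigma>A[OF a] kT[OF jzX(1) ja(1)] ja jzX u by simp
    have "e a \<noteq> z" using z a by blast
    then have ne: "j (e a) \<noteq> j z" using ja jzX by metis
    have fM: "fI F (j (e a)) (j z) \<in> M_part F"
      by (rule convex_ultrametric.f_in[OF K_likeD(5)[OF FK] ja(3) jz(2) ne])
    have "fI F a ?w = \<sigma> (fI F (j (e a)) (j z))"
      using is_iso_fun[OF \<sigma>(1), of F_sym "[j (e a), j z]"] \<sigma>A[OF a] ja jzX u by simp
    then show "fI F a ?w = fI C (e a) z"
      using \<sigma>M[OF fM] kF(1)[OF ja(1) jzX(1)] ja jzX by simp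
  qed
qed

lemma fraisse_limit_rich:
  assumes F: "fraisse_limit L0 lt M F" and lin: "strict_linorder_on (univ M) (\<lambda>x y. relI M lt [x, y])"
    and lt: "lt \<in> Rels L0" "rarity L0 lt = 2" and M: "is_struct L0 M" "countable (univ M)"
  shows "rich_struct F"
proof -
  \<comment> \<open>Points with constant mutual closeness \<open>m\<close> satisfy the triple
    condition by its first alternative, whatever \<open>m\<close> and the colours are. Three of them
    supply a new point above (\<open>2\<close> over \<open>0\<close>), below (\<open>0\<close> under
    \<open>2\<close>) and between (\<open>1\<close>).\<close>
  define C :: "_ \<Rightarrow> (nat \<Rightarrow> bool) \<Rightarrow> (_ + nat, _, _) ext_struct" where
    "C m N = ext_of M {0, 1, 2} (<) (\<lambda>_ _. m) N" for m N
  have C: "K_class L0 lt M (C m N)" if "m \<in> univ M" for m N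
  proof (rule K_like_imp_K_class)
    show "K_like L0 lt (C m N)"
      unfolding C_def
    proof (rule ext_of_K_like[OF M(1) lt(2)])
      show "convex_ultrametric {0, 1, 2 :: nat} (<) (univ M) (\<lambda>x y. relI M lt [x, y]) (\<lambda>_ _. m)"
        by unfold_locales (use that lin in \<open>auto intro: strict_linorder_onI\<close>)
    qed
  qed (use M in \<open>auto simp: C_def ext_of_M_part_is\<close>)
  have "is_iso L0 Inl M (M_struct F)" using F unfolding fraisse_limit_def M_part_is_def by simp
  from is_iso_bij[OF this] have Mp: "M_part F = Inl ` univ M" by (simp add: bij_betw_def)
  have FK: "K_like L0 lt F" by (rule fraisse_limit_K_like[OF F lin lt])
  interpret convex_ultrametric "V_part F" "tri F" "M_part F" "\<lambda>x y. relI F (OldR lt) [x, y]" "fI F"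
    by (rule K_likeD(5)[OF FK])
  note real = fraisse_limit_realizes[OF F lin lt C]
  show ?thesis
    unfolding rich_def
  proof (intro conjI ballI allI impI)
    obtain m where m: "m \<in> univ M" using M by (auto simp: is_struct_def)
    then show "M_part F \<noteq> {}" using Mp by blast
    show "V_part F \<noteq> {}"
      using real[OF m, of "{}" "\<lambda>_. Inr 0" "\<lambda>_. True" "Inr 0"] by (auto simp: C_def)
  next
    fix b m c assume b: "b \<in> V_part F" and m: "m \<in> M_part F"
    then obtain m' where m': "m' \<in> univ M" "m = Inl m'" using Mp by blast
    have irr: "\<not> tri F b b" using V_irrefl b by blast
    show "\<exists>z\<in>V_part F. tri F b z \<and> fI F b z = m \<and> relI F N_sym [z] = c"
      using real[OF m'(1), of "{b}" "\<lambda>_. Inr 0" "\<lambda>i. if i = 0 then relI F N_sym [b] else c" "Inr 2"] b m' irr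
      by (auto simp: C_def)
    show "\<exists>z\<in>V_part F. tri F z b \<and> fI F b z = m \<and> relI F N_sym [z] = c"
      using real[OF m'(1), of "{b}" "\<lambda>_. Inr 2" "\<lambda>i. if i = 2 then relI F N_sym [b] else c" "Inr 0"] b m' irr
      by (auto simp: C_def)
  next
    fix b b' c assume b: "b \<in> V_part F" "b' \<in> V_part F" "tri F b b'"
    then have irr: "\<not> tri F b b" "\<not> tri F b' b'" "\<not> tri F b' b" "b \<noteq> b'" "b' \<noteq> b"
      using V_irrefl V_asym by blast+
    then obtain m where m: "m \<in> univ M" "fI F b b' = Inl m" "fI F b' b = Inl m"
      using f_in[OF b(1,2)] f_sym[OF b(1,2)] Mp by force
    show "\<exists>z\<in>V_part F. tri F b z \<and> tri F z b' \<and> fI F b z = fI F b b' \<and> fI F b' z = fI F b b' \<and>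
            relI F N_sym [z] = c"
    proof -
      let ?e = "\<lambda>x. if x = b then Inr 0 else Inr 2"
      let ?C = "C m (\<lambda>i. if i = 0 then relI F N_sym [b] else if i = 2 then relI F N_sym [b'] else c)"
      have "\<exists>w\<in>V_part F. (relI F N_sym [w] \<longleftrightarrow> relI ?C N_sym [Inr 1]) \<and>
        (\<forall>a\<in>{b, b'}. (tri F a w \<longleftrightarrow> tri ?C (?e a) (Inr 1)) \<and> (tri F w a \<longleftrightarrow> tri ?C (Inr 1) (?e a)) \<and>
           fI F a w = fI ?C (?e a) (Inr 1))"
        by (rule real[OF m(1)]) (use b m irr in \<open>auto simp: C_def\<close>)
      then show ?thesis using irr m by (auto simp: C_def)
    qed
  qed
qed

subsection \<open>Finitely supported functions\<close>

text \<open>A dense and codense set of rationals, which colours the values of the functions below.\<close>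

definition odd_denom :: "rat \<Rightarrow> bool" where
  "odd_denom q \<longleftrightarrow> (\<exists>k n :: int. odd n \<and> q = of_int k / of_int n)"

lemma odd_denom_dense:
  fixes r s :: rat
  assumes "r < s"
  shows "\<exists>q. r < q \<and> q < s \<and> odd_denom q = c"
proof -
  obtain j :: nat where j: "1 / (s - r) < of_nat j" using reals_Archimedean2 by blast
  \<comment> \<open>An odd \<open>n\<close> with \<open>1 / n\<close> less than
    \<open>s - r\<close>: the multiples of \<open>1 / n\<close>, and likewise their shifts by half a
    step, must meet the interval.\<close>
  define n :: int where "n = 2 * int j + 1"
  have n: "odd n" "0 < (of_int n :: rat)" by (simp_all add: n_def)
  have "1 / (s - r) < of_int n" using j by (simp add: n_def)
  then have gap: "1 < (s - r) * of_int n" using assms by (simp add: divide_less_eq mult.commute)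
  show ?thesis
  proof (cases c)
    case True
    define k where "k = \<lfloor>r * of_int n\<rfloor> + 1"
    have "r * of_int n < of_int k" "of_int k \<le> r * of_int n + 1" unfolding k_def by linarith+
    then have "r < of_int k / of_int n" "of_int k / of_int n < s"
      using n gap by (simp_all add: field_simps)
    moreover have "odd_denom (of_int k / of_int n)" using n(1) unfolding odd_denom_def by blast
    ultimately show ?thesis using True by blast
  next
    case False
    \<comment> \<open>The candidate is \<open>(k + 1/2) / n\<close>, hence the shift by one half. As
      \<open>(2 * k + 1) / (2 * n)\<close> it has an odd numerator over an even denominator, and
      cross-multiplying shows by parity that no fraction with odd denominator equals it.\<close>
    define k where "k = \<lfloor>r * of_int n - 1 / 2\<rfloor> + 1"
    let ?q = "of_int (2 * k + 1) / of_int (2 * n) :: rat"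
    have "r * of_int n - 1 / 2 < of_int k" "of_int k \<le> r * of_int n - 1 / 2 + 1"
      unfolding k_def by linarith+
    then have "r < ?q" "?q < s" using n gap by (simp_all add: field_simps)
    moreover have "\<not> odd_denom ?q"
    proof
      assume "odd_denom ?q"
      then obtain a b :: int where ab: "odd b" "?q = of_int a / of_int b" unfolding odd_denom_def by blast
      then have "b \<noteq> 0" "n \<noteq> 0" using n by auto
      then have "(of_int ((2 * k + 1) * b) :: rat) = of_int (a * (2 * n))"
        using ab(2) frac_eq_eq[of "of_int (2 * n) :: rat" "of_int b" "of_int (2 * k + 1)" "of_int a"]
        by (simp only: of_int_mult) simp
      then have "(2 * k + 1) * b = a * (2 * n)" by (simp only: of_int_eq_iff)
      moreover have "odd ((2 * k + 1) * b)" using ab(1) by simp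
      ultimately show False by simp
    qed
    ultimately show ?thesis using False by blast
  qed
qed

text \<open>The value \<open>q0\<close> plays the role of zero. New values have to avoid it because
  the colour is read at a nonzero value, and \<open>col\<close> takes both truth values everywhere
  so that any colour can be had on any side.\<close>

locale lex_space =
  fixes U :: "'u set" and r :: "'u \<Rightarrow> 'u \<Rightarrow> bool" and Q :: "'q set" and lq :: "'q \<Rightarrow> 'q \<Rightarrow> bool"
    and col :: "'q \<Rightarrow> bool" and q0 :: 'q
  assumes U_lin: "strict_linorder_on U r" and U_ne: "U \<noteq> {}"
    and Q_lin: "strict_linorder_on Q lq" and q0_in: "q0 \<in> Q"
    and Q_up: "a \<in> Q \<Longrightarrow> \<exists>q\<in>Q. lq a q \<and> col q = c \<and> q \<noteq> q0"
    and Q_down: "a \<in> Q \<Longrightarrow> \<exists>q\<in>Q. lq q a \<and> col q = c \<and> q \<noteq> q0"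
    and Q_between: "a \<in> Q \<Longrightarrow> b \<in> Q \<Longrightarrow> lq a b \<Longrightarrow> \<exists>q\<in>Q. lq a q \<and> lq q b \<and> col q = c \<and> q \<noteq> q0"
begin

definition fin_funs :: "('u \<Rightarrow> 'q) set" where
  "fin_funs = {x. (\<forall>u. u \<notin> U \<longrightarrow> x u = q0) \<and> (\<forall>u\<in>U. x u \<in> Q) \<and> finite {u\<in>U. x u \<noteq> q0}}"

definition first_diff :: "('u \<Rightarrow> 'q) \<Rightarrow> ('u \<Rightarrow> 'q) \<Rightarrow> 'u \<Rightarrow> bool" where
  "first_diff x y m \<longleftrightarrow> m \<in> U \<and> x m \<noteq> y m \<and> (\<forall>u\<in>U. r u m \<longrightarrow> x u = y u)"

definition diff_point :: "('u \<Rightarrow> 'q) \<Rightarrow> ('u \<Rightarrow> 'q) \<Rightarrow> 'u" where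
  "diff_point x y = (THE m. first_diff x y m)"

definition lex_less :: "('u \<Rightarrow> 'q) \<Rightarrow> ('u \<Rightarrow> 'q) \<Rightarrow> bool" where
  "lex_less x y \<longleftrightarrow> (\<exists>m. first_diff x y m \<and> lq (x m) (y m))"

text \<open>The last place is used because \<open>branch\<close> erases everything after the
  deviation, which frees the colour of the new point from that of the old one. The zero function has
  no such place and is 0-coloured.\<close>

definition top_color :: "('u \<Rightarrow> 'q) \<Rightarrow> bool" where
  "top_color x \<longleftrightarrow> (\<exists>m\<in>U. x m \<noteq> q0 \<and> (\<forall>u\<in>U. r m u \<longrightarrow> x u = q0) \<and> col (x m))"

lemmas r_irrefl = strict_linorder_onD(1)[OF U_lin]
lemmas r_trans = strict_linorder_onD(2)[OF U_lin]
lemmas r_total = strict_linorder_onD(3)[OF U_lin]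
lemmas r_asym = strict_linorder_onD(4)[OF U_lin]

lemma first_diff_unique: "first_diff x y m \<Longrightarrow> first_diff x y m' \<Longrightarrow> m = m'"
  using r_total unfolding first_diff_def by metis

lemma diff_point_eq: "first_diff x y m \<Longrightarrow> diff_point x y = m"
  unfolding diff_point_def using first_diff_unique by blast

lemma lex_less_iff: "first_diff x y m \<Longrightarrow> lex_less x y \<longleftrightarrow> lq (x m) (y m)"
  unfolding lex_less_def using first_diff_unique by blast

lemma first_diff_sym: "first_diff x y m \<longleftrightarrow> first_diff y x m"
  unfolding first_diff_def by metis

lemma diff_point_sym: "diff_point x y = diff_point y x"
proof -
  have "first_diff x y = first_diff y x" using first_diff_sym by blast
  then show ?thesis unfolding diff_point_def by simp
qed

text \<open>Finite supports leave only finitely many places of difference, so a least one exists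
  although \<open>U\<close> need not be well-ordered.\<close>

lemma first_diff_ex:
  assumes "x \<in> fin_funs" "y \<in> fin_funs" "x \<noteq> y"
  shows "\<exists>m. first_diff x y m"
proof -
  let ?S = "{u \<in> U. x u \<noteq> y u}"
  have "?S \<subseteq> {u \<in> U. x u \<noteq> q0} \<union> {u \<in> U. y u \<noteq> q0}" by auto
  then have "finite ?S" using assms unfolding fin_funs_def by (auto intro: finite_subset)
  moreover have "?S \<noteq> {}"
  proof
    assume "?S = {}"
    then have "x u = y u" for u using assms unfolding fin_funs_def by (cases "u \<in> U") auto
    then show False using assms(3) by blast
  qed
  ultimately obtain m where m: "m \<in> ?S" "\<And>s. s \<in> ?S \<Longrightarrow> s \<noteq> m \<Longrightarrow> r m s"
    using finite_strict_linorder_has_min[OF _ _ _ U_lin, of ?S] by blast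
  then have "first_diff x y m" unfolding first_diff_def using r_asym r_irrefl by blast
  then show ?thesis by blast
qed

lemma in_Q: "x \<in> fin_funs \<Longrightarrow> u \<in> U \<Longrightarrow> x u \<in> Q"
  unfolding fin_funs_def by blast

lemma first_diff_in: "first_diff x y m \<Longrightarrow> m \<in> U"
  unfolding first_diff_def by blast

text \<open>At the earlier of the places \<open>m\<close> and \<open>n\<close> one pair already
  differs while the other still agrees, so \<open>x\<close> and \<open>z\<close> first differ there.
  At a common place, transitivity on values applies.\<close>

lemma lex_triple:
  assumes V: "x \<in> fin_funs" "y \<in> fin_funs" "z \<in> fin_funs"
    and xy: "first_diff x y m" "lq (x m) (y m)" and yz: "first_diff y z n" "lq (y n) (z n)"
  shows "m = n \<and> first_diff x z m \<and> lq (x m) (z m) \<or>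
    r m n \<and> first_diff x z m \<and> lq (x m) (z m) \<or> r n m \<and> first_diff x z n \<and> lq (x n) (z n)"
proof -
  have mn: "m \<in> U" "n \<in> U" using xy yz first_diff_in by blast+
  consider "m = n" | "r m n" | "r n m" using r_total mn by blast
  then show ?thesis
  proof cases
    case 1
    have "lq (x m) (z m)"
      using strict_linorder_onD(2)[OF Q_lin in_Q[OF V(1) mn(1)] in_Q[OF V(2) mn(1)] in_Q[OF V(3) mn(1)]]
        xy yz 1 by blast
    moreover from this have "x m \<noteq> z m"
      using strict_linorder_onD(1)[OF Q_lin] in_Q[OF V(1) mn(1)] by metis
    ultimately show ?thesis using xy yz 1 unfolding first_diff_def by simp
  next
    case 2
    have "y m = z m" using yz 2 mn unfolding first_diff_def by blast
    moreover have "x u = z u" if "u \<in> U" "r u m" for u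
      using that xy yz r_trans[OF that(1) mn that(2) 2] unfolding first_diff_def by metis
    ultimately show ?thesis using xy 2 unfolding first_diff_def by auto
  next
    case 3
    have "x n = y n" using xy 3 mn unfolding first_diff_def by blast
    moreover have "x u = z u" if "u \<in> U" "r u n" for u
      using that xy yz r_trans[OF that(1) mn(2,1) that(2) 3] unfolding first_diff_def by metis
    ultimately show ?thesis using yz 3 unfolding first_diff_def by auto
  qed
qed

lemma lex_convex_ultrametric: "convex_ultrametric fin_funs lex_less U r diff_point"
proof
  show "strict_linorder_on fin_funs lex_less"
  proof (rule strict_linorder_onI)
    show "\<not> lex_less x x" for x unfolding lex_less_def first_diff_def by blast
    show "lex_less x z" if "x \<in> fin_funs" "y \<in> fin_funs" "z \<in> fin_funs" "lex_less x y" "lex_less y z" for x y z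
      using that lex_triple[OF that(1-3)] unfolding lex_less_def by metis
    show "lex_less x y \<or> lex_less y x" if xy: "x \<in> fin_funs" "y \<in> fin_funs" "x \<noteq> y" for x y
    proof -
      obtain m where m: "first_diff x y m" using first_diff_ex[OF xy] by blast
      then have "lq (x m) (y m) \<or> lq (y m) (x m)"
        using strict_linorder_onD(3)[OF Q_lin] in_Q[OF xy(1)] in_Q[OF xy(2)] unfolding first_diff_def by blast
      then show ?thesis using m first_diff_sym unfolding lex_less_def by blast
    qed
  qed
  show "strict_linorder_on U r" by (rule U_lin)
  show "diff_point x y = diff_point y x" for x y by (rule diff_point_sym)
  show "diff_point x y \<in> U" if xy: "x \<in> fin_funs" "y \<in> fin_funs" "x \<noteq> y" for x y
    using first_diff_ex[OF xy] diff_point_eq first_diff_in by metis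
  fix x y z assume V: "x \<in> fin_funs" "y \<in> fin_funs" "z \<in> fin_funs" and "lex_less x y" "lex_less y z"
  then obtain m n where mn: "first_diff x y m" "lq (x m) (y m)" "first_diff y z n" "lq (y n) (z n)"
    unfolding lex_less_def by blast
  from lex_triple[OF V mn]
  show "diff_point x y = diff_point x z \<and> diff_point x z = diff_point y z \<or>
       diff_point x y = diff_point x z \<and> r (diff_point x z) (diff_point y z) \<or>
       diff_point x z = diff_point y z \<and> r (diff_point y z) (diff_point x y)"
    using diff_point_eq[OF mn(1)] diff_point_eq[OF mn(3)] diff_point_eq[of x z] by auto
qed

text \<open>The witness for all three clauses of richness: keeping \<open>b\<close> below
  \<open>m\<close> makes \<open>m\<close> the first difference, the value \<open>q\<close> decides
  the side, and zeros afterwards make \<open>q\<close> the last nonzero value.\<close>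

definition branch :: "('u \<Rightarrow> 'q) \<Rightarrow> 'u \<Rightarrow> 'q \<Rightarrow> 'u \<Rightarrow> 'q" where
  "branch b m q u = (if u \<in> U \<and> r u m then b u else if u = m then q else q0)"

lemma branch_in: "b \<in> fin_funs \<Longrightarrow> m \<in> U \<Longrightarrow> q \<in> Q \<Longrightarrow> branch b m q \<in> fin_funs"
proof -
  assume b: "b \<in> fin_funs" "m \<in> U" "q \<in> Q"
  have "{u \<in> U. branch b m q u \<noteq> q0} \<subseteq> insert m {u \<in> U. b u \<noteq> q0}" by (auto simp: branch_def)
  moreover have "finite {u \<in> U. b u \<noteq> q0}" using b unfolding fin_funs_def by blast
  ultimately have "finite {u \<in> U. branch b m q u \<noteq> q0}" using finite_subset by blast
  then show ?thesis using b q0_in unfolding fin_funs_def by (auto simp: branch_def)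
qed

lemma branch_first_diff: "m \<in> U \<Longrightarrow> q \<noteq> b m \<Longrightarrow> first_diff b (branch b m q) m"
  using r_irrefl unfolding first_diff_def branch_def by auto

lemma branch_at: "m \<in> U \<Longrightarrow> branch b m q m = q"
  using r_irrefl unfolding branch_def by auto

lemma branch_color:
  assumes "m \<in> U" "q \<noteq> q0"
  shows "top_color (branch b m q) \<longleftrightarrow> col q"
proof
  assume "top_color (branch b m q)"
  then obtain n where n: "n \<in> U" "branch b m q n \<noteq> q0" "\<forall>u\<in>U. r n u \<longrightarrow> branch b m q u = q0" "col (branch b m q n)"
    unfolding top_color_def by blast
  have "n = m"
  proof (rule ccontr)
    assume "n \<noteq> m"
    then have "r n m" using n(2) by (auto simp: branch_def split: if_splits)
    then show False using n(3) assms branch_at[of m b q] by simp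
  qed
  then show "col q" using n(4) branch_at assms by simp
next
  assume "col q"
  moreover have "branch b m q u = q0" if "u \<in> U" "r m u" for u
    using that assms r_asym r_irrefl unfolding branch_def by auto
  ultimately show "top_color (branch b m q)"
    unfolding top_color_def using assms branch_at[OF assms(1), of b q] by (intro bexI[of _ m]) simp_all
qed

lemma lex_rich: "rich fin_funs lex_less U diff_point top_color"
  unfolding rich_def
proof (intro conjI ballI allI impI)
  have "(\<lambda>_. q0) \<in> fin_funs" using q0_in unfolding fin_funs_def by simp
  then show "fin_funs \<noteq> {}" by blast
  show "U \<noteq> {}" by (rule U_ne)
next
  fix b m c assume b: "b \<in> fin_funs" and m: "m \<in> U"
  note irr = strict_linorder_onD(1)[OF Q_lin]
  obtain q where q: "q \<in> Q" "lq (b m) q" "col q = c" "q \<noteq> q0" using Q_up in_Q[OF b m] by blast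
  then have "q \<noteq> b m" using irr by blast
  then have d: "first_diff b (branch b m q) m" by (intro branch_first_diff m)
  show "\<exists>z\<in>fin_funs. lex_less b z \<and> diff_point b z = m \<and> top_color z = c"
    using branch_in[OF b m q(1)] d diff_point_eq[OF d] branch_color[OF m q(4)] q branch_at[OF m]
    unfolding lex_less_def by (intro bexI[of _ "branch b m q"]) auto
  obtain q where q: "q \<in> Q" "lq q (b m)" "col q = c" "q \<noteq> q0" using Q_down in_Q[OF b m] by blast
  then have "q \<noteq> b m" using irr by blast
  then have d: "first_diff b (branch b m q) m" by (intro branch_first_diff m)
  show "\<exists>z\<in>fin_funs. lex_less z b \<and> diff_point b z = m \<and> top_color z = c"
    using branch_in[OF b m q(1)] d[THEN first_diff_sym[THEN iffD1]] diff_point_eq[OF d]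
      branch_color[OF m q(4)] q branch_at[OF m]
    unfolding lex_less_def by (intro bexI[of _ "branch b m q"]) auto
next
  fix b b' c assume b: "b \<in> fin_funs" "b' \<in> fin_funs" "lex_less b b'"
  note irr = strict_linorder_onD(1)[OF Q_lin]
  obtain m where m: "first_diff b b' m" "lq (b m) (b' m)" using b(3) unfolding lex_less_def by blast
  have mU: "m \<in> U" using m(1) first_diff_in by blast
  obtain q where q: "q \<in> Q" "lq (b m) q" "lq q (b' m)" "col q = c" "q \<noteq> q0"
    using Q_between[OF in_Q[OF b(1) mU] in_Q[OF b(2) mU] m(2)] by blast
  then have ne: "q \<noteq> b m" "q \<noteq> b' m" using irr by blast+
  have d: "first_diff b (branch b m q) m" by (intro branch_first_diff mU ne(1))
  \<comment> \<open>Below \<open>m\<close> the functions \<open>b\<close> and \<open>b'\<close>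
    agree, so the witness built from \<open>b\<close> first differs from \<open>b'\<close> at
    \<open>m\<close> as well.\<close>
  have d': "first_diff (branch b m q) b' m"
    using m(1) ne(2) branch_at[OF mU] unfolding first_diff_def branch_def by auto
  have "diff_point b' (branch b m q) = m" using diff_point_eq[OF d'] diff_point_sym by metis
  then show "\<exists>z\<in>fin_funs. lex_less b z \<and> lex_less z b' \<and> diff_point b z = diff_point b b' \<and>
      diff_point b' z = diff_point b b' \<and> top_color z = c"
    using branch_in[OF b(1) mU q(1)] d d' diff_point_eq[OF d] diff_point_eq[OF m(1)]
      branch_color[OF mU q(5)] q branch_at[OF mU]
    unfolding lex_less_def by (intro bexI[of _ "branch b m q"]) auto
qed

end

section \<open>Cardinality of the space of finitely supported functions\<close>

lemma card_of_Times_ordLeq_infinite: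
  "infinite C \<Longrightarrow> |A| \<le>o |C| \<Longrightarrow> |B| \<le>o |C| \<Longrightarrow> |A \<times> B| \<le>o |C|"
  by (rule card_of_Times_ordLeq_infinite_Field[OF _ _ _ card_of_Card_order]) (simp_all add: Field_card_of)

text \<open>Finite powers of an infinite set do not exceed it, and neither does the union over the
  countably many lengths.\<close>

lemma card_of_lists_ordLeq:
  assumes "infinite A"
  shows "|lists A| \<le>o |A|"
proof -
  have "|{xs \<in> lists A. length xs = n}| \<le>o |A|" for n
  proof (induction n)
    case 0
    have "{xs \<in> lists A. length xs = 0} = {[]}" by auto
    moreover have "|{[]}| \<le>o |A|"
      using assms by (metis card_of_singl_ordLeq finite.emptyI)
    ultimately show ?case by simp
  next
    case (Suc n)
    have "{xs \<in> lists A. length xs = Suc n} \<subseteq> (\<lambda>(x, xs). x # xs) ` (A \<times> {xs \<in> lists A. length xs = n})"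
      by (force simp: length_Suc_conv)
    then have "|{xs \<in> lists A. length xs = Suc n}| \<le>o |A \<times> {xs \<in> lists A. length xs = n}|"
      by (rule ordLeq_transitive[OF card_of_mono1 card_of_image])
    moreover have "|A \<times> {xs \<in> lists A. length xs = n}| \<le>o |A|"
      by (intro card_of_Times_ordLeq_infinite assms Suc card_of_mono1 subset_refl)
    ultimately show ?case using ordLeq_transitive by blast
  qed
  moreover have "lists A = (\<Union>n. {xs \<in> lists A. length xs = n})" by auto
  moreover have "|UNIV :: nat set| \<le>o |A|" using assms by (simp add: infinite_iff_card_of_nat)
  ultimately show ?thesis
    using card_of_UNION_ordLeq_infinite[OF assms, of "UNIV :: nat set" "\<lambda>n. {xs \<in> lists A. length xs = n}"]
    by auto
qed

text \<open>A function is determined by the finite graph of its nonzero values, and finite subsets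
  of an infinite set are images of lists over it.\<close>

lemma (in lex_space) card_of_fin_funs:
  assumes "infinite (U \<times> Q)"
  shows "|fin_funs| \<le>o |U \<times> Q|"
proof -
  define gr where "gr x = {(u, x u) | u. u \<in> U \<and> x u \<noteq> q0}" for x :: "'u \<Rightarrow> 'q"
  have "inj_on gr fin_funs"
  proof (rule inj_onI)
    fix x y assume xy: "x \<in> fin_funs" "y \<in> fin_funs" and "gr x = gr y"
    then have eq: "(u, q) \<in> gr x \<longleftrightarrow> (u, q) \<in> gr y" for u q by simp
    show "x = y"
    proof
      fix u
      show "x u = y u"
      proof (cases "u \<in> U")
        case True
        then show ?thesis using eq[of u "x u"] eq[of u "y u"] by (auto simp: gr_def)
      next
        case False
        then show ?thesis using xy by (simp add: fin_funs_def)
      qed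
    qed
  qed
  moreover have "gr ` fin_funs \<subseteq> set ` lists (U \<times> Q)"
  proof
    fix s assume "s \<in> gr ` fin_funs"
    then obtain x where x: "x \<in> fin_funs" "s = gr x" by blast
    have "gr x = (\<lambda>u. (u, x u)) ` {u \<in> U. x u \<noteq> q0}" by (auto simp: gr_def)
    moreover have "finite {u \<in> U. x u \<noteq> q0}" using x unfolding fin_funs_def by blast
    ultimately have "finite (gr x)" by simp
    then obtain xs where "set xs = gr x" using finite_list by blast
    moreover have "gr x \<subseteq> U \<times> Q" using x in_Q by (auto simp: gr_def)
    ultimately show "s \<in> set ` lists (U \<times> Q)" using x by (metis image_eqI in_listsI subsetD)
  qed
  ultimately have "|fin_funs| \<le>o |set ` lists (U \<times> Q)|" using card_of_ordLeq by blast
  then show ?thesis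
    using ordLeq_transitive[OF card_of_image card_of_lists_ordLeq[OF assms]] ordLeq_transitive by blast
qed

subsection \<open>Rich structures model the Scott sentence of the Fraisse limit\<close>

lemma scott_sentence_reflecting:
  assumes "countable_lang L" "scott_sentence L M p" "is_model L A p"
  shows "\<exists>PP. countable PP \<and> (\<forall>X\<subseteq>univ A. reflects (univ A) PP X \<longrightarrow>
     is_struct L (restrict_to A X) \<and> (countable X \<longrightarrow> isomorphic L (restrict_to A X) M))"
proof -
  have "is_struct L A" "sentence L p" using assms unfolding is_model_def scott_sentence_def by blast+
  from is_model_reflecting[OF assms(1) this]
  obtain PP where PP: "countable PP" "\<And>X. X \<subseteq> univ A \<Longrightarrow> reflects (univ A) PP X \<Longrightarrow>
      is_struct L (restrict_to A X) \<and> (is_model L (restrict_to A X) p \<longleftrightarrow> is_model L A p)" by blast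
  show ?thesis
  proof (intro exI[of _ PP] conjI allI impI)
    fix X assume X: "X \<subseteq> univ A" "reflects (univ A) PP X"
    show st: "is_struct L (restrict_to A X)" using PP(2)[OF X] by blast
    assume "countable X"
    then show "isomorphic L (restrict_to A X) M"
      using scott_sentence_iff[OF assms(2) st] PP(2)[OF X] assms(3) by simp
  qed (rule PP(1))
qed

text \<open>The axioms of a linear order concern at most three elements, and these lie in a
  countable substructure isomorphic to \<open>M\<close>. This makes the order of \<open>M1\<close>
  available, of which only \<open>\<phi>\<close> and the cardinality are known.\<close>

lemma scott_model_strict_linorder:
  assumes "countable_lang L" "scott_sentence L M p" "is_model L A p"
    and lt: "lt \<in> Rels L" "rarity L lt = 2"
    and lin: "strict_linorder_on (univ M) (\<lambda>x y. relI M lt [x, y])"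
  shows "strict_linorder_on (univ A) (\<lambda>x y. relI A lt [x, y])"
proof -
  obtain PP where PP: "countable PP" "\<And>X. X \<subseteq> univ A \<Longrightarrow> reflects (univ A) PP X \<Longrightarrow>
      countable X \<Longrightarrow> isomorphic L (restrict_to A X) M"
    using scott_sentence_reflecting[OF assms(1-3)] by blast
  have *: "\<exists>X. S \<subseteq> X \<and> strict_linorder_on X (\<lambda>x y. relI A lt [x, y])" if S: "finite S" "S \<subseteq> univ A" for S
  proof -
    obtain X where X: "countable X" "S \<subseteq> X" "X \<subseteq> univ A" "reflects (univ A) PP X"
      using countable_reflecting_set[OF PP(1) countable_finite[OF S(1)] S(2)] by blast
    then obtain h where h: "is_iso L h (restrict_to A X) M"
      using PP(2)[OF X(3,4,1)] unfolding isomorphic_def by blast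
    have b: "bij_betw h X (univ M)" using is_iso_bij[OF h] by simp
    have "strict_linorder_on X (\<lambda>x y. relI A lt [x, y])"
    proof (rule strict_linorder_on_image[OF lin, of _ h])
      show "h y \<in> univ M" if "y \<in> X" for y using b that by (auto simp: bij_betw_def)
      show "inj_on h X" using b by (simp add: bij_betw_def)
      show "relI A lt [x, y] \<longleftrightarrow> relI M lt [h x, h y]" if "x \<in> X" "y \<in> X" for x y
        using is_iso_rel[OF h lt(1), of "[x, y]"] lt(2) that by simp
    qed
    then show ?thesis using X(2) by blast
  qed
  show ?thesis
  proof (rule strict_linorder_onI)
    fix x assume "x \<in> univ A"
    then obtain X where "x \<in> X" "strict_linorder_on X (\<lambda>x y. relI A lt [x, y])"
      using *[of "{x}"] by auto
    then show "\<not> relI A lt [x, x]" using strict_linorder_onD(1) by fast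
  next
    fix x y assume "x \<in> univ A" "y \<in> univ A" and ne: "x \<noteq> y"
    then obtain X where X: "x \<in> X" "y \<in> X" "strict_linorder_on X (\<lambda>x y. relI A lt [x, y])"
      using *[of "{x, y}"] by auto
    from strict_linorder_onD(3)[OF X(3,1,2) ne]
    show "relI A lt [x, y] \<or> relI A lt [y, x]" .
  next
    fix x y z assume "x \<in> univ A" "y \<in> univ A" "z \<in> univ A" and R: "relI A lt [x, y]" "relI A lt [y, z]"
    then obtain X where X: "x \<in> X" "y \<in> X" "z \<in> X" "strict_linorder_on X (\<lambda>x y. relI A lt [x, y])"
      using *[of "{x, y, z}"] by auto
    from strict_linorder_onD(2)[OF X(4,1,2,3) R] show "relI A lt [x, z]" .
  qed
qed

text \<open>The clauses of \<open>rich\<close> in the form needed for \<open>reflects\<close>, with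
  parameters read from the list; lists of other lengths or contents only add further witnesses. The
  first predicate keeps the V-part nonempty.\<close>

definition rich_preds :: "('a, 'f, 'r) ext_struct \<Rightarrow> ('a list \<Rightarrow> 'a \<Rightarrow> bool) set" where
  "rich_preds A = insert (\<lambda>xs z. z \<in> V_part A)
     (range (\<lambda>c xs z. z \<in> V_part A \<and> tri A (xs ! 0) z \<and> fI A (xs ! 0) z = xs ! 1 \<and> relI A N_sym [z] = c) \<union>
      range (\<lambda>c xs z. z \<in> V_part A \<and> tri A z (xs ! 0) \<and> fI A (xs ! 0) z = xs ! 1 \<and> relI A N_sym [z] = c) \<union>
      range (\<lambda>c xs z. z \<in> V_part A \<and> tri A (xs ! 0) z \<and> tri A z (xs ! 1) \<and>
         fI A (xs ! 0) z = fI A (xs ! 0) (xs ! 1) \<and> fI A (xs ! 1) z = fI A (xs ! 0) (xs ! 1) \<and>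
         relI A N_sym [z] = c))"

lemma rich_struct_restrict:
  assumes rich: "rich_struct A" and X: "X \<subseteq> univ A" and refl: "reflects (univ A) (rich_preds A) X"
    and ne: "M_part A \<inter> X \<noteq> {}"
  shows "rich_struct (restrict_to A X)"
  unfolding rich_def V_part_restrict[OF X] M_part_restrict[OF X] restrict_to_simps
proof (intro conjI ballI allI impI)
  have VA: "V_part A \<subseteq> univ A" by (rule V_part_subset)
  show "M_part A \<inter> X \<noteq> {}" by fact
  obtain v where "v \<in> V_part A" using richD(1)[OF rich] by blast
  then show "V_part A \<inter> X \<noteq> {}"
    using reflectsD[OF refl, of "\<lambda>xs z. z \<in> V_part A" "[]" v] VA by (auto simp: rich_preds_def)
  fix b m c assume b: "b \<in> V_part A \<inter> X" and m: "m \<in> M_part A \<inter> X"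
  note bm = IntD1[OF b] IntD1[OF m]
  obtain z where "z \<in> V_part A" "tri A b z" "fI A b z = m" "relI A N_sym [z] = c"
    using richD(3)[OF rich bm, of c] by blast
  then have "\<exists>z\<in>X. z \<in> V_part A \<and> tri A ([b, m] ! 0) z \<and> fI A ([b, m] ! 0) z = [b, m] ! 1 \<and> relI A N_sym [z] = c"
    by (intro reflectsD[OF refl, of "\<lambda>xs z. z \<in> V_part A \<and> tri A (xs ! 0) z \<and> fI A (xs ! 0) z = xs ! 1 \<and>
        relI A N_sym [z] = c" "[b, m]" z]) (use b m VA in \<open>auto simp: rich_preds_def\<close>)
  then show "\<exists>z\<in>V_part A \<inter> X. tri A b z \<and> fI A b z = m \<and> relI A N_sym [z] = c" by auto
  obtain z where "z \<in> V_part A" "tri A z b" "fI A b z = m" "relI A N_sym [z] = c"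
    using richD(4)[OF rich bm, of c] by blast
  then have "\<exists>z\<in>X. z \<in> V_part A \<and> tri A z ([b, m] ! 0) \<and> fI A ([b, m] ! 0) z = [b, m] ! 1 \<and> relI A N_sym [z] = c"
    by (intro reflectsD[OF refl, of "\<lambda>xs z. z \<in> V_part A \<and> tri A z (xs ! 0) \<and> fI A (xs ! 0) z = xs ! 1 \<and>
        relI A N_sym [z] = c" "[b, m]" z]) (use b m VA in \<open>auto simp: rich_preds_def\<close>)
  then show "\<exists>z\<in>V_part A \<inter> X. tri A z b \<and> fI A b z = m \<and> relI A N_sym [z] = c" by auto
next
  have VA: "V_part A \<subseteq> univ A" by (rule V_part_subset)
  fix b b' c assume b: "b \<in> V_part A \<inter> X" "b' \<in> V_part A \<inter> X" "tri A b b'"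
  obtain z where "z \<in> V_part A" "tri A b z" "tri A z b'" "fI A b z = fI A b b'"
    "fI A b' z = fI A b b'" "relI A N_sym [z] = c"
    using richD(5)[OF rich IntD1[OF b(1)] IntD1[OF b(2)] b(3), of c] by blast
  then have "\<exists>z\<in>X. z \<in> V_part A \<and> tri A ([b, b'] ! 0) z \<and> tri A z ([b, b'] ! 1) \<and>
         fI A ([b, b'] ! 0) z = fI A ([b, b'] ! 0) ([b, b'] ! 1) \<and>
         fI A ([b, b'] ! 1) z = fI A ([b, b'] ! 0) ([b, b'] ! 1) \<and> relI A N_sym [z] = c"
    by (intro reflectsD[OF refl, of "\<lambda>xs z. z \<in> V_part A \<and> tri A (xs ! 0) z \<and> tri A z (xs ! 1) \<and>
         fI A (xs ! 0) z = fI A (xs ! 0) (xs ! 1) \<and> fI A (xs ! 1) z = fI A (xs ! 0) (xs ! 1) \<and>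
         relI A N_sym [z] = c" "[b, b']" z]) (use b VA in \<open>auto simp: rich_preds_def\<close>)
  then show "\<exists>z\<in>V_part A \<inter> X. tri A b z \<and> tri A z b' \<and> fI A b z = fI A b b' \<and> fI A b' z = fI A b b' \<and>
      relI A N_sym [z] = c" by auto
qed

lemma rich_models_fraisse_scott_sentence:
  assumes L0: "countable_lang L0" and lt: "lt \<in> Rels L0" "rarity L0 lt = 2"
    and M: "is_struct L0 M" "countable (univ M)"
    and lin: "strict_linorder_on (univ M) (\<lambda>x y. relI M lt [x, y])"
    and \<phi>: "scott_sentence L0 M \<phi>" and F: "fraisse_limit L0 lt M F"
    and \<phi>F: "scott_sentence (ext_lang L0) F \<phi>F"
    and G: "K_like L0 lt G" "rich_struct G" "is_model L0 (M_struct G) \<phi>"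
  shows "is_model (ext_lang L0) G \<phi>F"
proof -
  have cL: "countable_lang (ext_lang L0)"
    using L0 unfolding countable_lang_def ext_lang_def by simp
  have "sentence (ext_lang L0) \<phi>F" using \<phi>F unfolding scott_sentence_def by blast
  from is_model_reflecting[OF cL K_likeD(1)[OF G(1)] this]
  obtain PP where PP: "countable PP" "\<And>X. X \<subseteq> univ G \<Longrightarrow> reflects (univ G) PP X \<Longrightarrow>
      is_struct (ext_lang L0) (restrict_to G X) \<and>
      (is_model (ext_lang L0) (restrict_to G X) \<phi>F \<longleftrightarrow> is_model (ext_lang L0) G \<phi>F)" by blast
  from scott_sentence_reflecting[OF L0 \<phi> G(3)]
  obtain QQ where QQ: "countable QQ" "\<And>X. X \<subseteq> M_part G \<Longrightarrow> reflects (M_part G) QQ X \<Longrightarrow>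
      is_struct L0 (restrict_to (M_struct G) X) \<and>
      (countable X \<longrightarrow> isomorphic L0 (restrict_to (M_struct G) X) M)" by auto
  \<comment> \<open>\<open>QQ\<close> is to be reflected inside the M-part, while \<open>X\<close>
    is built in the whole universe; restricting the witnesses to the M-part reconciles the
    two.\<close>
  define QQ' where "QQ' = (\<lambda>P xs z. z \<in> M_part G \<and> P xs z) ` QQ"
  have "countable (PP \<union> (QQ' \<union> rich_preds G))"
    using PP(1) QQ(1) by (simp add: QQ'_def rich_preds_def)
  from countable_reflecting_set[OF this, of "{}" "univ G"]
  obtain X where X: "countable X" "X \<subseteq> univ G" "reflects (univ G) PP X" "reflects (univ G) QQ' X"
    "reflects (univ G) (rich_preds G) X" by (auto simp: reflects_Un)
  let ?H = "restrict_to G X"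
  have "reflects (M_part G) QQ (M_part G \<inter> X)"
    unfolding reflects_def
  proof (intro ballI allI impI)
    fix P xs assume P: "P \<in> QQ" "set xs \<subseteq> M_part G \<inter> X" "\<exists>z\<in>M_part G. P xs z"
    then obtain z where z: "z \<in> M_part G" "P xs z" by blast
    have "\<exists>z\<in>X. z \<in> M_part G \<and> P xs z"
    proof (rule reflectsD[OF X(4)])
      show "(\<lambda>xs z. z \<in> M_part G \<and> P xs z) \<in> QQ'" using P by (simp add: QQ'_def)
    qed (use P z M_part_subset[of G] in auto)
    then show "\<exists>z\<in>M_part G \<inter> X. P xs z" by blast
  qed
  from QQ(2)[OF Int_lower1 this] X(1)
  have HM: "is_struct L0 (M_struct ?H)" "isomorphic L0 (M_struct ?H) M"
    unfolding M_struct_restrict[OF X(2)] by auto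
  have HK: "K_like L0 lt ?H"
    by (rule K_like_restrict[OF G(1) X(2) conjunct1[OF PP(2)[OF X(2,3)]] HM(1)])
  have Hr: "rich_struct ?H"
  proof (rule rich_struct_restrict[OF G(2) X(2,5)])
    show "M_part G \<inter> X \<noteq> {}" using HM(1) M_part_restrict[OF X(2)] by (simp add: is_struct_def)
  qed
  have FM: "is_iso L0 Inl M (M_struct F)" and Fc: "countable (univ F)"
    using F unfolding fraisse_limit_def M_part_is_def by simp_all
  from FM have "isomorphic L0 M (M_struct F)" unfolding isomorphic_def by blast
  then obtain h where h: "is_iso L0 h (M_struct ?H) (M_struct F)"
    using isomorphic_trans[OF HM(2)] unfolding isomorphic_def by blast
  have "isomorphic (ext_lang L0) ?H F"
    by (rule rich_struct_iso[OF HK fraisse_limit_K_like[OF F lin lt] lt Hr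
          fraisse_limit_rich[OF F lin lt M] _ Fc h]) (simp add: X(1))
  then have "is_model (ext_lang L0) ?H \<phi>F"
    using scott_sentence_iff[OF \<phi>F K_likeD(1)[OF HK]] X(1) by simp
  then show ?thesis using PP(2)[OF X(2,3)] by blast
qed

section \<open>The order of values and the final model\<close>

lemma lex_space_lex_prod:
  assumes U: "strict_linorder_on U r" "U \<noteq> {}" and L: "strict_linorder_on L ltL" "l0 \<in> L"
  shows "lex_space U r (L \<times> UNIV) (\<lambda>(l, s) (l', s'). ltL l l' \<or> l = l' \<and> s < s')
     (\<lambda>(l, s). odd_denom s) (l0, 0)"
proof
  let ?lq = "\<lambda>(l, s) (l', s'). ltL l l' \<or> l = l' \<and> s < (s' :: rat)"
  note irr = strict_linorder_onD(1)[OF L(1)] and tr = strict_linorder_onD(2)[OF L(1)]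
    and tot = strict_linorder_onD(3)[OF L(1)]
  show "strict_linorder_on U r" "U \<noteq> {}" "(l0, 0) \<in> L \<times> UNIV" using assms by auto
  show "strict_linorder_on (L \<times> UNIV) ?lq"
  proof (rule strict_linorder_onI)
    show "\<not> ?lq x x" if "x \<in> L \<times> UNIV" for x using that irr by (cases x) auto
    show "?lq x z" if "x \<in> L \<times> UNIV" "y \<in> L \<times> UNIV" "z \<in> L \<times> UNIV" "?lq x y" "?lq y z" for x y z
    proof -
      obtain a s b s' d s'' where [simp]: "x = (a, s)" "y = (b, s')" "z = (d, s'')"
        by (cases x; cases y; cases z) blast
      have "ltL a b \<Longrightarrow> ltL b d \<Longrightarrow> ltL a d" using tr[of a b d] that(1-3) by simp
      then show ?thesis using that(4,5) by auto
    qed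
    show "?lq x y \<or> ?lq y x" if "x \<in> L \<times> UNIV" "y \<in> L \<times> UNIV" "x \<noteq> y" for x y
      using that tot by (cases x; cases y) force
  qed
  \<comment> \<open>A nonzero rational keeps a pair distinct from \<open>(l0, 0)\<close> whatever
    its first coordinate is. To avoid 0, a second rational is taken below the first one: at most one
    of the two is 0.\<close>
  have dense: "\<exists>q. s < q \<and> q < s' \<and> odd_denom q = c \<and> q \<noteq> 0" if ss': "s < s'" for s s' c
  proof -
    obtain q where q: "s < q" "q < s'" "odd_denom q = c" using odd_denom_dense[OF ss'] by blast
    obtain q' where q': "s < q'" "q' < q" "odd_denom q' = c" using odd_denom_dense[OF q(1)] by blast
    show ?thesis using q q' by (cases "q = 0") (auto intro: exI[of _ q] exI[of _ q'])
  qed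
  fix a c assume a: "a \<in> L \<times> (UNIV :: rat set)"
  obtain l s where ls: "a = (l, s)" "l \<in> L" using a by auto
  obtain q where "s < q" "odd_denom q = c" "q \<noteq> 0" using dense[of s "s + 1"] by auto
  then show "\<exists>q\<in>L \<times> UNIV. ?lq a q \<and> (case q of (l, s) \<Rightarrow> odd_denom s) = c \<and> q \<noteq> (l0, 0)"
    using ls by (intro bexI[of _ "(l, q)"]) auto
  obtain q where "q < s" "odd_denom q = c" "q \<noteq> 0" using dense[of "s - 1" s] by auto
  then show "\<exists>q\<in>L \<times> UNIV. ?lq q a \<and> (case q of (l, s) \<Rightarrow> odd_denom s) = c \<and> q \<noteq> (l0, 0)"
    using ls by (intro bexI[of _ "(l, q)"]) auto
  fix b assume b: "b \<in> L \<times> UNIV" and lt: "?lq a b"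
  obtain l' s' where ls': "b = (l', s')" "l' \<in> L" using b by auto
  show "\<exists>q\<in>L \<times> UNIV. ?lq a q \<and> ?lq q b \<and> (case q of (l, s) \<Rightarrow> odd_denom s) = c \<and> q \<noteq> (l0, 0)"
  proof (cases "ltL l l'")
    case True
    \<comment> \<open>Even if \<open>l'\<close> immediately follows \<open>l\<close> in
      \<open>L\<close>, the copy of the rationals over \<open>l\<close> has no greatest element, so
      there is room above \<open>(l, s)\<close>.\<close>
    obtain q where "s < q" "odd_denom q = c" "q \<noteq> 0" using dense[of s "s + 1"] by auto
    then show ?thesis using ls ls' True by (intro bexI[of _ "(l, q)"]) auto
  next
    case False
    then have "l = l'" "s < s'" using lt ls ls' by auto
    then obtain q where "s < q" "q < s'" "odd_denom q = c" "q \<noteq> 0" using dense[of s s'] by auto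
    then show ?thesis using ls ls' \<open>l = l'\<close> by (intro bexI[of _ "(l, q)"]) auto
  qed
qed

theorem theorem4p14:
  fixes L0 :: "('f, 'r) lang"
    and lt :: 'r
    and M :: "('m, 'f, 'r) struct"
    and \<phi> :: "('f, 'r) fm"
    and F :: "('m + nat, 'f, 'r) ext_struct"
    and \<phi>F :: "('f ext_fun, 'r ext_rel) fm"
    and M1 :: "('b, 'f, 'r) struct"
    and L :: "'l set"
    and ltL :: "'l \<Rightarrow> 'l \<Rightarrow> bool"
  assumes "countable_lang L0"
    and "lt \<in> Rels L0" and "rarity L0 lt = 2"
    and "is_struct L0 M" and "countable (univ M)"
    and "strict_linorder_on (univ M) (\<lambda>x y. relI M lt [x, y])"
    and "scott_sentence L0 M \<phi>"
    and "\<exists>A :: (nat set, 'f, 'r) struct. is_model L0 A \<phi> \<and> |univ A| =o aleph1"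
    and "\<not> (\<exists>A :: (nat set set, 'f, 'r) struct. is_model L0 A \<phi> \<and> |univ A| =o aleph2)"
    and "fraisse_limit L0 lt M F"
    and "scott_sentence (ext_lang L0) F \<phi>F"
    and "is_model L0 M1 \<phi>" and "|univ M1| =o aleph1"
    and "strict_linorder_on L ltL" and "aleph1 \<le>o |L|"
  shows "\<exists>(G :: ('b + 'l, 'f, 'r) ext_struct) (emb :: 'l \<Rightarrow> 'b + 'l).
           is_model (ext_lang L0) G \<phi>F \<and>
           |univ G| =o |L| \<and>
           M_part_is L0 G M1 \<and>
           inj_on emb L \<and> emb ` L \<subseteq> V_part G \<and>
           (\<forall>x\<in>L. \<forall>y\<in>L. ltL x y \<longleftrightarrow> tri G (emb x) (emb y)) \<and>
           (\<forall>x\<in>L. zero_colored G (emb x))"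
proof -
  let ?U = "univ M1" and ?r = "\<lambda>x y. relI M1 lt [x, y]"
  have M1: "is_struct L0 M1" using assms(12) unfolding is_model_def by blast
  have U_lin: "strict_linorder_on ?U ?r"
    by (rule scott_model_strict_linorder[OF assms(1,7,12,2,3,6)])
  have nL: "natLeq \<le>o |L|"
    by (rule ordLeq_transitive[OF cardSuc_ordLeq[OF natLeq_Card_order] assms(15)])
  then have infL: "infinite L" using infinite_iff_natLeq_ordLeq[of L] by blast
  then obtain l0 where l0: "l0 \<in> L" by fastforce
  have UL: "|?U| \<le>o |L|" by (rule ordIso_ordLeq_trans[OF assms(13,15)])
  obtain m0 where m0: "m0 \<in> ?U" using M1 by (auto simp: is_struct_def)
  let ?lq = "\<lambda>(l, s) (l', s'). ltL l l' \<or> l = l' \<and> s < (s' :: rat)"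
  interpret S: lex_space ?U ?r "L \<times> UNIV" ?lq "\<lambda>(l, s). odd_denom s" "(l0, 0)"
    by (rule lex_space_lex_prod[OF U_lin _ assms(14) l0]) (use m0 in blast)
  interpret C: convex_ultrametric S.fin_funs S.lex_less ?U ?r S.diff_point
    by (rule S.lex_convex_ultrametric)
  \<comment> \<open>Failing \<open>odd_denom\<close> will give colour 0, and being nonzero keeps
    \<open>(l, s0)\<close> distinct from the zero value \<open>(l0, 0)\<close> even for
    \<open>l = l0\<close>.\<close>
  obtain s0 where s0: "\<not> odd_denom s0" "s0 \<noteq> 0" using odd_denom_dense[of 0 1 False] by auto
  define x where "x l = S.branch (\<lambda>_. (l0, 0)) m0 (l, s0)" for l
  have x_in: "x l \<in> S.fin_funs" if "l \<in> L" for l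
    unfolding x_def by (rule S.branch_in) (use that m0 l0 in \<open>auto simp: S.fin_funs_def\<close>)
  have x_at: "x l m0 = (l, s0)" for l unfolding x_def by (rule S.branch_at[OF m0])
  have x_color: "\<not> S.top_color (x l)" for l
    unfolding x_def using S.branch_color[OF m0, of "(l, s0)"] s0 by simp
  have x_inj: "inj_on x L" using x_at by (metis inj_onI prod.inject)
  \<comment> \<open>For distinct elements of \<open>L\<close> the functions first differ at
    \<open>m0\<close>, where their rational coordinates coincide, so the order of \<open>L\<close>
    decides.\<close>
  have x_less: "S.lex_less (x l) (x l') \<longleftrightarrow> ltL l l'" if "l \<in> L" "l' \<in> L" for l l'
  proof (cases "l = l'")
    case True
    then show ?thesis
      using C.V_irrefl[OF x_in[OF that(1)]] strict_linorder_onD(1)[OF assms(14) that(1)] by simp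
  next
    case False
    have "x l u = x l' u" if "?r u m0" "u \<in> ?U" for u
      using that unfolding x_def S.branch_def by simp
    then have d: "S.first_diff (x l) (x l') m0"
      unfolding S.first_diff_def using m0 x_at False by auto
    show ?thesis unfolding S.lex_less_iff[OF d] x_at using False by simp
  qed
  \<comment> \<open>The functions \<open>x l\<close> bound the cardinality from below; from above,
    the infinite set \<open>L\<close> absorbs \<open>?U\<close> and the rationals.\<close>
  have card: "|S.fin_funs| =o |L|"
  proof (rule ordIso_iff_ordLeq[THEN iffD2, OF conjI])
    have "|UNIV :: rat set| \<le>o |L|"
    proof -
      have "|UNIV :: rat set| \<le>o |UNIV :: nat set|"
        using card_of_ordLeq[of "UNIV :: rat set" "UNIV :: nat set"] inj_to_nat by blast
      moreover have "|UNIV :: nat set| \<le>o |L|" using infL infinite_iff_card_of_nat by blast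
      ultimately show ?thesis by (rule ordLeq_transitive)
    qed
    then have "|L \<times> (UNIV :: rat set)| \<le>o |L|"
      by (intro card_of_Times_ordLeq_infinite infL card_of_mono1 subset_refl)
    then have "|?U \<times> (L \<times> (UNIV :: rat set))| \<le>o |L|"
      by (rule card_of_Times_ordLeq_infinite[OF infL UL])
    moreover have "infinite (?U \<times> (L \<times> (UNIV :: rat set)))"
      using infL m0 by (auto simp: finite_cartesian_product_iff)
    ultimately show "|S.fin_funs| \<le>o |L|"
      by (rule ordLeq_transitive[OF S.card_of_fin_funs, rotated])
    show "|L| \<le>o |S.fin_funs|"
      by (rule card_of_ordLeq[THEN iffD1]) (use x_inj x_in in blast)
  qed
  \<comment> \<open>The V-part has to live on the type of \<open>L\<close>, so the functions are
    renamed by elements of \<open>L\<close> through an arbitrary bijection. The order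
    \<open>t\<close> arising this way is not \<open>ltL\<close>, which is why the embedding passes
    through \<open>inv_into L \<beta>\<close>.\<close>
  obtain \<beta> where \<beta>: "bij_betw \<beta> L S.fin_funs"
    using card_of_ordIso[of L S.fin_funs] ordIso_symmetric[OF card] by blast
  define t where "t a b = S.lex_less (\<beta> a) (\<beta> b)" for a b
  define f where "f a b = S.diff_point (\<beta> a) (\<beta> b)" for a b
  define N where "N a = S.top_color (\<beta> a)" for a
  have \<beta>_in: "\<beta> a \<in> S.fin_funs" if "a \<in> L" for a using \<beta> that by (auto simp: bij_betw_def)
  have \<beta>_inj: "inj_on \<beta> L" using \<beta> by (simp add: bij_betw_def)
  have f_in: "f a b \<in> ?U" if "a \<in> L" "b \<in> L" "a \<noteq> b" for a b
    unfolding f_def using that C.f_in[OF \<beta>_in \<beta>_in] \<beta>_inj by (auto dest: inj_onD)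
  have cu: "convex_ultrametric L t ?U ?r f"
    by (rule convex_ultrametric_transfer[OF S.lex_convex_ultrametric \<beta>_inj, of "\<lambda>u. u"])
      (use \<beta>_in f_in in \<open>auto simp: t_def f_def\<close>)
  have ri: "rich L t ?U f N"
    by (rule rich_transfer[OF S.lex_rich \<beta>, of "\<lambda>u. u"])
      (use \<beta>_in f_in C.V_irrefl in \<open>auto simp: t_def f_def N_def bij_betw_def\<close>)
  define G where "G = ext_of M1 L t f N"
  have GK: "K_like L0 lt G" unfolding G_def by (rule ext_of_K_like[OF M1 assms(3) cu])
  have Gr: "rich_struct G"
    unfolding G_def
    by (rule ext_of_rich[OF ri]) (use convex_ultrametric.V_irrefl[OF cu] f_in in auto)
  have GM: "M_part_is L0 G M1" unfolding G_def by (rule ext_of_M_part_is[OF M1])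
  have "wf_fm L0 \<phi>" using assms(7) unfolding scott_sentence_def sentence_def by blast
  then have "is_model L0 (M_struct G) \<phi>"
    using is_model_iso GM assms(12) unfolding M_part_is_def by blast
  then have Gmod: "is_model (ext_lang L0) G \<phi>F"
    by (rule rich_models_fraisse_scott_sentence[OF assms(1-7,10,11) GK Gr])
  define emb :: "'l \<Rightarrow> 'b + 'l" where "emb l = Inr (inv_into L \<beta> (x l))" for l
  have inv: "inv_into L \<beta> (x l) \<in> L" "\<beta> (inv_into L \<beta> (x l)) = x l" if "l \<in> L" for l
    using \<beta> x_in[OF that] by (auto simp: bij_betw_def inv_into_into f_inv_into_f)
  show ?thesis
  proof (intro exI[of _ G] exI[of _ emb] conjI ballI)
    show "inj_on emb L"
    proof (rule inj_onI)
      fix l l' assume l: "l \<in> L" "l' \<in> L" and "emb l = emb l'"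
      then have "x l = x l'" using inv by (metis emb_def sum.inject(2))
      then show "l = l'" using x_inj l by (auto dest: inj_onD)
    qed
    have "|univ G| =o |?U <+> L|" unfolding G_def by (simp add: Plus_def card_of_refl)
    moreover have "|?U <+> L| =o |L|" by (rule card_of_Plus_infinite2[OF infL UL])
    ultimately show "|univ G| =o |L|" using ordIso_transitive by blast
    show "emb ` L \<subseteq> V_part G" using inv by (auto simp: G_def emb_def)
    show "zero_colored G (emb l)" if "l \<in> L" for l
      using inv[OF that] x_color by (auto simp: zero_colored_def G_def emb_def N_def)
    show "ltL l l' \<longleftrightarrow> tri G (emb l) (emb l')" if "l \<in> L" "l' \<in> L" for l l'
      using inv that x_less by (simp add: G_def emb_def t_def)
  qed (fact Gmod GM)+
qed

end
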